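(* Let $\Gamma$ be a compact metric graph with vertex partition $\mathcal{V}=\mathcal{V}_K\sqcup\mathcal{V}_D$. Let $a,\kappa\in\mathbb{L}_\infty(\Gamma)$ with $\inf_\Gamma a>0$ and $\inf_\Gamma\kappa>0$, and assume that $a$ is Lipschitz on $\Gamma$. Let $\mathcal{L}=\kappa^2-\nabla(a\nabla)$ and $L=1-\Delta_\Gamma$, both with Kirchhoff conditions on $\mathcal{V}_K$ and Dirichlet conditions on $\mathcal{V}_D$. Then for every $\alpha\in[0,2]$, $\dot H^{\alpha}_{\mathcal{L}}\cong\dot H^{\alpha}$, where $\dot H^\alpha_{\mathcal{L}}=\mathcal{D}(\mathcal{L}^{\alpha/2})$ and $\dot H^\alpha=\mathcal{D}(L^{\alpha/2})$.
   Context: $\Gamma$ is a compact metric graph: it is obtained from a finite connected graph (loops and multiple edges allowed) by identifying every edge $e\in\mathcal{E}$ with an interval $[0,l_e]$, $0<l_e<\infty$, and gluing together the interval endpoints that correspond to the same vertex. "Lipschitz on $\Gamma$" is with respect to the geodesic distance (in particular $a$ is continuous at the vertices). Each edge has two natural parameterizations $\zeta:[0,l_e]\to e$ (the two orientations); functions on $e$ are identified with functions on $[0,l_e]$. $\mathbb{L}_2(\Gamma)=\bigoplus_e\mathbb{L}_2(e)$ (real-valued). $\nabla$ is the edgewise weak derivative with respect to a fixed orientation of each edge ($\nabla(a\nabla u)$ does not depend on it) and $\Delta=\nabla^2$. $H^2(\Gamma)$ is the space of continuous functions on $\Gamma$ that are in $H^2(0,l_e)$ on each edge, with norm$^2$ $\sum_e\|u\|_{H^2(e)}^2$.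 $K(\Gamma)$ denotes the Kirchhoff conditions $\sum_{(e,\zeta):\zeta(0)=v}(u\circ\zeta)'(0^+)=0$ for every $v\in\mathcal{V}_K$ (sum over all pairs of an edge and a natural parameterization starting at $v$; a loop contributes two terms). $D(\Gamma)$ denotes the conditions $u(v)=0$ for every $v\in\mathcal{V}_D$. $L u=u-\Delta u$ and $\mathcal{L}u=\kappa^2u-\nabla(a\nabla u)$ (edgewise), each with domain $H^2(\Gamma)\cap K(\Gamma)\cap D(\Gamma)$, are self-adjoint positive operators on $\mathbb{L}_2(\Gamma)$ with compact inverse. For such an operator $A$ with orthonormal eigenbasis $\{\psi_i\}$ and eigenvalues $\mu_i>0$, and $\alpha\ge0$, $\mathcal{D}(A^{\alpha/2})=\{u\in\mathbb{L}_2(\Gamma):\sum_i\mu_i^\alpha\langle u,\psi_i\rangle^2<\infty\}$ with norm$^2$ $\sum_i\mu_i^\alpha\langle u,\psi_i\rangle^2$. $X\cong Y$ means equality as sets with equivalent norms. *)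

theory Defs
  imports "HOL-Analysis.Analysis" "Graph_Theory.Digraph_Component"
begin

section \<open>Compact metric graphs\<close>

text \<open>
  The combinatorial graph is a finite multigraph (loops and parallel arcs allowed). Each undirected
  edge is listed once, as an arc; its direction is the fixed reference orientation of the edge.
\<close>

locale compact_metric_graph = fin_digraph G
  for G :: "('v, 'e) pre_digraph" (structure) +
  fixes len :: "'e \<Rightarrow> real"
  assumes connected_graph: "Digraph_Component.connected G"
    and len_pos: "e \<in> arcs G \<Longrightarrow> 0 < len e"

datatype ('v, 'e) mg_point = Vertex 'v | Interior 'e real

definition mg_points :: "('v, 'e) pre_digraph \<Rightarrow> ('e \<Rightarrow> real) \<Rightarrow> ('v, 'e) mg_point set" where
  "mg_points G len = Vertex ` verts G \<union> {Interior e t | e t. e \<in> arcs G \<and> 0 < t \<and> t < len e}"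

text \<open>The two natural parameterizations of \<open>e\<close>, both meant on \<open>{0..len e}\<close>:
  along the reference orientation (\<open>True\<close>) and against it (\<open>False\<close>).\<close>

definition edge_pt :: "('v, 'e) pre_digraph \<Rightarrow> ('e \<Rightarrow> real) \<Rightarrow> 'e \<Rightarrow> real \<Rightarrow> ('v, 'e) mg_point" where
  "edge_pt G len e t =
     (if t = 0 then Vertex (tail G e) else if t = len e then Vertex (head G e) else Interior e t)"

definition nat_param ::
    "('v, 'e) pre_digraph \<Rightarrow> ('e \<Rightarrow> real) \<Rightarrow> 'e \<Rightarrow> bool \<Rightarrow> real \<Rightarrow> ('v, 'e) mg_point" where
  "nat_param G len e d t = edge_pt G len e (if d then t else len e - t)"

text \<open>\<open>mg_path G len p q r\<close>: a concatenation of finitely many edge segments, of total length \<open>r\<close>,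
  joins \<open>p\<close> to \<open>q\<close>.\<close>

inductive mg_path ::
    "('v, 'e) pre_digraph \<Rightarrow> ('e \<Rightarrow> real) \<Rightarrow> ('v, 'e) mg_point \<Rightarrow> ('v, 'e) mg_point \<Rightarrow> real \<Rightarrow> bool"
  for G len where
  refl: "p \<in> mg_points G len \<Longrightarrow> mg_path G len p p 0"
| step: "mg_path G len p (edge_pt G len e s) r \<Longrightarrow> e \<in> arcs G \<Longrightarrow> s \<in> {0..len e} \<Longrightarrow> t \<in> {0..len e}
    \<Longrightarrow> mg_path G len p (edge_pt G len e t) (r + \<bar>t - s\<bar>)"

definition geodesic_dist ::
    "('v, 'e) pre_digraph \<Rightarrow> ('e \<Rightarrow> real) \<Rightarrow> ('v, 'e) mg_point \<Rightarrow> ('v, 'e) mg_point \<Rightarrow> real" where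
  "geodesic_dist G len p q = Inf {r. mg_path G len p q r}"

type_synonym ('v, 'e) mg_fun = "('v, 'e) mg_point \<Rightarrow> real"

definition on_edge ::
    "('v, 'e) pre_digraph \<Rightarrow> ('e \<Rightarrow> real) \<Rightarrow> 'e \<Rightarrow> ('v, 'e) mg_fun \<Rightarrow> real \<Rightarrow> real" where
  "on_edge G len e u t = u (edge_pt G len e t)"

definition mg_lipschitz :: "('v, 'e) pre_digraph \<Rightarrow> ('e \<Rightarrow> real) \<Rightarrow> ('v, 'e) mg_fun \<Rightarrow> bool" where
  "mg_lipschitz G len f \<longleftrightarrow>
     (\<exists>C. \<forall>p\<in>mg_points G len. \<forall>q\<in>mg_points G len. \<bar>f p - f q\<bar> \<le> C * geodesic_dist G len p q)"

text \<open>Continuity for the quotient topology; single-valuedness at the vertices is built into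
  \<open>mg_point\<close>.\<close>

definition mg_continuous :: "('v, 'e) pre_digraph \<Rightarrow> ('e \<Rightarrow> real) \<Rightarrow> ('v, 'e) mg_fun \<Rightarrow> bool" where
  "mg_continuous G len u \<longleftrightarrow> (\<forall>e\<in>arcs G. continuous_on {0..len e} (on_edge G len e u))"


section \<open>Lebesgue spaces\<close>

text \<open>Elements of \<open>L\<^sub>2\<close> are represented by functions, so sets of functions stand for sets of classes.\<close>

definition L2_on :: "real \<Rightarrow> (real \<Rightarrow> real) \<Rightarrow> bool" where
  "L2_on b f \<longleftrightarrow> f \<in> borel_measurable (lebesgue_on {0..b}) \<and>
     integrable (lebesgue_on {0..b}) (\<lambda>t. (f t)\<^sup>2)"

definition L2_graph :: "('v, 'e) pre_digraph \<Rightarrow> ('e \<Rightarrow> real) \<Rightarrow> ('v, 'e) mg_fun set" where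
  "L2_graph G len = {u. \<forall>e\<in>arcs G. L2_on (len e) (on_edge G len e u)}"

definition L2_inner ::
    "('v, 'e) pre_digraph \<Rightarrow> ('e \<Rightarrow> real) \<Rightarrow> ('v, 'e) mg_fun \<Rightarrow> ('v, 'e) mg_fun \<Rightarrow> real" where
  "L2_inner G len u v =
     (\<Sum>e\<in>arcs G. LINT t|lebesgue_on {0..len e}. on_edge G len e u t * on_edge G len e v t)"

definition L2_norm :: "('v, 'e) pre_digraph \<Rightarrow> ('e \<Rightarrow> real) \<Rightarrow> ('v, 'e) mg_fun \<Rightarrow> real" where
  "L2_norm G len u = sqrt (L2_inner G len u u)"

definition Linf_graph :: "('v, 'e) pre_digraph \<Rightarrow> ('e \<Rightarrow> real) \<Rightarrow> ('v, 'e) mg_fun set" where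
  "Linf_graph G len = {f. \<exists>C. \<forall>e\<in>arcs G.
     on_edge G len e f \<in> borel_measurable (lebesgue_on {0..len e}) \<and>
     (AE t in lebesgue_on {0..len e}. \<bar>on_edge G len e f t\<bar> \<le> C)}"

text \<open>\<open>inf f > 0\<close>, in the essential sense appropriate for \<open>L\<^sub>\<infinity>\<close> functions.\<close>

definition ess_inf_pos :: "('v, 'e) pre_digraph \<Rightarrow> ('e \<Rightarrow> real) \<Rightarrow> ('v, 'e) mg_fun \<Rightarrow> bool" where
  "ess_inf_pos G len f \<longleftrightarrow>
     (\<exists>c>0. \<forall>e\<in>arcs G. AE t in lebesgue_on {0..len e}. c \<le> on_edge G len e f t)"


section \<open>Weak derivatives and the Sobolev space of order two\<close>

definition test_function :: "real \<Rightarrow> (real \<Rightarrow> real) \<Rightarrow> bool" where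
  "test_function b \<phi> \<longleftrightarrow> (\<forall>n x. (deriv ^^ n) \<phi> differentiable (at x)) \<and>
     (\<exists>c d. 0 < c \<and> c \<le> d \<and> d < b \<and> (\<forall>x. x \<notin> {c..d} \<longrightarrow> \<phi> x = 0))"

text \<open>Weak derivative on the open interval \<open>(0, b)\<close>, within integrable functions.\<close>

definition has_weak_deriv :: "real \<Rightarrow> (real \<Rightarrow> real) \<Rightarrow> (real \<Rightarrow> real) \<Rightarrow> bool" where
  "has_weak_deriv b f g \<longleftrightarrow>
     integrable (lebesgue_on {0..b}) f \<and> integrable (lebesgue_on {0..b}) g \<and>
     (\<forall>\<phi>. test_function b \<phi> \<longrightarrow>
        (LINT t|lebesgue_on {0..b}. f t * deriv \<phi> t) = - (LINT t|lebesgue_on {0..b}. g t * \<phi> t))"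

definition H2_on :: "real \<Rightarrow> (real \<Rightarrow> real) \<Rightarrow> bool" where
  "H2_on b f \<longleftrightarrow> (\<exists>f' f''. has_weak_deriv b f f' \<and> has_weak_deriv b f' f'' \<and>
     L2_on b f \<and> L2_on b f' \<and> L2_on b f'')"

definition H2_graph :: "('v, 'e) pre_digraph \<Rightarrow> ('e \<Rightarrow> real) \<Rightarrow> ('v, 'e) mg_fun set" where
  "H2_graph G len =
     {u. mg_continuous G len u \<and> (\<forall>e\<in>arcs G. H2_on (len e) (on_edge G len e u))}"


section \<open>Vertex conditions and the differential operators\<close>

definition kirchhoff ::
    "('v, 'e) pre_digraph \<Rightarrow> ('e \<Rightarrow> real) \<Rightarrow> 'v set \<Rightarrow> ('v, 'e) mg_fun set" where
  "kirchhoff G len VK = {u. \<forall>v\<in>VK.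
     (\<Sum>(e, d) \<in> {(e, d). e \<in> arcs G \<and> nat_param G len e d 0 = Vertex v}.
        vector_derivative (u \<circ> nat_param G len e d) (at 0 within {0..len e})) = 0}"

definition dirichlet :: "'v set \<Rightarrow> ('v, 'e) mg_fun set" where
  "dirichlet VD = {u. \<forall>v\<in>VD. u (Vertex v) = 0}"

text \<open>An unbounded operator is given by its graph, as a relation between functions;
  the value is determined up to null sets.\<close>

definition op_domain ::
    "('v, 'e) pre_digraph \<Rightarrow> ('e \<Rightarrow> real) \<Rightarrow> 'v set \<Rightarrow> 'v set \<Rightarrow> ('v, 'e) mg_fun set" where
  "op_domain G len VK VD = H2_graph G len \<inter> kirchhoff G len VK \<inter> dirichlet VD"

definition elliptic_op ::
    "('v, 'e) pre_digraph \<Rightarrow> ('e \<Rightarrow> real) \<Rightarrow> 'v set \<Rightarrow> 'v set \<Rightarrow>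
     ('v, 'e) mg_fun \<Rightarrow> ('v, 'e) mg_fun \<Rightarrow> ('v, 'e) mg_fun \<Rightarrow> ('v, 'e) mg_fun \<Rightarrow> bool" where
  "elliptic_op G len VK VD a \<kappa> u f \<longleftrightarrow>
     u \<in> op_domain G len VK VD \<and> f \<in> L2_graph G len \<and>
     (\<forall>e\<in>arcs G. \<exists>du g.
        has_weak_deriv (len e) (on_edge G len e u) du \<and>
        has_weak_deriv (len e) (\<lambda>t. on_edge G len e a t * du t) g \<and>
        (AE t in lebesgue_on {0..len e}.
           on_edge G len e f t = (on_edge G len e \<kappa> t)\<^sup>2 * on_edge G len e u t - g t))"

definition one_minus_laplacian ::
    "('v, 'e) pre_digraph \<Rightarrow> ('e \<Rightarrow> real) \<Rightarrow> 'v set \<Rightarrow> 'v set \<Rightarrow>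
     ('v, 'e) mg_fun \<Rightarrow> ('v, 'e) mg_fun \<Rightarrow> bool" where
  "one_minus_laplacian G len VK VD u f \<longleftrightarrow>
     u \<in> op_domain G len VK VD \<and> f \<in> L2_graph G len \<and>
     (\<forall>e\<in>arcs G. \<exists>du ddu.
        has_weak_deriv (len e) (on_edge G len e u) du \<and>
        has_weak_deriv (len e) du ddu \<and>
        (AE t in lebesgue_on {0..len e}. on_edge G len e f t = on_edge G len e u t - ddu t))"


section \<open>Domains of fractional powers\<close>

text \<open>
  An orthonormal basis of \<open>L\<^sub>2\<close> (an orthonormal family with dense span) consisting of eigenfunctions
  of \<open>A\<close>. The index set \<open>I\<close> is a set of naturals rather than \<open>UNIV\<close> since \<open>L\<^sub>2\<close> is trivial for a graph
  without edges.
\<close>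

definition orthonormal_eigenbasis ::
    "('v, 'e) pre_digraph \<Rightarrow> ('e \<Rightarrow> real) \<Rightarrow> (('v, 'e) mg_fun \<Rightarrow> ('v, 'e) mg_fun \<Rightarrow> bool) \<Rightarrow>
     nat set \<Rightarrow> (nat \<Rightarrow> ('v, 'e) mg_fun) \<Rightarrow> (nat \<Rightarrow> real) \<Rightarrow> bool" where
  "orthonormal_eigenbasis G len A I \<psi> \<mu> \<longleftrightarrow>
     (\<forall>i\<in>I. A (\<psi> i) (\<lambda>x. \<mu> i * \<psi> i x)) \<and>
     (\<forall>i\<in>I. \<forall>j\<in>I. L2_inner G len (\<psi> i) (\<psi> j) = (if i = j then 1 else 0)) \<and>
     (\<forall>u\<in>L2_graph G len. \<forall>\<epsilon>>0. \<exists>F c. finite F \<and> F \<subseteq> I \<and>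
        L2_norm G len (\<lambda>x. u x - (\<Sum>i\<in>F. c i * \<psi> i x)) < \<epsilon>)"

text \<open>\<open>D(A\<^bsup>\<alpha>/2\<^esup>)\<close> and its norm, for an operator with eigenbasis \<open>\<psi>\<close> and eigenvalues \<open>\<mu> i > 0\<close>
  (so that \<open>powr\<close> is the usual real power).\<close>

definition frac_domain ::
    "('v, 'e) pre_digraph \<Rightarrow> ('e \<Rightarrow> real) \<Rightarrow> nat set \<Rightarrow> (nat \<Rightarrow> ('v, 'e) mg_fun) \<Rightarrow> (nat \<Rightarrow> real) \<Rightarrow>
     real \<Rightarrow> ('v, 'e) mg_fun set" where
  "frac_domain G len I \<psi> \<mu> \<alpha> =
     {u \<in> L2_graph G len. (\<lambda>i. \<mu> i powr \<alpha> * (L2_inner G len u (\<psi> i))\<^sup>2) summable_on I}"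

definition frac_norm ::
    "('v, 'e) pre_digraph \<Rightarrow> ('e \<Rightarrow> real) \<Rightarrow> nat set \<Rightarrow> (nat \<Rightarrow> ('v, 'e) mg_fun) \<Rightarrow> (nat \<Rightarrow> real) \<Rightarrow>
     real \<Rightarrow> ('v, 'e) mg_fun \<Rightarrow> real" where
  "frac_norm G len I \<psi> \<mu> \<alpha> u = sqrt (\<Sum>\<^sub>\<infinity>i\<in>I. \<mu> i powr \<alpha> * (L2_inner G len u (\<psi> i))\<^sup>2)"

definition equal_with_equivalent_norms ::
    "'a set \<Rightarrow> ('a \<Rightarrow> real) \<Rightarrow> 'a set \<Rightarrow> ('a \<Rightarrow> real) \<Rightarrow> bool" where
  "equal_with_equivalent_norms X N Y M \<longleftrightarrow>
     X = Y \<and> (\<exists>c>0. \<exists>C>0. \<forall>u\<in>X. c * M u \<le> N u \<and> N u \<le> C * M u)"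

end

theory Submission
  imports Defs
begin

text \<open>
  The Laplacian case is the elliptic one with coefficients \<open>1\<close>, so by symmetry it suffices to bound the
  norm of \<open>D(A\<^bsup>\<alpha>/2\<^esup>)\<close> by that of \<open>D(B\<^bsup>\<alpha>/2\<^esup>)\<close> for any two such operators. By
  the Heinz inequality only \<open>\<alpha> = 2\<close> matters, and by duality this is the bound
  \<open>\<bar>\<langle>v, A w\<rangle>\<bar> \<le> C \<parallel>B v\<parallel> \<parallel>w\<parallel>\<close> for finite eigenfunction combinations \<open>v\<close> of \<open>B\<close> and
  \<open>w\<close> of \<open>A\<close>. In the quadratic form of \<open>A\<close> write \<open>a v' w' = (a / b) (b v') w'\<close> and move the derivative off
  \<open>w\<close>: \<open>b v'\<close> has the derivative \<open>\<sigma>\<^sup>2 v - B v\<close>, \<open>a / b\<close> is Lipschitz, and the boundary terms cancel by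
  the vertex conditions. The Heinz inequality follows from comparing \<open>K\<close>-functionals, which for an operator
  with an eigenbasis are explicit sums.
\<close>

section \<open>Test functions\<close>

text \<open>Two operators with unrelated eigenbases cannot be compared coefficient by coefficient.
  The K-functional, the infimum over v of |u - v|^2 + t^2 |A v|^2, speaks of vectors only, so a
  bound between the operators carries over to it whatever the bases are. The bound itself is set up
  by duality because a Lipschitz \<open>a\<close> has a derivative only almost everywhere, and
  applying A to an eigenfunction of B would bring that derivative in. In the pairing, A falls on its
  own eigenfunctions, where it is multiplication by an eigenvalue, and only the Lipschitz constant
  of a / b appears. The Kirchhoff sums carry no weight \<open>a\<close>, while the boundary terms
  involve the flux a v'. They cancel nevertheless, because \<open>a\<close> and w have a single
  value at each vertex, which factors out of the sum. Weak derivatives are given through test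
  functions only, so classical derivatives up to the vertices have to be recovered first, by the du
  Bois-Reymond lemma with explicit bump functions.\<close>

definition smooth :: "(real \<Rightarrow> real) \<Rightarrow> bool" where
  "smooth f \<longleftrightarrow> (\<forall>n x. (deriv ^^ n) f differentiable (at x))"

text \<open>Inductions run over a finite order with the function kept general: the derivative of a
  product or of an affine composition is built from functions of the same kind, one order
  lower.\<close>

definition smooth_upto :: "nat \<Rightarrow> (real \<Rightarrow> real) \<Rightarrow> bool" where
  "smooth_upto n f \<longleftrightarrow> (\<forall>k\<le>n. \<forall>x. (deriv ^^ k) f differentiable (at x))"

lemma smooth_iff: "smooth f \<longleftrightarrow> (\<forall>n. smooth_upto n f)"
  unfolding smooth_def smooth_upto_def by blast

lemma smooth_upto_0: "smooth_upto 0 f \<longleftrightarrow> (\<forall>x. f differentiable (at x))"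
  unfolding smooth_upto_def by simp

lemma smooth_upto_Suc:
  "smooth_upto (Suc n) f \<longleftrightarrow> (\<forall>x. f differentiable (at x)) \<and> smooth_upto n (deriv f)"
proof -
  have "(\<forall>k\<le>Suc n. P k) \<longleftrightarrow> P 0 \<and> (\<forall>k\<le>n. P (Suc k))" for P :: "nat \<Rightarrow> bool"
    by (metis Suc_le_mono le0 not0_implies_Suc)
  then show ?thesis
    unfolding smooth_upto_def by (simp add: funpow_Suc_right del: funpow.simps)
qed

lemma smooth_upto_SucD: "smooth_upto (Suc n) f \<Longrightarrow> smooth_upto n f"
  unfolding smooth_upto_def by simp

lemma has_deriv_real: "(f :: real \<Rightarrow> real) differentiable (at x) \<Longrightarrow> (f has_real_derivative deriv f x) (at x)"
  using DERIV_deriv_iff_real_differentiable by blast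

lemma smooth_upto_add: "smooth_upto n f \<Longrightarrow> smooth_upto n g \<Longrightarrow> smooth_upto n (\<lambda>x. f x + g x)"
proof (induction n arbitrary: f g)
  case 0 then show ?case by (simp add: smooth_upto_0)
next
  case (Suc n)
  have "deriv (\<lambda>x. f x + g x) = (\<lambda>x. deriv f x + deriv g x)"
    by (rule ext, rule DERIV_imp_deriv)
       (use Suc.prems in \<open>auto simp: smooth_upto_Suc intro!: DERIV_add has_deriv_real\<close>)
  with Suc show ?case by (simp add: smooth_upto_Suc)
qed

lemma smooth_upto_mult: "smooth_upto n f \<Longrightarrow> smooth_upto n g \<Longrightarrow> smooth_upto n (\<lambda>x. f x * g x)"
proof (induction n arbitrary: f g)
  case 0 then show ?case by (simp add: smooth_upto_0)
next
  case (Suc n)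
  have "deriv (\<lambda>x. f x * g x) = (\<lambda>x. deriv f x * g x + deriv g x * f x)"
    by (rule ext, rule DERIV_imp_deriv)
       (use Suc.prems in \<open>auto simp: smooth_upto_Suc intro!: DERIV_mult has_deriv_real\<close>)
  moreover have "smooth_upto n (\<lambda>x. deriv f x * g x + deriv g x * f x)"
    using Suc.prems smooth_upto_SucD[OF Suc.prems(1)] smooth_upto_SucD[OF Suc.prems(2)]
    by (intro smooth_upto_add[OF Suc.IH Suc.IH]) (simp_all add: smooth_upto_Suc)
  ultimately show ?case using Suc.prems by (simp add: smooth_upto_Suc)
qed

lemma smooth_upto_const: "smooth_upto n (\<lambda>x. c)"
proof (induction n arbitrary: c)
  case (Suc n)
  have "deriv (\<lambda>x. c) = (\<lambda>x. 0 :: real)" by (rule ext, rule DERIV_imp_deriv) simp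
  with Suc show ?case by (simp add: smooth_upto_Suc)
qed (simp add: smooth_upto_0)

lemma smooth_upto_affine: "smooth_upto n f \<Longrightarrow> smooth_upto n (\<lambda>x. f (c * x + d))"
proof (induction n arbitrary: f)
  case 0 
  have "(\<lambda>x. f (c * x + d)) differentiable (at x)" for x
    by (rule differentiable_compose[of f "\<lambda>x. c * x + d"]) (use 0 in \<open>auto simp: smooth_upto_0\<close>)
  then show ?case by (simp add: smooth_upto_0)
next
  case (Suc n)
  have D: "((\<lambda>x. f (c * x + d)) has_real_derivative c * deriv f (c * x + d)) (at x)" for x
  proof -
    have "((\<lambda>x. c * x + d) has_real_derivative c) (at x)" by (auto intro!: derivative_eq_intros)
    from DERIV_chain2[OF has_deriv_real this] show ?thesis
      using Suc.prems by (metis mult.commute smooth_upto_Suc)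
  qed
  then have "deriv (\<lambda>x. f (c * x + d)) = (\<lambda>x. c * deriv f (c * x + d))"
    by (intro ext DERIV_imp_deriv)
  moreover have "smooth_upto n (\<lambda>x. c * deriv f (c * x + d))"
    using Suc.prems by (intro smooth_upto_mult[OF smooth_upto_const Suc.IH]) (simp add: smooth_upto_Suc)
  ultimately show ?case
    using D by (auto simp: smooth_upto_Suc real_differentiable_def)
qed

lemma smooth_mult: "smooth f \<Longrightarrow> smooth g \<Longrightarrow> smooth (\<lambda>x. f x * g x)"
  by (simp add: smooth_iff smooth_upto_mult)

lemma smooth_add: "smooth f \<Longrightarrow> smooth g \<Longrightarrow> smooth (\<lambda>x. f x + g x)"
  by (simp add: smooth_iff smooth_upto_add)

lemma smooth_const: "smooth (\<lambda>x. c)"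
  by (simp add: smooth_iff smooth_upto_const)

lemma smooth_affine: "smooth f \<Longrightarrow> smooth (\<lambda>x. f (c * x + d))"
  by (simp add: smooth_iff smooth_upto_affine)

lemma smooth_antideriv:
  assumes "smooth f" "\<And>x. (F has_real_derivative f x) (at x)"
  shows "smooth F"
proof -
  have "deriv F = f" using assms(2) by (intro ext DERIV_imp_deriv)
  then have "smooth_upto (Suc n) F" for n
    using assms by (auto simp: smooth_upto_Suc smooth_iff real_differentiable_def)
  then show ?thesis using smooth_upto_SucD smooth_iff by blast
qed

text \<open>The polynomial factor makes this family closed under differentiation, hence smooth.\<close>

definition flat_exp :: "real poly \<Rightarrow> real \<Rightarrow> real" where
  "flat_exp p x = (if x > 0 then poly p (1 / x) * exp (- 1 / x) else 0)"

lemma tendsto_poly_flat: "((\<lambda>x. poly p (1 / x) * exp (- 1 / x)) \<longlongrightarrow> 0) (at_right (0::real))"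
proof -
  have "((\<lambda>y. poly p y * exp (- y)) \<longlongrightarrow> 0) (at_top :: real filter)"
  proof -
    have "((\<lambda>y. y ^ k * exp (- y)) \<longlongrightarrow> 0) (at_top :: real filter)" for k
      using tendsto_power_div_exp_0[of k] by (simp add: exp_minus divide_inverse)
    then have "((\<lambda>y. \<Sum>i\<le>degree p. coeff p i * (y ^ i * exp (- y))) \<longlongrightarrow> (\<Sum>i\<le>degree p. coeff p i * 0)) (at_top :: real filter)"
      by (intro tendsto_intros)
    then show ?thesis
      by (simp add: poly_altdef sum_distrib_right mult.assoc)
  qed
  from filterlim_compose[OF this filterlim_inverse_at_top_right]
  show ?thesis by (simp add: divide_inverse)
qed

lemma flat_exp_deriv:
  "\<exists>q. \<forall>x. (flat_exp p has_real_derivative flat_exp q x) (at x)"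
proof -
  \<comment> \<open>Differentiating p(1/x) exp(-1/x) produces the factor 1/x^2 and the difference p
    - p', both polynomial in 1/x; \<open>[:0, 0, 1:]\<close> is the square of the variable.\<close>
  define q where "q = [:0, 0, 1:] * (p - pderiv p)"
  have "(flat_exp p has_real_derivative flat_exp q x) (at x)" for x
  proof -
    consider "x > 0" | "x < 0" | "x = 0" by linarith
    then show ?thesis
    proof cases
      case 1
      have "((\<lambda>x. poly p (1 / x) * exp (- 1 / x)) has_real_derivative flat_exp q x) (at x)"
        using 1 by (auto intro!: derivative_eq_intros DERIV_chain2[OF poly_DERIV]
            simp: q_def flat_exp_def field_simps power2_eq_square)
      then show ?thesis
        by (rule has_field_derivative_transform_within_open[of _ _ _ "{0<..}"])
           (use 1 in \<open>auto simp: flat_exp_def\<close>)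
    next
      case 2
      have "((\<lambda>x. 0) has_real_derivative flat_exp q x) (at x)"
        using 2 by (simp add: flat_exp_def)
      then show ?thesis
        by (rule has_field_derivative_transform_within_open[of _ _ _ "{..<0}"])
           (use 2 in \<open>auto simp: flat_exp_def\<close>)
    next
      case 3
      have "((\<lambda>y. flat_exp p y / y) \<longlongrightarrow> 0) (at 0)"
      proof (rule filterlim_split_at)
        show "((\<lambda>y. flat_exp p y / y) \<longlongrightarrow> 0) (at_left 0)"
          by (rule tendsto_eventually) (auto simp: flat_exp_def eventually_at_filter)
        show "((\<lambda>y. flat_exp p y / y) \<longlongrightarrow> 0) (at_right 0)"
        \<comment> \<open>Dividing by y multiplies the polynomial by its variable, so the difference
          quotient at 0 is again a flat function.\<close>
        proof (rule Lim_transform_eventually[OF tendsto_poly_flat[of "[:0,1:] * p"]])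
          show "\<forall>\<^sub>F x in at_right 0. poly ([:0,1:] * p) (1 / x) * exp (- 1 / x) = flat_exp p x / x"
            by (auto simp: flat_exp_def eventually_at_filter)
        qed
      qed
      then show ?thesis using 3 by (simp add: has_field_derivative_iff flat_exp_def)
    qed
  qed
  then show ?thesis by blast
qed

lemma smooth_flat_exp: "smooth (flat_exp p)"
proof -
  have "smooth_upto n (flat_exp p)" for n
  proof (induction n arbitrary: p)
    case 0
    then show ?case using flat_exp_deriv by (metis real_differentiable_def smooth_upto_0)
  next
    case (Suc n)
    obtain q where q: "\<And>x. (flat_exp p has_real_derivative flat_exp q x) (at x)"
      using flat_exp_deriv by blast
    then have "deriv (flat_exp p) = flat_exp q" by (intro ext DERIV_imp_deriv)
    then show ?case using Suc q by (auto simp: smooth_upto_Suc real_differentiable_def)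
  qed
  then show ?thesis by (simp add: smooth_iff)
qed

section \<open>Smooth bumps tending to the indicator of an interval\<close>

definition bump :: "real \<Rightarrow> real \<Rightarrow> nat \<Rightarrow> real \<Rightarrow> real" where
  "bump s t n x = flat_exp 1 (real (Suc n) * (x - s)) * flat_exp 1 (real (Suc n) * (t - x))"

lemma smooth_bump: "smooth (bump s t n)"
proof -
  have "smooth (\<lambda>x. flat_exp 1 (real (Suc n) * x + (- real (Suc n) * s)) *
     flat_exp 1 ((- real (Suc n)) * x + real (Suc n) * t))"
    by (intro smooth_mult smooth_affine smooth_flat_exp)
  moreover have "bump s t n = (\<lambda>x. flat_exp 1 (real (Suc n) * x + (- real (Suc n) * s)) *
     flat_exp 1 ((- real (Suc n)) * x + real (Suc n) * t))"
    unfolding bump_def by (rule ext) (simp add: algebra_simps)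
  ultimately show ?thesis by metis
qed

lemma flat_exp_1_bounds: "0 \<le> flat_exp 1 x" "flat_exp 1 x \<le> 1"
  by (auto simp: flat_exp_def)

lemma bump_bounds: "0 \<le> bump s t n x" "bump s t n x \<le> 1"
  unfolding bump_def using flat_exp_1_bounds by (auto intro: mult_le_one)

lemma bump_eq_0: "x \<notin> {s<..<t} \<Longrightarrow> bump s t n x = 0"
  by (auto simp: bump_def flat_exp_def mult_le_0_iff zero_less_mult_iff)

lemma bump_pos: "x \<in> {s<..<t} \<Longrightarrow> 0 < bump s t n x"
  by (auto simp: bump_def flat_exp_def)

lemma flat_exp_1_tendsto:
  assumes "x > 0" shows "(\<lambda>n. flat_exp 1 (real (Suc n) * x)) \<longlonglongrightarrow> 1"
proof -
  have "(\<lambda>n. exp (- (1 / x) * inverse (real (Suc n)))) \<longlonglongrightarrow> exp (- (1 / x) * 0)"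
    by (intro tendsto_intros LIMSEQ_inverse_real_of_nat)
  then show ?thesis using assms by (simp add: flat_exp_def divide_inverse mult_ac del: of_nat_Suc)
qed

text \<open>Dilation by \<open>Suc n\<close> drives both factors to 1 inside the interval, while
  outside one of them stays zero. This limit turns information about smooth integrands into
  information about integrals over intervals.\<close>

lemma bump_tendsto: "(\<lambda>n. bump s t n x) \<longlonglongrightarrow> indicat_real {s<..<t} x"
proof (cases "x \<in> {s<..<t}")
  case True
  then have "(\<lambda>n. bump s t n x) \<longlonglongrightarrow> 1 * 1"
    unfolding bump_def by (intro tendsto_mult flat_exp_1_tendsto) auto
  with True show ?thesis by simp
next
  case False
  then show ?thesis by (simp add: bump_eq_0)
qed

section \<open>Primitives and integration by parts\<close>

lemma integrable_lebesgue_on_iff: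
  fixes f :: "real \<Rightarrow> real"
  shows "integrable (lebesgue_on {a..b}) f \<longleftrightarrow> f absolutely_integrable_on {a..b}"
  by (simp add: integrable_restrict_space set_integrable_def)

lemma lebesgue_on_integral:
  fixes f :: "real \<Rightarrow> real"
  shows "f absolutely_integrable_on {a..b} \<Longrightarrow> integral\<^sup>L (lebesgue_on {a..b}) f = integral {a..b} f"
  by (simp add: lebesgue_integral_eq_integral integrable_lebesgue_on_iff)

lemma abs_integrable_mult_continuous:
  fixes f g :: "real \<Rightarrow> real"
  assumes "f absolutely_integrable_on {a..b}" "continuous_on {a..b} g"
  shows "(\<lambda>x. f x * g x) absolutely_integrable_on {a..b}"
proof -
  have "(\<lambda>x. g x * f x) absolutely_integrable_on {a..b}"
    using assms by (intro absolutely_integrable_bounded_measurable_product_real)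
      (auto intro: continuous_imp_measurable_on_sets_lebesgue compact_imp_bounded compact_continuous_image)
  then show ?thesis by (simp add: mult.commute)
qed

lemma abs_integrable_sub:
  fixes f :: "real \<Rightarrow> real"
  assumes "f absolutely_integrable_on {a..b}" "{c..d} \<subseteq> {a..b}"
  shows "f absolutely_integrable_on {c..d}"
  using assms absolutely_integrable_on_subinterval by blast

lemma lipschitz_of_C1:
  fixes v w :: "real \<Rightarrow> real"
  assumes v: "\<And>t. t \<in> {a..b} \<Longrightarrow> (v has_real_derivative w t) (at t within {a..b})"
    and M: "\<And>t. t \<in> {a..b} \<Longrightarrow> \<bar>w t\<bar> \<le> M" and xy: "x \<in> {a..b}" "y \<in> {a..b}"
  shows "\<bar>v x - v y\<bar> \<le> M * \<bar>x - y\<bar>"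
  using field_differentiable_bound[of "{a..b}" v w M x y] assms by auto

lemma quotient_lipschitz:
  fixes a1 a2 b1 b2 :: real
  assumes "0 < c" "c \<le> b1" "c \<le> b2" "\<bar>b1\<bar> \<le> B" "\<bar>a1\<bar> \<le> A"
    and "\<bar>a1 - a2\<bar> \<le> La * d" "\<bar>b1 - b2\<bar> \<le> Lb * d"
  shows "\<bar>a1 / b1 - a2 / b2\<bar> \<le> (La * B + A * Lb) / c\<^sup>2 * d"
proof -
  have p: "0 < b1" "0 < b2" using assms by auto
  have B: "0 \<le> B" and A: "0 \<le> A" using assms(4,5) by linarith+
  have Ld: "0 \<le> La * d" "0 \<le> Lb * d" using assms(6,7) by linarith+
  have "a1 / b1 - a2 / b2 = ((a1 - a2) * b1 - a1 * (b1 - b2)) / (b1 * b2)"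
    using p by (simp add: field_simps)
  also have "\<bar>\<dots>\<bar> = \<bar>(a1 - a2) * b1 - a1 * (b1 - b2)\<bar> / (b1 * b2)" using p by (simp add: abs_mult)
  also have "\<dots> \<le> (La * d * B + A * (Lb * d)) / (c * c)"
  proof (rule frac_le)
    have "\<bar>(a1 - a2) * b1 - a1 * (b1 - b2)\<bar> \<le> \<bar>a1 - a2\<bar> * \<bar>b1\<bar> + \<bar>a1\<bar> * \<bar>b1 - b2\<bar>"
      by (metis abs_mult abs_triangle_ineq4)
    also have "\<dots> \<le> La * d * B + A * (Lb * d)"
      using assms A B Ld by (intro add_mono mult_mono) auto
    finally show "\<bar>(a1 - a2) * b1 - a1 * (b1 - b2)\<bar> \<le> La * d * B + A * (Lb * d)" .
    show "c * c \<le> b1 * b2" using assms p by (intro mult_mono) auto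
    show "0 \<le> La * d * B + A * (Lb * d)" using A B Ld by simp
  qed (use assms in auto)
  finally show ?thesis by (simp add: power2_eq_square algebra_simps)
qed

text \<open>Freezing \<open>v\<close> at one point costs the length of the interval times the mass
  of \<open>g\<close>. As the mass itself shrinks with the interval, the error is of smaller order
  than the length.\<close>

lemma primitive_mult_remainder:
  fixes g v w :: "real \<Rightarrow> real"
  assumes g: "g absolutely_integrable_on {a..b}"
    and v: "\<And>t. t \<in> {a..b} \<Longrightarrow> (v has_real_derivative w t) (at t within {a..b})"
    and M: "\<And>t. t \<in> {a..b} \<Longrightarrow> \<bar>w t\<bar> \<le> M" and x: "x \<in> {a..b}"
  shows "\<bar>integral {a..b} (\<lambda>r. g r * (v r - v x))\<bar> \<le> M * (b - a) * integral {a..b} (\<lambda>r. \<bar>g r\<bar>)"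
proof -
  have cv: "continuous_on {a..b} (\<lambda>r. v r - v x)"
    using v by (intro continuous_intros) (meson DERIV_continuous_on)
  have i1: "(\<lambda>r. g r * (v r - v x)) integrable_on {a..b}"
    using abs_integrable_mult_continuous[OF g cv] set_lebesgue_integral_eq_integral(1) by blast
  have i2: "(\<lambda>r. M * (b - a) * \<bar>g r\<bar>) integrable_on {a..b}"
    using g by (intro integrable_on_mult_right) (auto simp: absolutely_integrable_on_def)
  have "M \<ge> 0" using M[OF x] by linarith
  have "norm (integral {a..b} (\<lambda>r. g r * (v r - v x))) \<le> integral {a..b} (\<lambda>r. M * (b - a) * \<bar>g r\<bar>)"
  proof (rule integral_norm_bound_integral[OF i1 i2])
    fix r assume r: "r \<in> {a..b}"
    have "\<bar>v r - v x\<bar> \<le> M * \<bar>r - x\<bar>" by (rule lipschitz_of_C1[OF v M r x])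
    also have "\<dots> \<le> M * (b - a)" using r x \<open>M \<ge> 0\<close> by (intro mult_left_mono) auto
    finally show "norm (g r * (v r - v x)) \<le> M * (b - a) * \<bar>g r\<bar>"
      by (simp add: abs_mult) (metis abs_ge_zero mult.commute mult_left_mono)
  qed
  then show ?thesis by simp
qed

lemma primitive_continuous:
  fixes g :: "real \<Rightarrow> real"
  assumes "g absolutely_integrable_on {0..l}" "\<And>t. t \<in> {0..l} \<Longrightarrow> P t = c + integral {0..t} g"
  shows "continuous_on {0..l} P"
proof -
  have "continuous_on {0..l} (\<lambda>t. c + integral {0..t} g)"
    using assms(1) by (intro continuous_intros indefinite_integral_continuous_1)
      (auto simp: absolutely_integrable_on_def)
  then show ?thesis by (rule continuous_on_eq) (simp add: assms(2))
qed

lemma integral_diff_Icc: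
  fixes g :: "real \<Rightarrow> real"
  assumes "g absolutely_integrable_on {0..l}" "0 \<le> s" "s \<le> t" "t \<le> l"
  shows "integral {0..t} g - integral {0..s} g = integral {s..t} g"
proof -
  have "g integrable_on {0..t}"
    using assms abs_integrable_sub[OF assms(1), of 0 t] by (auto simp: absolutely_integrable_on_def)
  from Henstock_Kurzweil_Integration.integral_combine[OF assms(2,3) this] show ?thesis by simp
qed

text \<open>\<open>P\<close> need not be differentiable anywhere. The difference of the two sides, as a function of the upper
  limit, still has derivative zero everywhere: its increments are \<open>O(\<bar>s - t\<bar>)\<close> times the increments of
  the primitive \<open>N\<close> of \<open>\<bar>g\<bar>\<close>.\<close>

lemma by_parts_primitive:
  fixes g v w P :: "real \<Rightarrow> real"
  assumes l: "0 \<le> l" and g: "g absolutely_integrable_on {0..l}"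
    and P: "\<And>t. t \<in> {0..l} \<Longrightarrow> P t = c + integral {0..t} g"
    and v: "\<And>t. t \<in> {0..l} \<Longrightarrow> (v has_real_derivative w t) (at t within {0..l})"
    and w: "continuous_on {0..l} w"
  shows "integral {0..l} (\<lambda>t. g t * v t) + integral {0..l} (\<lambda>t. P t * w t) = P l * v l - P 0 * v 0"
proof -
  have cP: "continuous_on {0..l} P" by (rule primitive_continuous[OF g P])
  have cv: "continuous_on {0..l} v" using v by (meson DERIV_continuous_on)
  have cPw: "continuous_on {0..l} (\<lambda>t. P t * w t)" by (intro continuous_intros cP w)
  have gv: "(\<lambda>t. g t * v t) absolutely_integrable_on {0..l}"
    by (rule abs_integrable_mult_continuous[OF g cv])
  obtain M where M: "\<And>t. t \<in> {0..l} \<Longrightarrow> \<bar>w t\<bar> \<le> M"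
    using compact_imp_bounded[OF compact_continuous_image[OF w]]
    by (metis bounded_iff compact_Icc image_eqI real_norm_def)
  define N where "N t = integral {0..t} (\<lambda>r. \<bar>g r\<bar>)" for t
  have ag: "(\<lambda>r. \<bar>g r\<bar>) absolutely_integrable_on {0..l}" using absolutely_integrable_abs[OF g] by simp
  have cN: "continuous_on {0..l} N" by (rule primitive_continuous[OF ag, of _ 0]) (simp add: N_def)
  have Nmono: "N x \<le> N y" if "0 \<le> x" "x \<le> y" "y \<le> l" for x y
  proof -
    have "0 \<le> integral {x..y} (\<lambda>r. \<bar>g r\<bar>)"
      using abs_integrable_sub[OF ag, of x y] that
      by (intro Henstock_Kurzweil_Integration.integral_nonneg) (auto simp: absolutely_integrable_on_def)
    then show ?thesis unfolding N_def using integral_diff_Icc[OF ag that] by linarith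
  qed
  define h where "h s = integral {0..s} (\<lambda>r. g r * v r) - P s * v s" for s
  \<comment> \<open>The added term turns the increment of \<open>h\<close> into the integral of g (v
    - v s) between t and s, which \<open>primitive_mult_remainder\<close> bounds. After division by
    s - t, continuity of \<open>N\<close> sends it to zero.\<close>
  define R where "R t s = h s - h t + P t * (v s - v t)" for t s
  have Rb: "\<bar>R t s\<bar> \<le> M * \<bar>s - t\<bar> * \<bar>N s - N t\<bar>" if st: "s \<in> {0..l}" "t \<in> {0..l}" for s t
  proof -
    have main: "\<bar>integral {x..y} (\<lambda>r. g r * v r) - v z * integral {x..y} g\<bar> \<le> M * (y - x) * (N y - N x)"
      if "0 \<le> x" "x \<le> y" "y \<le> l" "z \<in> {x..y}" for x y z
    proof -
      have sub: "{x..y} \<subseteq> {0..l}" using that by auto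
      have gi: "g absolutely_integrable_on {x..y}" "(\<lambda>r. g r * v r) absolutely_integrable_on {x..y}"
        using abs_integrable_sub[OF _ sub] g gv by auto
      have "integral {x..y} (\<lambda>r. g r * v r) - v z * integral {x..y} g = integral {x..y} (\<lambda>r. g r * v r - v z * g r)"
        using gi by (subst integral_diff)
          (auto simp: absolutely_integrable_on_def intro!: integrable_on_mult_right)
      also have "\<dots> = integral {x..y} (\<lambda>r. g r * (v r - v z))" by (simp add: algebra_simps)
      finally have eq: "integral {x..y} (\<lambda>r. g r * v r) - v z * integral {x..y} g = integral {x..y} (\<lambda>r. g r * (v r - v z))" .
      show ?thesis
        unfolding eq N_def integral_diff_Icc[OF ag that(1-3)]
        by (rule primitive_mult_remainder[OF gi(1), of v w])
           (use sub that in \<open>auto intro!: M DERIV_subset[OF v]\<close>)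
    qed
    show ?thesis
    proof (cases "t \<le> s")
      case True
      have Ps: "P s - P t = integral {t..s} g"
        using P st integral_diff_Icc[OF g, of t s] True by simp
      have "R t s = integral {t..s} (\<lambda>r. g r * v r) - v s * integral {t..s} g"
        unfolding R_def h_def Ps[symmetric] using integral_diff_Icc[OF gv, of t s] True st
        by (simp add: algebra_simps)
      moreover have "N t \<le> N s"
        by (rule Nmono) (use True st in auto)
      ultimately show ?thesis using main[of t s s] True st by simp
    next
      case False
      have Ps: "P t - P s = integral {s..t} g"
        using P st integral_diff_Icc[OF g, of s t] False by simp
      have "R t s = - (integral {s..t} (\<lambda>r. g r * v r) - v s * integral {s..t} g)"
        unfolding R_def h_def Ps[symmetric] using integral_diff_Icc[OF gv, of s t] False st
        by (simp add: algebra_simps)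
      moreover have "N s \<le> N t"
        by (rule Nmono) (use False st in auto)
      ultimately show ?thesis using main[of s t s] False st by simp
    qed
  qed
  have R': "((R t) has_real_derivative 0) (at t within {0..l})" if t: "t \<in> {0..l}" for t
  proof -
    have "((\<lambda>s. R t s / (s - t)) \<longlongrightarrow> 0) (at t within {0..l})"
    proof (rule Lim_null_comparison)
      have "(N \<longlongrightarrow> N t) (at t within {0..l})" using cN t by (simp add: continuous_on_def)
      then have "((\<lambda>s. M * \<bar>N s - N t\<bar>) \<longlongrightarrow> M * \<bar>N t - N t\<bar>) (at t within {0..l})"
        by (intro tendsto_intros)
      then show "((\<lambda>s. M * \<bar>N s - N t\<bar>) \<longlongrightarrow> 0) (at t within {0..l})" by simp
      show "\<forall>\<^sub>F s in at t within {0..l}. norm (R t s / (s - t)) \<le> M * \<bar>N s - N t\<bar>"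
        unfolding eventually_at_filter using Rb[OF _ t]
        by (auto simp: divide_simps abs_mult mult_ac intro!: always_eventually)
    qed
    then show ?thesis by (simp add: has_field_derivative_iff R_def)
  qed
  define \<Psi> where "\<Psi> s = h s + integral {0..s} (\<lambda>t. P t * w t)" for s
  have "(\<Psi> has_real_derivative 0) (at t within {0..l})" if t: "t \<in> {0..l}" for t
  proof -
    have "\<Psi> = (\<lambda>s. R t s - P t * (v s - v t) + h t + integral {0..s} (\<lambda>t. P t * w t))"
      by (auto simp: \<Psi>_def R_def)
    moreover have "((\<lambda>s. R t s - P t * (v s - v t) + h t + integral {0..s} (\<lambda>t. P t * w t)) has_real_derivative 0 - P t * (w t - 0) + 0 + P t * w t) (at t within {0..l})"
      by (intro DERIV_add DERIV_diff DERIV_cmult DERIV_const R'[OF t] v[OF t] integral_has_real_derivative[OF cPw t])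
    ultimately show ?thesis by simp
  qed
  then obtain k where k: "\<And>s. s \<in> {0..l} \<Longrightarrow> \<Psi> s = k"
    using has_field_derivative_zero_constant[of "{0..l}" \<Psi>] by auto
  have "\<Psi> l = \<Psi> 0" using k l by simp
  then show ?thesis by (simp add: \<Psi>_def h_def algebra_simps)
qed

text \<open>The positive and the negative part of \<open>k\<close> are densities of two measures
  that agree on all rays, hence everywhere; densities are unique up to null sets.\<close>

lemma AE_zero_if_primitive_zero:
  fixes k :: "real \<Rightarrow> real"
  assumes b: "0 \<le> b" and k: "k absolutely_integrable_on {0..b}"
    and z: "\<And>t. t \<in> {0..b} \<Longrightarrow> integral {0..t} k = 0"
  shows "AE t in lebesgue_on {0..b}. k t = 0"
proof -
  \<comment> \<open>Extension by zero to the line, followed by a Borel version \<open>K'\<close>: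
    the measures are compared over \<open>lborel\<close>, whereas \<open>k\<close> is only Lebesgue
    measurable.\<close>
  define K where "K x = indicator {0..b} x * k x" for x
  have Ki: "integrable lebesgue K" using k by (simp add: K_def[abs_def] set_integrable_def)
  then obtain K' where K': "K' \<in> borel_measurable lborel" "AE x in lborel. K x = K' x"
    using completion_ex_borel_measurable_real[OF borel_measurable_integrable] by blast
  have AE: "AE x in lebesgue. K x = K' x" using K'(2) by (rule AE_completion)
  have K'i: "integrable lborel K'"
    using integrable_cong_AE[THEN iffD1, OF _ _ AE Ki] K'(1) Ki
    by (auto simp: integrable_completion measurable_completion)
  have I0: "(LINT x|lborel. indicator {y<..} x * K' x) = 0" for y
  proof -
    have "(LINT x|lborel. indicator {y<..} x * K' x) = (LINT x|lebesgue. indicator {y<..} x * K' x)"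
      using K'(1) by (intro integral_completion[symmetric]) simp
    also have "\<dots> = (LINT x|lebesgue. indicator {y<..} x * K x)"
      using AE borel_measurable_integrable[OF Ki] K'(1)
      by (intro integral_cong_AE borel_measurable_times) (auto simp: measurable_completion)
    also have "\<dots> = (LINT x|lebesgue. indicator ({y<..} \<inter> {0..b}) x *\<^sub>R k x)"
      by (intro Bochner_Integration.integral_cong) (auto simp: K_def indicator_def)
    also have "\<dots> = integral ({y<..} \<inter> {0..b}) k"
      using k by (intro set_lebesgue_integral_eq_integral(2)[unfolded set_lebesgue_integral_def])
        (auto intro: set_integrable_subset)
    also have "\<dots> = 0"
    proof -
      consider "y < 0" | "y > b" | "0 \<le> y" "y \<le> b" by linarith
      then show ?thesis
      proof cases
        case 1
        then have "{y<..} \<inter> {0..b} = {0..b}" by auto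
        then show ?thesis using z b by simp
      next
        case 2
        then have "{y<..} \<inter> {0..b} = {}" by auto
        then show ?thesis by simp
      next
        case 3
        then have "{y<..} \<inter> {0..b} = {y<..b}" by auto
        moreover have "integral {y<..b} k = integral {y..b} k"
          by (rule integral_spike_set) (auto intro: negligible_subset[of "{y}"])
        moreover have "integral {y..b} k = 0"
          using integral_diff_Icc[OF k, of y b] z 3 by auto
        ultimately show ?thesis by simp
      qed
    qed
    finally show ?thesis .
  qed
  have int_pos: "integrable lborel (\<lambda>x. indicator {y<..} x * K' x)" for y
    using integrable_mult_indicator[of "{y<..}" lborel K'] K'i by simp
  have em: "emeasure (density lborel (\<lambda>x. ennreal (s * K' x))) {y<..} = (\<integral>\<^sup>+x. ennreal (s * (indicator {y<..} x * K' x)) \<partial>lborel)" for y s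
    using K'(1) by (subst emeasure_density) (auto intro!: nn_integral_cong simp: indicator_def)
  \<comment> \<open>\<open>ennreal\<close> truncates at zero, so the two densities are the positive
    and the negative part of \<open>K'\<close>.\<close>
  have "density lborel (\<lambda>x. ennreal (1 * K' x)) = density lborel (\<lambda>x. ennreal (- 1 * K' x))"
  proof (rule measure_eqI_lessThan)
    fix y
    let ?f = "\<lambda>x. indicator {y<..} x * K' x"
    have fin: "(\<integral>\<^sup>+x. ennreal (?f x) \<partial>lborel) < \<infinity>" "(\<integral>\<^sup>+x. ennreal (- ?f x) \<partial>lborel) < \<infinity>"
      using int_pos[of y] by (auto simp: real_integrable_def less_top)
    show "emeasure (density lborel (\<lambda>x. ennreal (1 * K' x))) {y<..} < \<infinity>"
      unfolding em using fin by simp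
    have "enn2real (\<integral>\<^sup>+x. ennreal (?f x) \<partial>lborel) = enn2real (\<integral>\<^sup>+x. ennreal (- ?f x) \<partial>lborel)"
      using real_lebesgue_integral_def[OF int_pos[of y]] I0[of y] by simp
    then have "(\<integral>\<^sup>+x. ennreal (?f x) \<partial>lborel) = (\<integral>\<^sup>+x. ennreal (- ?f x) \<partial>lborel)"
      using fin by (metis ennreal_enn2real infinity_ennreal_def)
    then show "emeasure (density lborel (\<lambda>x. ennreal (1 * K' x))) {y<..} = emeasure (density lborel (\<lambda>x. ennreal (- 1 * K' x))) {y<..}"
      unfolding em by simp
  qed auto
  then have "AE x in lborel. ennreal (1 * K' x) = ennreal (- 1 * K' x)"
    using K'(1) by (intro sigma_finite_measure.density_unique[OF sigma_finite_lborel]) auto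
  moreover have "r = 0" if "ennreal r = ennreal (- r)" for r
    using that by (cases "0 \<le> r") (auto simp: ennreal_neg)
  ultimately have "AE x in lborel. K' x = 0"
    by (auto elim!: eventually_mono)
  then have "AE x in lebesgue. K' x = 0" by (rule AE_completion)
  with AE have "AE x in lebesgue. x \<in> {0..b} \<longrightarrow> k x = 0"
    by eventually_elim (auto simp: K_def)
  then show ?thesis by (subst AE_restrict_space_iff) auto
qed

text \<open>The mean of the function over [t, t + h] is differentiable in t, and its derivative is a
  difference quotient of step h, so the Lipschitz constant bounds it uniformly in h.\<close>

lemma lipschitz_mollifier:
  fixes r :: "real \<Rightarrow> real"
  assumes l: "0 \<le> l" and L: "\<And>x y. x \<in> {0..l} \<Longrightarrow> y \<in> {0..l} \<Longrightarrow> \<bar>r x - r y\<bar> \<le> L * \<bar>x - y\<bar>"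
    and h: "0 < h" and L0: "0 \<le> L"
  obtains m d where "\<And>t. (m has_real_derivative d t) (at t)" "continuous_on UNIV d"
    "\<And>t. \<bar>d t\<bar> \<le> L" "\<And>t. t \<in> {0..l} \<Longrightarrow> \<bar>m t - r t\<bar> \<le> L * h"
proof -
  \<comment> \<open>Clamping the argument extends \<open>r\<close> to the line with the same
    Lipschitz constant, so that means reaching beyond l make sense.\<close>
  define R where "R x = r (max 0 (min l x))" for x
  have RL: "\<bar>R x - R y\<bar> \<le> L * \<bar>x - y\<bar>" for x y
  proof -
    have "\<bar>R x - R y\<bar> \<le> L * \<bar>max 0 (min l x) - max 0 (min l y)\<bar>"
      unfolding R_def using l by (intro L) auto
    also have "\<dots> \<le> L * \<bar>x - y\<bar>" using L0 by (intro mult_left_mono) auto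
    finally show ?thesis .
  qed
  have "L-lipschitz_on UNIV R"
    using RL L0 by (auto simp: lipschitz_on_def dist_real_def)
  then have cR: "continuous_on UNIV R" by (rule lipschitz_on_continuous_on)
  obtain S where S: "\<And>x. (S has_real_derivative R x) (at x)"
    using einterval_antiderivative[of "-\<infinity>" "\<infinity>" R] cR
    by (auto simp: continuous_on_eq_continuous_at has_real_derivative_iff_has_vector_derivative)
  have Sh: "((\<lambda>t. S (t + h)) has_real_derivative R (t + h)) (at t)" for t
    using S[of "t + h"] by (simp add: DERIV_shift)
  show ?thesis
  proof (rule that[of "\<lambda>t. (S (t + h) - S t) / h" "\<lambda>t. (R (t + h) - R t) / h"])
    show "((\<lambda>t. (S (t + h) - S t) / h) has_real_derivative (R (t + h) - R t) / h) (at t)" for t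
      by (intro DERIV_cdivide DERIV_diff Sh S)
    show "continuous_on UNIV (\<lambda>t. (R (t + h) - R t) / h)"
      using h by (intro continuous_intros continuous_on_compose2[OF cR]) auto
    show "\<bar>(R (t + h) - R t) / h\<bar> \<le> L" for t
      using RL[of "t + h" t] h by (simp add: divide_simps)
    show "\<bar>(S (t + h) - S t) / h - r t\<bar> \<le> L * h" if t: "t \<in> {0..l}" for t
    proof -
      obtain z where z: "t < z" "z < t + h" "S (t + h) - S t = (t + h - t) * R z"
        using MVT2[of t "t + h" S R] S h by auto
      have "(S (t + h) - S t) / h - r t = R z - R t"
        using z h t by (simp add: R_def)
      also have "\<bar>\<dots>\<bar> \<le> L * \<bar>z - t\<bar>" by (rule RL)
      also have "\<dots> \<le> L * h" using z L0 by (intro mult_left_mono) auto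
      finally show ?thesis .
    qed
  qed
qed

text \<open>Replacing \<open>r\<close> by a mollification avoids the almost everywhere derivative of \<open>r\<close>.\<close>

lemma by_parts_lipschitz:
  fixes g q r w w1 :: "real \<Rightarrow> real"
  assumes l: "0 \<le> l" and g: "g absolutely_integrable_on {0..l}"
    and q: "\<And>t. t \<in> {0..l} \<Longrightarrow> q t = c + integral {0..t} g"
    and w: "\<And>t. t \<in> {0..l} \<Longrightarrow> (w has_real_derivative w1 t) (at t within {0..l})"
    and w1: "continuous_on {0..l} w1"
    and L: "\<And>x y. x \<in> {0..l} \<Longrightarrow> y \<in> {0..l} \<Longrightarrow> \<bar>r x - r y\<bar> \<le> L * \<bar>x - y\<bar>" and L0: "0 \<le> L"
  shows "\<bar>integral {0..l} (\<lambda>t. q t * r t * w1 t) + integral {0..l} (\<lambda>t. g t * r t * w t)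
      - (q l * r l * w l - q 0 * r 0 * w 0)\<bar> \<le> L * integral {0..l} (\<lambda>t. \<bar>q t * w t\<bar>)"
    (is "\<bar>?T\<bar> \<le> ?B")
proof (rule field_le_epsilon)
  fix e :: real assume e: "0 < e"
  have cq: "continuous_on {0..l} q" by (rule primitive_continuous[OF g q])
  have cw: "continuous_on {0..l} w" using w by (meson DERIV_continuous_on)
  have "L-lipschitz_on {0..l} r"
    using L L0 by (auto simp: lipschitz_on_def dist_real_def)
  then have cr: "continuous_on {0..l} r" by (rule lipschitz_on_continuous_on)
  define K1 where "K1 = integral {0..l} (\<lambda>t. \<bar>q t * w1 t\<bar>)"
  define K2 where "K2 = integral {0..l} (\<lambda>t. \<bar>g t * w t\<bar>)"
  define K where "K = K1 + K2 + \<bar>q l * w l\<bar> + \<bar>q 0 * w 0\<bar>"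
  have gw: "(\<lambda>t. g t * w t) absolutely_integrable_on {0..l}"
    by (rule abs_integrable_mult_continuous[OF g cw])
  have K1: "0 \<le> K1" unfolding K1_def
    by (intro Henstock_Kurzweil_Integration.integral_nonneg integrable_continuous_real continuous_intros cq w1) auto
  have K2: "0 \<le> K2" unfolding K2_def using gw
    by (intro Henstock_Kurzweil_Integration.integral_nonneg) (auto simp: absolutely_integrable_on_def)
  have K: "0 \<le> K" using K1 K2 by (simp add: K_def)
  \<comment> \<open>Replacing \<open>r\<close> by its mollification changes the four terms by at
    most L * h * K in total. The summand 1 keeps the quotient defined when L * K = 0.\<close>
  define h where "h = e / (L * K + 1)"
  have LK: "0 \<le> L * K" using K L0 by simp
  have h: "0 < h" using e LK by (simp add: h_def)
  have hK: "L * h * K \<le> e"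
  proof -
    have "L * K / (L * K + 1) \<le> 1" using LK by simp
    then have "e * (L * K / (L * K + 1)) \<le> e * 1" using e by (intro mult_left_mono) auto
    then show ?thesis by (simp add: h_def mult_ac)
  qed
  obtain m d where m: "\<And>t. (m has_real_derivative d t) (at t)" "continuous_on UNIV d"
    "\<And>t. \<bar>d t\<bar> \<le> L" "\<And>t. t \<in> {0..l} \<Longrightarrow> \<bar>m t - r t\<bar> \<le> L * h"
    using lipschitz_mollifier[OF l L h L0] by metis
  have cm: "continuous_on {0..l} m" using m(1) by (meson DERIV_continuous_on has_field_derivative_at_within)
  have cd: "continuous_on {0..l} d" using m(2) continuous_on_subset by blast
  \<comment> \<open>With the smooth \<open>m\<close> the formula is exact. The term containing
    \<open>d\<close> is the only trace of a derivative of \<open>r\<close>, and its bound does not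
    depend on h.\<close>
  have parts: "integral {0..l} (\<lambda>t. g t * (m t * w t)) + integral {0..l} (\<lambda>t. q t * (d t * w t + w1 t * m t))
     = q l * (m l * w l) - q 0 * (m 0 * w 0)"
    by (rule by_parts_primitive[OF l g q])
      (auto intro!: DERIV_mult has_field_derivative_at_within[OF m(1)] w continuous_intros cd cw w1 cm)
  have split: "integral {0..l} (\<lambda>t. q t * (d t * w t + w1 t * m t)) =
     integral {0..l} (\<lambda>t. q t * d t * w t) + integral {0..l} (\<lambda>t. q t * m t * w1 t)"
    by (subst integral_add[symmetric])
       (auto intro!: integrable_continuous_real continuous_intros cq cd cw w1 cm simp: algebra_simps)
  have D: "\<bar>integral {0..l} (\<lambda>t. q t * d t * w t)\<bar> \<le> L * integral {0..l} (\<lambda>t. \<bar>q t * w t\<bar>)"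
  proof -
    have "norm (integral {0..l} (\<lambda>t. q t * d t * w t)) \<le> integral {0..l} (\<lambda>t. L * \<bar>q t * w t\<bar>)"
    proof (rule integral_norm_bound_integral)
      fix x
      show "norm (q x * d x * w x) \<le> L * \<bar>q x * w x\<bar>"
        using mult_right_mono[OF m(3)[of x], of "\<bar>q x * w x\<bar>"] by (simp add: abs_mult mult_ac)
    qed (intro integrable_continuous_real continuous_intros cq cd cw)+
    then show ?thesis by simp
  qed
  have E1: "\<bar>integral {0..l} (\<lambda>t. q t * r t * w1 t) - integral {0..l} (\<lambda>t. q t * m t * w1 t)\<bar> \<le> L * h * K1"
  proof -
    have "integral {0..l} (\<lambda>t. q t * r t * w1 t) - integral {0..l} (\<lambda>t. q t * m t * w1 t)
       = integral {0..l} (\<lambda>t. q t * r t * w1 t - q t * m t * w1 t)"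
      by (rule integral_diff[symmetric]) (intro integrable_continuous_real continuous_intros cq cr cm w1)+
    moreover have "norm (integral {0..l} (\<lambda>t. q t * r t * w1 t - q t * m t * w1 t)) \<le> integral {0..l} (\<lambda>t. (L * h) * \<bar>q t * w1 t\<bar>)"
    proof (rule integral_norm_bound_integral)
      fix x assume x: "x \<in> {0..l}"
      have "q x * r x * w1 x - q x * m x * w1 x = - ((m x - r x) * (q x * w1 x))" by (simp add: algebra_simps)
      then show "norm (q x * r x * w1 x - q x * m x * w1 x) \<le> (L * h) * \<bar>q x * w1 x\<bar>"
        using mult_right_mono[OF m(4)[OF x], of "\<bar>q x * w1 x\<bar>"] by (simp add: abs_mult)
    qed (intro integrable_continuous_real continuous_intros cq cr cm w1)+
    ultimately show ?thesis by (simp add: K1_def)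
  qed
  have E2: "\<bar>integral {0..l} (\<lambda>t. g t * r t * w t) - integral {0..l} (\<lambda>t. g t * (m t * w t))\<bar> \<le> L * h * K2"
  proof -
    have i1: "(\<lambda>t. g t * (r t * w t)) integrable_on {0..l}" "(\<lambda>t. g t * (m t * w t)) integrable_on {0..l}"
      by (auto intro!: abs_integrable_mult_continuous[OF g, THEN set_lebesgue_integral_eq_integral(1)] continuous_intros cr cw cm)
    have "integral {0..l} (\<lambda>t. g t * r t * w t) - integral {0..l} (\<lambda>t. g t * (m t * w t))
       = integral {0..l} (\<lambda>t. g t * (r t * w t) - g t * (m t * w t))"
      using i1 by (subst integral_diff) (auto simp: mult.assoc)
    moreover have "norm (integral {0..l} (\<lambda>t. g t * (r t * w t) - g t * (m t * w t))) \<le> integral {0..l} (\<lambda>t. (L * h) * \<bar>g t * w t\<bar>)"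
    proof (rule integral_norm_bound_integral)
      fix x assume x: "x \<in> {0..l}"
      have "g x * (r x * w x) - g x * (m x * w x) = - ((m x - r x) * (g x * w x))" by (simp add: algebra_simps)
      then show "norm (g x * (r x * w x) - g x * (m x * w x)) \<le> (L * h) * \<bar>g x * w x\<bar>"
        using mult_right_mono[OF m(4)[OF x], of "\<bar>g x * w x\<bar>"] by (simp add: abs_mult)
      next
        show "(\<lambda>t. L * h * \<bar>g t * w t\<bar>) integrable_on {0..l}"
          using gw by (intro integrable_on_mult_right) (auto simp: absolutely_integrable_on_def)
    qed (use i1 in \<open>intro integrable_diff; simp\<close>)
    ultimately show ?thesis by (simp add: K2_def)
  qed
  have E3: "\<bar>q x * r x * w x - q x * (m x * w x)\<bar> \<le> L * h * \<bar>q x * w x\<bar>" if x: "x \<in> {0..l}" for x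
  proof -
    have "q x * r x * w x - q x * (m x * w x) = - ((m x - r x) * (q x * w x))" by (simp add: algebra_simps)
    then show ?thesis
      using mult_right_mono[OF m(4)[OF x], of "\<bar>q x * w x\<bar>"] by (simp add: abs_mult)
  qed
  have "L * h * K = L * h * K1 + L * h * K2 + L * h * \<bar>q l * w l\<bar> + L * h * \<bar>q 0 * w 0\<bar>"
    by (simp add: K_def algebra_simps)
  then have sum: "L * h * K1 + L * h * K2 + L * h * \<bar>q l * w l\<bar> + L * h * \<bar>q 0 * w 0\<bar> \<le> e"
    using hK by simp
  have combine: "\<bar>A + B - (C - D)\<bar> \<le> X + e"
    if "\<bar>A - A'\<bar> \<le> a1" "\<bar>B - B'\<bar> \<le> a2" "\<bar>C - C'\<bar> \<le> a3" "\<bar>D - D'\<bar> \<le> a4" "\<bar>E\<bar> \<le> X"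
      "B' + (E + A') = C' - D'" "a1 + a2 + a3 + a4 \<le> e" for A B C D X A' B' C' D' E a1 a2 a3 a4 :: real
    using that by (auto simp: abs_le_iff)
  show "\<bar>?T\<bar> \<le> ?B + e"
    by (rule combine[OF E1 E2 E3 E3 D parts[unfolded split] sum]) (use l in auto)
qed

section \<open>Weak derivatives\<close>

lemma test_functionD:
  assumes "test_function b \<phi>"
  shows "(\<phi> has_real_derivative deriv \<phi> x) (at x)" "continuous_on A \<phi>" "continuous_on A (deriv \<phi>)"
    "\<phi> 0 = 0" "\<phi> b = 0"
proof -
  have d: "(deriv ^^ n) \<phi> differentiable (at x)" for n x
    using assms by (auto simp: test_function_def)
  show "(\<phi> has_real_derivative deriv \<phi> x) (at x)"
    using d[of 0 x] has_deriv_real by simp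
  show "continuous_on A \<phi>"
    using d[of 0] by (simp add: continuous_at_imp_continuous_on differentiable_imp_continuous_within)
  show "continuous_on A (deriv \<phi>)"
    using d[of 1] by (simp add: continuous_at_imp_continuous_on differentiable_imp_continuous_within)
  show "\<phi> 0 = 0" "\<phi> b = 0" using assms by (auto simp: test_function_def)
qed

text \<open>Subtracting a primitive of \<open>g\<close> leaves a function whose weak derivative is
  zero: integration by parts moves the derivative in the term with \<open>g\<close>, and test
  functions vanish at both ends.\<close>

lemma weak_deriv_orthogonal:
  assumes b: "0 < b" and fg: "has_weak_deriv b f g" and \<phi>: "test_function b \<phi>"
  shows "integral {0..b} (\<lambda>t. (f t - integral {0..t} g) * deriv \<phi> t) = 0"
proof -
  note T = test_functionD[OF \<phi>]
  have f: "f absolutely_integrable_on {0..b}" and g: "g absolutely_integrable_on {0..b}"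
    using fg by (simp_all add: has_weak_deriv_def integrable_lebesgue_on_iff)
  have fd: "(\<lambda>t. f t * deriv \<phi> t) absolutely_integrable_on {0..b}"
    and gp: "(\<lambda>t. g t * \<phi> t) absolutely_integrable_on {0..b}"
    by (intro abs_integrable_mult_continuous f g T)+
  have Pc: "continuous_on {0..b} (\<lambda>t. integral {0..t} g)"
    by (rule primitive_continuous[OF g, of _ 0]) simp
  have Pd: "(\<lambda>t. integral {0..t} g * deriv \<phi> t) integrable_on {0..b}"
    by (intro integrable_continuous_real continuous_intros Pc T)
  have "integral {0..b} (\<lambda>t. f t * deriv \<phi> t) = - integral {0..b} (\<lambda>t. g t * \<phi> t)"
    using fg \<phi> by (simp add: has_weak_deriv_def lebesgue_on_integral[OF fd, symmetric] lebesgue_on_integral[OF gp, symmetric])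
  moreover have "integral {0..b} (\<lambda>t. g t * \<phi> t) + integral {0..b} (\<lambda>t. integral {0..t} g * deriv \<phi> t) = 0"
    using by_parts_primitive[of b g "\<lambda>t. integral {0..t} g" 0 \<phi> "deriv \<phi>"] b g T
    by (simp add: has_field_derivative_at_within)
  moreover have "integral {0..b} (\<lambda>t. (f t - integral {0..t} g) * deriv \<phi> t)
      = integral {0..b} (\<lambda>t. f t * deriv \<phi> t) - integral {0..b} (\<lambda>t. integral {0..t} g * deriv \<phi> t)"
    unfolding left_diff_distrib
    by (rule integral_diff) (use fd Pd in \<open>auto simp: absolutely_integrable_on_def\<close>)
  ultimately show ?thesis by simp
qed

section \<open>The du Bois-Reymond lemma\<close>

lemma continuous_bump: "continuous_on A (bump s t n)"
  using smooth_bump[of s t n] unfolding smooth_def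
  by (metis continuous_at_imp_continuous_on differentiable_imp_continuous_within funpow_0)

lemma integral_bump_pos:
  assumes "0 \<le> s" "s < t" "t \<le> b"
  shows "0 < integral {0..b} (bump s t n)"
proof -
  have i: "bump s t n integrable_on {a..b}" for a b
    by (intro integrable_continuous_real continuous_bump)
  have "0 < integral {s..t} (bump s t n)"
    using integral_less_real[of s t "\<lambda>_. 0" "bump s t n"] assms bump_pos continuous_bump by simp
  also have "\<dots> \<le> integral {0..b} (bump s t n)"
    using assms bump_bounds by (intro integral_subset_le i) auto
  finally show ?thesis .
qed

text \<open>A combination of two bumps with total integral zero has a primitive that vanishes to the
  left and to the right of both supports. This provides enough derivatives of test
  functions.\<close>

lemma bump_difference_primitive:
  assumes b: "0 < b" and p: "0 < s" "s < t" "t < b" and q: "0 < s'" "s' < t'" "t' < b"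
    and k: "integral {0..b} (bump s t n) = k * integral {0..b} (bump s' t' m)"
  obtains F where "test_function b F" "\<And>x. deriv F x = bump s t n x - k * bump s' t' m x"
proof -
  define f where "f x = bump s t n x - k * bump s' t' m x" for x
  define lo where "lo = min s s'"
  define hi where "hi = max t t'"
  have lh: "0 < lo" "lo \<le> hi" "hi < b" using p q by (auto simp: lo_def hi_def)
  have f0: "f x = 0" if "x \<notin> {lo<..<hi}" for x
  proof -
    have "x \<notin> {s<..<t}" "x \<notin> {s'<..<t'}" using that by (auto simp: lo_def hi_def)
    then show ?thesis by (simp add: f_def bump_eq_0 del: greaterThanLessThan_iff)
  qed
  have cf: "continuous_on A f" for A
    unfolding f_def by (intro continuous_intros continuous_bump)
  define F where "F x = integral {0..x} f" for x
  have Fb: "F b = 0"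
    unfolding F_def f_def using k
    by (subst integral_diff) (auto intro!: integrable_continuous_real continuous_intros continuous_bump)
  have F1: "F x = 0" if "x \<le> lo" for x
    unfolding F_def by (rule integral_unique[OF has_integral_is_0]) (use that f0 in auto)
  have F2: "F x = 0" if "hi \<le> x" for x
  proof -
    have zero: "integral {y..z} f = 0" if "hi \<le> y" for y z
      by (rule integral_unique[OF has_integral_is_0]) (use that f0 in auto)
    have "F x = F hi + integral {hi..x} f" "F b = F hi + integral {hi..b} f"
      unfolding F_def using that lh
      by (auto intro!: Henstock_Kurzweil_Integration.integral_combine[symmetric] integrable_continuous_real cf)
    then show ?thesis using zero Fb by simp
  qed
  have D: "(F has_real_derivative f x) (at x)" for x
  proof -
    \<comment> \<open>The support stays away from 0 and b, so these open sets cover the line: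
      \<open>F\<close> is locally zero on the outer two, and the fundamental theorem applies on the
      middle one.\<close>
    consider "x < lo" | "x \<in> {0<..<b}" | "x > hi" using lh by fastforce
    then show ?thesis
    proof cases
      case 1
      have "((\<lambda>x. 0) has_real_derivative f x) (at x)" using 1 f0 by simp
      then show ?thesis
        by (rule has_field_derivative_transform_within_open[of _ _ _ "{..<lo}"]) (use 1 F1 in auto)
    next
      case 2
      have "(F has_real_derivative f x) (at x within {0..b})"
        unfolding F_def[abs_def] using 2 by (intro integral_has_real_derivative cf) auto
      moreover have "at x within {0..b} = at x"
        using 2 by (intro at_within_interior) auto
      ultimately show ?thesis by simp
    next
      case 3
      have "((\<lambda>x. 0) has_real_derivative f x) (at x)" using 3 f0 by simp
      then show ?thesis
        by (rule has_field_derivative_transform_within_open[of _ _ _ "{hi<..}"]) (use 3 F2 in auto)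
    qed
  qed
  have "smooth f"
    using smooth_add[OF smooth_bump smooth_mult[OF smooth_const smooth_bump], of s t n "-k" s' t' m]
    by (simp add: f_def[abs_def])
  then have "smooth F" using D by (rule smooth_antideriv)
  then have "test_function b F"
    unfolding test_function_def smooth_def using lh F1 F2
    by (intro conjI exI[of _ lo] exI[of _ hi]) auto
  moreover have "deriv F x = f x" for x using D by (rule DERIV_imp_deriv)
  ultimately show ?thesis using that f_def by simp
qed

text \<open>Let h be \<open>f\<close> minus the primitive of \<open>g\<close>. It is orthogonal to
  all zero-mean differences of bumps, so its mean against every bump is the same constant c. Letting
  the bumps tend to indicators, h - c integrates to zero over every inner interval and hence
  vanishes almost everywhere.\<close>

lemma weak_deriv_imp_primitive:
  assumes b: "0 < b" and fg: "has_weak_deriv b f g"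
  shows "\<exists>c. AE t in lebesgue_on {0..b}. f t = c + integral {0..t} g"
proof -
  have f: "f absolutely_integrable_on {0..b}" and g: "g absolutely_integrable_on {0..b}"
    using fg by (simp_all add: has_weak_deriv_def integrable_lebesgue_on_iff)
  define h where "h t = f t - integral {0..t} g" for t
  have Pc: "continuous_on {0..b} (\<lambda>t. integral {0..t} g)"
    by (rule primitive_continuous[OF g, of _ 0]) simp
  have h: "h absolutely_integrable_on {0..b}"
    unfolding h_def[abs_def] using f absolutely_integrable_continuous_real[OF Pc] by (rule set_integral_diff)
  \<comment> \<open>A fixed reference bump on the middle third; the mean of \<open>h\<close> against
    it is the constant of the statement.\<close>
  define \<eta> where "\<eta> = bump (b / 3) (2 * b / 3) 0"
  have \<eta>: "0 < integral {0..b} \<eta>" unfolding \<eta>_def using b by (intro integral_bump_pos) auto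
  define c where "c = integral {0..b} (\<lambda>t. h t * \<eta> t) / integral {0..b} \<eta>"
  have hb: "(\<lambda>x. h x * bump s t n x) absolutely_integrable_on {0..b}" for s t n
    by (intro abs_integrable_mult_continuous h continuous_bump)
  have bi: "bump s t n integrable_on {0..b}" for s t n
    by (intro integrable_continuous_real continuous_bump)
  have eqn: "integral {0..b} (\<lambda>x. h x * bump s t n x) = c * integral {0..b} (bump s t n)"
    if st: "0 < s" "s < t" "t < b" for s t n
  proof -
    \<comment> \<open>The factor that equalizes the masses, so that the difference of the bumps is
      the derivative of a test function.\<close>
    define k where "k = integral {0..b} (bump s t n) / integral {0..b} \<eta>"
    have "integral {0..b} (bump s t n) = k * integral {0..b} (bump (b / 3) (2 * b / 3) 0)"
      using \<eta> by (simp add: k_def \<eta>_def)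
    then obtain F where F: "test_function b F" "\<And>x. deriv F x = bump s t n x - k * \<eta> x"
      unfolding \<eta>_def using bump_difference_primitive[OF b st, of "b / 3" "2 * b / 3"] b by auto blast
    have "0 = integral {0..b} (\<lambda>x. h x * bump s t n x - k * (h x * \<eta> x))"
      using weak_deriv_orthogonal[OF b fg F(1)] by (simp add: h_def F(2) algebra_simps)
    also have "\<dots> = integral {0..b} (\<lambda>x. h x * bump s t n x) - integral {0..b} (\<lambda>x. k * (h x * \<eta> x))"
      using hb by (intro integral_diff) (auto simp: \<eta>_def absolutely_integrable_on_def intro!: integrable_on_mult_right)
    finally show ?thesis by (simp add: k_def c_def)
  qed
  have lim: "integral {s..t} (\<lambda>x. h x - c) = 0" if st: "0 < s" "s < t" "t < b" for s t
  proof -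
    have i1: "(\<lambda>n. integral {0..b} (\<lambda>x. h x * bump s t n x)) \<longlonglongrightarrow> integral {0..b} (\<lambda>x. h x * indicator {s<..<t} x)"
    proof (rule dominated_convergence(2)[where h = "\<lambda>x. \<bar>h x\<bar>"])
      show "(\<lambda>x. h x * bump s t n x) integrable_on {0..b}" for n
        using hb by (simp add: absolutely_integrable_on_def)
      show "(\<lambda>x. \<bar>h x\<bar>) integrable_on {0..b}" using h by (simp add: absolutely_integrable_on_def)
      show "norm (h x * bump s t n x) \<le> \<bar>h x\<bar>" for n x
        using bump_bounds[of s t n x] by (simp add: abs_mult mult_left_le)
      show "(\<lambda>n. h x * bump s t n x) \<longlonglongrightarrow> h x * indicator {s<..<t} x" for x
        by (intro tendsto_intros bump_tendsto)
    qed
    have i2: "(\<lambda>n. integral {0..b} (bump s t n)) \<longlonglongrightarrow> integral {0..b} (indicat_real {s<..<t})"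
    proof (rule dominated_convergence(2)[where h = "\<lambda>x. 1"])
      show "(bump s t n) integrable_on {0..b}" for n by (rule bi)
      show "norm (bump s t n x) \<le> 1" for n x
        using bump_bounds[of s t n x] by simp
    qed (auto intro: bump_tendsto)
    have "(\<lambda>n. integral {0..b} (\<lambda>x. h x * bump s t n x)) \<longlonglongrightarrow> c * integral {0..b} (indicat_real {s<..<t})"
      unfolding eqn[OF st] by (intro tendsto_intros i2)
    then have eq: "integral {0..b} (\<lambda>x. h x * indicator {s<..<t} x) = c * integral {0..b} (indicat_real {s<..<t})"
      using i1 LIMSEQ_unique by blast
    have restr: "integral {0..b} (\<lambda>x. k x * indicator {s<..<t} x) = integral {s..t} k" for k :: "real \<Rightarrow> real"
    proof -
      have "integral {0..b} (\<lambda>x. k x * indicator {s<..<t} x) = integral {0..b} (\<lambda>x. if x \<in> {s<..<t} then k x else 0)"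
        by (intro integral_cong) (auto simp: indicator_def)
      also have "\<dots> = integral ({0..b} \<inter> {s<..<t}) k" by (subst integral_restrict_Int) (simp add: Int_commute)
      also have "{0..b} \<inter> {s<..<t} = {s<..<t}" using st by auto
      also have "integral {s<..<t} k = integral {s..t} k" by (simp add: integral_open_interval_real)
      finally show ?thesis .
    qed
    have "integral {s..t} h = c * integral {s..t} (\<lambda>x. 1)"
      using eq restr[of h] restr[of "\<lambda>x. 1"] by simp
    moreover have "h integrable_on {s..t}"
      using abs_integrable_sub[OF h, of s t] st by (simp add: absolutely_integrable_on_def)
    ultimately show ?thesis using st by (subst integral_diff) auto
  qed
  have hc: "(\<lambda>x. h x - c) absolutely_integrable_on {0..b}"
    using h by (intro set_integral_diff) auto
  define H where "H t = integral {0..t} (\<lambda>x. h x - c)" for t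
  have Hc: "continuous_on {0..b} H" by (rule primitive_continuous[OF hc, of _ 0]) (simp add: H_def)
  \<comment> \<open>\<open>lim\<close> covers only intervals strictly inside. \<open>H\<close> is
    therefore compared with its value at the midpoint; continuity extends the constancy to the ends,
    and \<open>H 0\<close> is zero.\<close>
  define m where "m = b / 2"
  have m: "0 < m" "m < b" using b by (auto simp: m_def)
  have Hm: "H t = H m" if t: "t \<in> {0<..<b}" for t
  proof (cases t m rule: linorder_cases)
    case less
    then show ?thesis unfolding H_def using integral_diff_Icc[OF hc, of t m] lim[of t m] t m by auto
  next
    case greater
    then show ?thesis unfolding H_def using integral_diff_Icc[OF hc, of m t] lim[of m t] t m by auto
  qed simp
  have Hm': "H t = H m" if t: "t \<in> {0..b}" for t
  proof (rule continuous_constant_on_closure[of "{0<..<b}" H "H m" t])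
    show "continuous_on (closure {0<..<b}) H" using b Hc by simp
    show "t \<in> closure {0<..<b}" using b t by simp
  qed (use Hm in auto)
  have "H 0 = 0" by (simp add: H_def)
  then have "H t = 0" if "t \<in> {0..b}" for t using Hm'[OF that] Hm'[of 0] b by simp
  then have "AE t in lebesgue_on {0..b}. h t - c = 0"
    using AE_zero_if_primitive_zero[OF _ hc] b by (simp add: H_def)
  then have "AE t in lebesgue_on {0..b}. f t = c + integral {0..t} g"
    by (rule AE_mp) (auto simp: h_def)
  then show ?thesis by blast
qed

section \<open>The Heinz inequality\<close>

text \<open>The weight of the real interpolation norm for squared K-functionals. Values in
  \<open>ennreal\<close> allow sums and integrals to be exchanged without integrability
  conditions.\<close>

definition heinz_weight :: "real \<Rightarrow> real \<Rightarrow> ennreal" where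
  "heinz_weight \<alpha> t = indicator {0<..} t * ennreal (t powr (- \<alpha> - 1))"

text \<open>The minimum over z of (1 - z)^2 + (s z)^2, attained at z = 1 / (1 + s^2): the squared
  K-functional of a single eigendirection, with s = t \<mu>.\<close>

definition heinz_kernel :: "real \<Rightarrow> real" where
  "heinz_kernel s = s\<^sup>2 / (1 + s\<^sup>2)"

lemma heinz_kernel_bounds: "0 \<le> heinz_kernel s" "heinz_kernel s \<le> 1" "heinz_kernel s \<le> s\<^sup>2"
proof -
  have p: "0 < 1 + s\<^sup>2" by (simp add: add_pos_nonneg)
  show "0 \<le> heinz_kernel s" "heinz_kernel s \<le> 1" using p by (simp_all add: heinz_kernel_def)
  have "s\<^sup>2 \<le> s\<^sup>2 * (1 + s\<^sup>2)" by (simp add: algebra_simps)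
  then show "heinz_kernel s \<le> s\<^sup>2" using p by (simp add: heinz_kernel_def pos_divide_le_eq)
qed

lemma heinz_measurable [measurable]:
  "heinz_weight \<alpha> \<in> borel_measurable borel" "heinz_kernel \<in> borel_measurable borel"
  unfolding heinz_weight_def[abs_def] heinz_kernel_def[abs_def] by measurable

lemma heinz_integral_scale:
  assumes "0 < m"
  shows "(\<integral>\<^sup>+t. heinz_weight \<alpha> t * ennreal (heinz_kernel (t * m)) \<partial>lborel)
    = ennreal (m powr \<alpha>) * (\<integral>\<^sup>+t. heinz_weight \<alpha> t * ennreal (heinz_kernel t) \<partial>lborel)"
proof -
  have w: "heinz_weight \<alpha> (m * t) = ennreal (m powr (- \<alpha> - 1)) * heinz_weight \<alpha> t" for t
    using assms by (auto simp: heinz_weight_def indicator_def zero_less_mult_iff powr_mult ennreal_mult)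
  have "(\<integral>\<^sup>+t. heinz_weight \<alpha> t * ennreal (heinz_kernel t) \<partial>lborel)
     = ennreal m * (\<integral>\<^sup>+t. heinz_weight \<alpha> (m * t) * ennreal (heinz_kernel (m * t)) \<partial>lborel)"
    using assms nn_integral_real_affine[of "\<lambda>t. heinz_weight \<alpha> t * ennreal (heinz_kernel t)" m 0] by simp
  also have "\<dots> = ennreal m * (ennreal (m powr (- \<alpha> - 1)) * (\<integral>\<^sup>+t. heinz_weight \<alpha> t * ennreal (heinz_kernel (t * m)) \<partial>lborel))"
    by (simp add: w nn_integral_cmult mult.assoc) (simp add: mult.commute)
  finally have "ennreal (m powr \<alpha>) * (\<integral>\<^sup>+t. heinz_weight \<alpha> t * ennreal (heinz_kernel t) \<partial>lborel)
    = ennreal (m powr \<alpha> * m * m powr (- \<alpha> - 1)) * (\<integral>\<^sup>+t. heinz_weight \<alpha> t * ennreal (heinz_kernel (t * m)) \<partial>lborel)"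
    using assms by (simp add: ennreal_mult mult_ac)
  moreover have "m powr \<alpha> * m * m powr (- \<alpha> - 1) = 1"
  proof -
    have "m powr \<alpha> * m * m powr (- \<alpha> - 1) = m powr \<alpha> * m powr 1 * m powr (- \<alpha> - 1)" using assms by simp
    also have "\<dots> = m powr (\<alpha> + 1 + (- \<alpha> - 1))" by (simp only: powr_add)
    finally show ?thesis using assms by simp
  qed
  ultimately show ?thesis by simp
qed

text \<open>Near 0 the kernel is at most t^2, which leaves t^(1 - \<alpha>), integrable for \<alpha>
  < 2. At infinity it is at most 1, which leaves t^(- \<alpha> - 1), integrable for \<alpha> >
  0.\<close>

lemma heinz_integral_finite:
  assumes "0 < \<alpha>" "\<alpha> < 2"
  shows "(\<integral>\<^sup>+t. heinz_weight \<alpha> t * ennreal (heinz_kernel t) \<partial>lborel) < \<infinity>"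
proof -
  have 1: "(\<integral>\<^sup>+t. ennreal (indicator {0..1} t * t powr (1 - \<alpha>)) \<partial>lborel) = ennreal (1 powr (1 - \<alpha> + 1) / (1 - \<alpha> + 1))"
    using assms by (intro nn_integral_has_integral_lebesgue has_integral_powr_from_0) auto
  have 2: "(\<integral>\<^sup>+t. ennreal (indicator {1..} t * t powr (- \<alpha> - 1)) \<partial>lborel) = ennreal (- (1 powr (- \<alpha> - 1 + 1)) / (- \<alpha> - 1 + 1))"
    using assms by (intro nn_integral_has_integral_lebesgue has_integral_powr_to_inf) auto
  have "heinz_weight \<alpha> t * ennreal (heinz_kernel t) \<le>
      ennreal (indicator {0..1} t * t powr (1 - \<alpha>)) + ennreal (indicator {1..} t * t powr (- \<alpha> - 1))" for t
  proof -
    consider "t \<le> 0" | "0 < t" "t \<le> 1" | "1 < t" by linarith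
    then show ?thesis
    proof cases
      case 2
      have "t powr (- \<alpha> - 1) * heinz_kernel t \<le> t powr (- \<alpha> - 1) * t powr 2"
        using heinz_kernel_bounds(3)[of t] 2 by (intro mult_left_mono) auto
      also have "\<dots> = t powr (1 - \<alpha>)" by (simp add: powr_add[symmetric])
      finally have "ennreal (t powr (- \<alpha> - 1) * heinz_kernel t) \<le> ennreal (indicator {0..1} t * t powr (1 - \<alpha>))"
        using 2 by (simp add: ennreal_leI)
      moreover have "heinz_weight \<alpha> t * ennreal (heinz_kernel t) = ennreal (t powr (- \<alpha> - 1) * heinz_kernel t)"
        using 2 by (simp add: heinz_weight_def ennreal_mult heinz_kernel_bounds)
      ultimately show ?thesis by (metis add_increasing2 zero_le)
    next
      case 3
      have "t powr (- \<alpha> - 1) * heinz_kernel t \<le> t powr (- \<alpha> - 1) * 1"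
        using heinz_kernel_bounds(2)[of t] by (intro mult_left_mono) auto
      then have "ennreal (t powr (- \<alpha> - 1) * heinz_kernel t) \<le> ennreal (indicator {1..} t * t powr (- \<alpha> - 1))"
        using 3 by (simp add: ennreal_leI)
      moreover have "heinz_weight \<alpha> t * ennreal (heinz_kernel t) = ennreal (t powr (- \<alpha> - 1) * heinz_kernel t)"
        using 3 by (simp add: heinz_weight_def ennreal_mult heinz_kernel_bounds)
      ultimately show ?thesis by (metis add_increasing zero_le)
    qed (simp add: heinz_weight_def)
  qed
  then have "(\<integral>\<^sup>+t. heinz_weight \<alpha> t * ennreal (heinz_kernel t) \<partial>lborel) \<le>
     (\<integral>\<^sup>+t. ennreal (indicator {0..1} t * t powr (1 - \<alpha>)) + ennreal (indicator {1..} t * t powr (- \<alpha> - 1)) \<partial>lborel)"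
    by (intro nn_integral_mono)
  also have "\<dots> = (\<integral>\<^sup>+t. ennreal (indicator {0..1} t * t powr (1 - \<alpha>)) \<partial>lborel) + (\<integral>\<^sup>+t. ennreal (indicator {1..} t * t powr (- \<alpha> - 1)) \<partial>lborel)"
    by (rule nn_integral_add) measurable
  also have "\<dots> < \<infinity>" unfolding 1 2 by simp
  finally show ?thesis .
qed

text \<open>Together with finiteness this allows the constant to be cancelled from an inequality
  between extended reals.\<close>

lemma heinz_integral_pos:
  assumes "0 < \<alpha>"
  shows "0 < (\<integral>\<^sup>+t. heinz_weight \<alpha> t * ennreal (heinz_kernel t) \<partial>lborel)"
proof -
  \<comment> \<open>On [1, 2] the weight is at least its value at 2, and the kernel at least its
    value 1/2 at 1.\<close>
  define c where "c = 2 powr (- \<alpha> - 1) * (1 / 2)"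
  have "0 < ennreal c" by (simp add: c_def)
  also have "ennreal c = (\<integral>\<^sup>+t. ennreal c * indicator {1..2::real} t \<partial>lborel)"
    by (subst nn_integral_cmult_indicator) auto
  also have "\<dots> \<le> (\<integral>\<^sup>+t. heinz_weight \<alpha> t * ennreal (heinz_kernel t) \<partial>lborel)"
  proof (rule nn_integral_mono)
    fix t :: real
    show "ennreal c * indicator {1..2} t \<le> heinz_weight \<alpha> t * ennreal (heinz_kernel t)"
    proof (cases "t \<in> {1..2}")
      case True
      have "2 powr (- \<alpha> - 1) \<le> t powr (- \<alpha> - 1)" using True assms by (intro powr_mono2') auto
      moreover have "1 / 2 \<le> heinz_kernel t"
      proof -
        have "1 \<le> t\<^sup>2" using True by (simp add: one_le_power)
        then show ?thesis by (simp add: heinz_kernel_def divide_simps add_pos_nonneg)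
      qed
      ultimately have "c \<le> t powr (- \<alpha> - 1) * heinz_kernel t" unfolding c_def by (intro mult_mono) auto
      then have "ennreal c \<le> ennreal (t powr (- \<alpha> - 1) * heinz_kernel t)" by (rule ennreal_leI)
      moreover have "heinz_weight \<alpha> t * ennreal (heinz_kernel t) = ennreal (t powr (- \<alpha> - 1) * heinz_kernel t)"
        using True by (simp add: heinz_weight_def ennreal_mult heinz_kernel_bounds)
      ultimately show ?thesis using True by simp
    qed simp
  qed
  finally show ?thesis .
qed

text \<open>The weights \<open>m powr \<alpha>\<close> are, up to a constant, superpositions of the dilated kernels
  \<open>heinz_kernel (t * m)\<close>, so inequalities for all dilations can be integrated over \<open>t\<close>.\<close>

lemma heinz_integrate:
  fixes \<mu> \<nu> p q :: "nat \<Rightarrow> real"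
  assumes \<alpha>: "0 < \<alpha>" "\<alpha> < 2" and E: "finite E" and C: "0 \<le> C"
    and pos: "\<And>i. i \<in> E \<Longrightarrow> 0 < \<mu> i" "\<And>j. j \<in> J \<Longrightarrow> 0 < \<nu> j" and p: "\<And>i. i \<in> E \<Longrightarrow> 0 \<le> p i"
    and q: "\<And>j. j \<in> J \<Longrightarrow> 0 \<le> q j" "q summable_on J"
    and le: "\<And>t. 0 < t \<Longrightarrow> (\<Sum>i\<in>E. heinz_kernel (t * \<mu> i) * p i) \<le> C * (\<Sum>\<^sub>\<infinity>j\<in>J. heinz_kernel (t * \<nu> j) * q j)"
    and sum: "(\<lambda>j. \<nu> j powr \<alpha> * q j) summable_on J"
  shows "(\<Sum>i\<in>E. \<mu> i powr \<alpha> * p i) \<le> C * (\<Sum>\<^sub>\<infinity>j\<in>J. \<nu> j powr \<alpha> * q j)"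
proof -
  define I1 where "I1 = (\<integral>\<^sup>+t. heinz_weight \<alpha> t * ennreal (heinz_kernel t) \<partial>lborel)"
  have I1: "0 < I1" "I1 < \<infinity>" using heinz_integral_finite heinz_integral_pos \<alpha> by (auto simp: I1_def)
  have scale: "(\<integral>\<^sup>+t. heinz_weight \<alpha> t * ennreal (heinz_kernel (t * m)) \<partial>lborel) = ennreal (m powr \<alpha>) * I1" if "0 < m" for m
    unfolding I1_def by (rule heinz_integral_scale[OF that])
  \<comment> \<open>Unordered sums over \<open>J\<close> become series over all naturals, extended
    by zero, to which monotone convergence applies.\<close>
  have suminf: "ennreal (\<Sum>\<^sub>\<infinity>j\<in>J. f j) = (\<Sum>j. ennreal (if j \<in> J then f j else 0))"
    if "f summable_on J" "\<And>j. j \<in> J \<Longrightarrow> 0 \<le> f j" for f :: "nat \<Rightarrow> real"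
  proof -
    have "((\<lambda>j. if j \<in> J then f j else 0) has_sum (\<Sum>\<^sub>\<infinity>j\<in>J. f j)) UNIV"
      using has_sum_cong_neutral[where S = J and T = UNIV and f = f and g = "\<lambda>j. if j \<in> J then f j else 0"]
        has_sum_infsum[OF that(1)] by simp
    then have "(\<lambda>j. if j \<in> J then f j else 0) sums (\<Sum>\<^sub>\<infinity>j\<in>J. f j)" by (rule has_sum_imp_sums)
    then show ?thesis using that(2)
      by (subst suminf_ennreal2) (auto simp: sums_iff)
  qed
  have "ennreal (\<Sum>i\<in>E. \<mu> i powr \<alpha> * p i) = (\<Sum>i\<in>E. ennreal (p i) * ennreal (\<mu> i powr \<alpha>))"
    using p by (subst sum_ennreal[symmetric]) (auto simp: ennreal_mult mult.commute)
  then have "ennreal (\<Sum>i\<in>E. \<mu> i powr \<alpha> * p i) * I1 = (\<Sum>i\<in>E. ennreal (p i) * (ennreal (\<mu> i powr \<alpha>) * I1))"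
    by (simp add: sum_distrib_right mult.assoc)
  also have "\<dots> = (\<Sum>i\<in>E. \<integral>\<^sup>+t. ennreal (p i) * (heinz_weight \<alpha> t * ennreal (heinz_kernel (t * \<mu> i))) \<partial>lborel)"
    using pos by (intro sum.cong HOL.refl) (simp add: nn_integral_cmult scale)
  also have "\<dots> = (\<integral>\<^sup>+t. (\<Sum>i\<in>E. ennreal (p i) * (heinz_weight \<alpha> t * ennreal (heinz_kernel (t * \<mu> i)))) \<partial>lborel)"
    by (subst nn_integral_sum) auto
  also have "\<dots> \<le> (\<integral>\<^sup>+t. (\<Sum>j. ennreal C * (ennreal (if j \<in> J then q j else 0) * (heinz_weight \<alpha> t * ennreal (heinz_kernel (t * \<nu> j))))) \<partial>lborel)"
  proof (rule nn_integral_mono)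
    fix t :: real
    show "(\<Sum>i\<in>E. ennreal (p i) * (heinz_weight \<alpha> t * ennreal (heinz_kernel (t * \<mu> i))))
       \<le> (\<Sum>j. ennreal C * (ennreal (if j \<in> J then q j else 0) * (heinz_weight \<alpha> t * ennreal (heinz_kernel (t * \<nu> j)))))"
    proof (cases "0 < t")
      case False
      then have "heinz_weight \<alpha> t = 0" by (simp add: heinz_weight_def)
      then show ?thesis by simp
    next
      case True
      have "(\<Sum>i\<in>E. ennreal (p i) * (heinz_weight \<alpha> t * ennreal (heinz_kernel (t * \<mu> i))))
          = heinz_weight \<alpha> t * ennreal (\<Sum>i\<in>E. heinz_kernel (t * \<mu> i) * p i)"
      proof -
        have "ennreal (\<Sum>i\<in>E. heinz_kernel (t * \<mu> i) * p i) = (\<Sum>i\<in>E. ennreal (heinz_kernel (t * \<mu> i)) * ennreal (p i))"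
          using p by (subst sum_ennreal[symmetric]) (auto simp: heinz_kernel_bounds ennreal_mult)
        then show ?thesis by (simp add: sum_distrib_left mult_ac)
      qed
      also have "\<dots> \<le> heinz_weight \<alpha> t * ennreal (C * (\<Sum>\<^sub>\<infinity>j\<in>J. heinz_kernel (t * \<nu> j) * q j))"
        by (intro mult_left_mono ennreal_leI le True) simp
      also have "\<dots> = heinz_weight \<alpha> t * (ennreal C * (\<Sum>j. ennreal (if j \<in> J then heinz_kernel (t * \<nu> j) * q j else 0)))"
      proof -
        have s: "(\<lambda>j. heinz_kernel (t * \<nu> j) * q j) summable_on J"
          by (rule summable_on_comparison_test[OF q(2)])
             (auto simp: q heinz_kernel_bounds mult_left_le_one_le)
        have "0 \<le> (\<Sum>\<^sub>\<infinity>j\<in>J. heinz_kernel (t * \<nu> j) * q j)"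
          by (intro infsum_nonneg mult_nonneg_nonneg heinz_kernel_bounds q)
        then show ?thesis using C
          by (subst suminf[symmetric, OF s]) (auto simp: q heinz_kernel_bounds ennreal_mult)
      qed
      also have "\<dots> = (\<Sum>j. heinz_weight \<alpha> t * (ennreal C * ennreal (if j \<in> J then heinz_kernel (t * \<nu> j) * q j else 0)))"
        by simp
      also have "\<dots> = (\<Sum>j. ennreal C * (ennreal (if j \<in> J then q j else 0) * (heinz_weight \<alpha> t * ennreal (heinz_kernel (t * \<nu> j)))))"
        by (intro suminf_cong) (auto simp: q heinz_kernel_bounds ennreal_mult mult_ac)
      finally show ?thesis .
    qed
  qed
  \<comment> \<open>Monotone convergence exchanges the series with the integral; then each dilated
    kernel integrates to a multiple of \<nu>^\<alpha> by \<open>scale\<close>.\<close>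
  also have "\<dots> = (\<Sum>j. \<integral>\<^sup>+t. ennreal C * (ennreal (if j \<in> J then q j else 0) * (heinz_weight \<alpha> t * ennreal (heinz_kernel (t * \<nu> j)))) \<partial>lborel)"
    by (rule nn_integral_suminf) measurable
  also have "\<dots> = (\<Sum>j. ennreal C * (ennreal (if j \<in> J then \<nu> j powr \<alpha> * q j else 0) * I1))"
  proof (rule suminf_cong)
    fix j
    show "(\<integral>\<^sup>+t. ennreal C * (ennreal (if j \<in> J then q j else 0) * (heinz_weight \<alpha> t * ennreal (heinz_kernel (t * \<nu> j)))) \<partial>lborel)
       = ennreal C * (ennreal (if j \<in> J then \<nu> j powr \<alpha> * q j else 0) * I1)"
      using pos(2)[of j] q(1)[of j]
      by (cases "j \<in> J", simp_all add: nn_integral_cmult scale ennreal_mult) (simp add: mult_ac)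
  qed
  also have "\<dots> = ennreal C * ((\<Sum>j. ennreal (if j \<in> J then \<nu> j powr \<alpha> * q j else 0)) * I1)"
    by simp
  also have "\<dots> = ennreal (C * (\<Sum>\<^sub>\<infinity>j\<in>J. \<nu> j powr \<alpha> * q j)) * I1"
  proof -
    have "0 \<le> (\<Sum>\<^sub>\<infinity>j\<in>J. \<nu> j powr \<alpha> * q j)" using q by (intro infsum_nonneg) auto
    then show ?thesis using C q by (subst suminf[OF sum, symmetric]) (simp_all add: ennreal_mult mult.assoc)
  qed
  finally have "ennreal (\<Sum>i\<in>E. \<mu> i powr \<alpha> * p i) \<le> ennreal (C * (\<Sum>\<^sub>\<infinity>j\<in>J. \<nu> j powr \<alpha> * q j))"
    using I1 by (metis ennreal_mult_le_mult_iff infinity_ennreal_def less_irrefl mult.commute)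
  moreover have "0 \<le> C * (\<Sum>\<^sub>\<infinity>j\<in>J. \<nu> j powr \<alpha> * q j)"
    using C q by (intro mult_nonneg_nonneg infsum_nonneg) auto
  ultimately show ?thesis by (simp add: ennreal_le_iff)
qed

section \<open>Orthonormal families and the comparison of K-functionals\<close>

locale semi_inner_space =
  fixes V :: "('x \<Rightarrow> real) set" and ip :: "('x \<Rightarrow> real) \<Rightarrow> ('x \<Rightarrow> real) \<Rightarrow> real"
  assumes zero_mem: "(\<lambda>x. 0) \<in> V"
    and add_mem: "u \<in> V \<Longrightarrow> v \<in> V \<Longrightarrow> (\<lambda>x. u x + v x) \<in> V"
    and scale_mem: "u \<in> V \<Longrightarrow> (\<lambda>x. c * u x) \<in> V"
    and ip_sym: "u \<in> V \<Longrightarrow> v \<in> V \<Longrightarrow> ip u v = ip v u"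
    and ip_add: "u \<in> V \<Longrightarrow> v \<in> V \<Longrightarrow> w \<in> V \<Longrightarrow> ip (\<lambda>x. u x + v x) w = ip u w + ip v w"
    and ip_scale: "u \<in> V \<Longrightarrow> w \<in> V \<Longrightarrow> ip (\<lambda>x. c * u x) w = c * ip u w"
    and ip_nonneg: "u \<in> V \<Longrightarrow> 0 \<le> ip u u"
begin

definition orthonormal :: "nat set \<Rightarrow> (nat \<Rightarrow> 'x \<Rightarrow> real) \<Rightarrow> bool" where
  "orthonormal I \<psi> \<longleftrightarrow> (\<forall>i\<in>I. \<psi> i \<in> V) \<and> (\<forall>i\<in>I. \<forall>j\<in>I. ip (\<psi> i) (\<psi> j) = (if i = j then 1 else 0))"

definition complete_family :: "nat set \<Rightarrow> (nat \<Rightarrow> 'x \<Rightarrow> real) \<Rightarrow> bool" where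
  "complete_family I \<psi> \<longleftrightarrow> (\<forall>u\<in>V. \<forall>\<epsilon>>0. \<exists>F c. finite F \<and> F \<subseteq> I \<and>
     ip (\<lambda>x. u x - (\<Sum>i\<in>F. c i * \<psi> i x)) (\<lambda>x. u x - (\<Sum>i\<in>F. c i * \<psi> i x)) < \<epsilon>)"

lemma ip_zero: "w \<in> V \<Longrightarrow> ip (\<lambda>x. 0) w = 0"
  using ip_scale[of w w 0] by simp

lemma diff_mem: "u \<in> V \<Longrightarrow> v \<in> V \<Longrightarrow> (\<lambda>x. u x - v x) \<in> V"
  using add_mem[OF _ scale_mem[of v "-1"], of u] by simp

lemma ip_diff: "u \<in> V \<Longrightarrow> v \<in> V \<Longrightarrow> w \<in> V \<Longrightarrow> ip (\<lambda>x. u x - v x) w = ip u w - ip v w"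
  using ip_add[OF _ scale_mem[of v "-1"], of u w] ip_scale[of v w "-1"] by simp

lemma sum_mem: "finite F \<Longrightarrow> (\<And>i. i \<in> F \<Longrightarrow> \<psi> i \<in> V) \<Longrightarrow> (\<lambda>x. \<Sum>i\<in>F. c i * \<psi> i x) \<in> V"
  by (induction F rule: finite_induct) (auto simp: zero_mem intro!: add_mem scale_mem)

lemma ip_sum: "finite F \<Longrightarrow> (\<And>i. i \<in> F \<Longrightarrow> \<psi> i \<in> V) \<Longrightarrow> w \<in> V \<Longrightarrow>
    ip (\<lambda>x. \<Sum>i\<in>F. c i * \<psi> i x) w = (\<Sum>i\<in>F. c i * ip (\<psi> i) w)"
  by (induction F rule: finite_induct) (simp_all add: ip_zero ip_add ip_scale scale_mem sum_mem)

context
  fixes I \<psi> assumes on: "orthonormal I \<psi>"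
begin

lemma orthonormalD: "i \<in> I \<Longrightarrow> \<psi> i \<in> V"
  "i \<in> I \<Longrightarrow> j \<in> I \<Longrightarrow> ip (\<psi> i) (\<psi> j) = (if i = j then 1 else 0)"
  using on by (auto simp: orthonormal_def)

lemma ip_comb_basis:
  assumes "finite F" "F \<subseteq> I" "j \<in> F"
  shows "ip (\<lambda>x. \<Sum>i\<in>F. c i * \<psi> i x) (\<psi> j) = c j"
proof -
  have "ip (\<lambda>x. \<Sum>i\<in>F. c i * \<psi> i x) (\<psi> j) = (\<Sum>i\<in>F. c i * ip (\<psi> i) (\<psi> j))"
    using assms orthonormalD by (intro ip_sum) auto
  also have "\<dots> = (\<Sum>i\<in>F. if i = j then c i else 0)"
    using assms orthonormalD by (intro sum.cong) (auto simp: subset_iff)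
  finally show ?thesis using assms by simp
qed

lemma ip_comb_self:
  assumes "finite F" "F \<subseteq> I"
  shows "ip (\<lambda>x. \<Sum>i\<in>F. c i * \<psi> i x) (\<lambda>x. \<Sum>i\<in>F. c i * \<psi> i x) = (\<Sum>i\<in>F. (c i)\<^sup>2)"
proof -
  let ?v = "\<lambda>x. \<Sum>i\<in>F. c i * \<psi> i x"
  have V: "?v \<in> V" "\<And>i. i \<in> F \<Longrightarrow> \<psi> i \<in> V" using assms orthonormalD by (auto intro!: sum_mem)
  have "ip ?v ?v = (\<Sum>i\<in>F. c i * ip (\<psi> i) ?v)" using assms V by (intro ip_sum) auto
  also have "\<dots> = (\<Sum>i\<in>F. c i * c i)"
    using ip_comb_basis[OF assms] ip_sym[OF _ V(1)] V by (intro sum.cong) auto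
  finally show ?thesis by (simp add: power2_eq_square)
qed

text \<open>Completing the square in the coefficients \<open>c\<close>: the Fourier coefficients are
  optimal, and the excess of any other choice is explicit. Bessel, Parseval and the value of the
  K-functional all come from this formula.\<close>

lemma ip_remainder:
  assumes u: "u \<in> V" and F: "finite F" "F \<subseteq> I"
  shows "ip (\<lambda>x. u x - (\<Sum>i\<in>F. c i * \<psi> i x)) (\<lambda>x. u x - (\<Sum>i\<in>F. c i * \<psi> i x))
    = ip u u - (\<Sum>i\<in>F. (ip u (\<psi> i))\<^sup>2) + (\<Sum>i\<in>F. (ip u (\<psi> i) - c i)\<^sup>2)"
proof -
  let ?v = "\<lambda>x. \<Sum>i\<in>F. c i * \<psi> i x"
  have v: "?v \<in> V" "\<And>i. i \<in> F \<Longrightarrow> \<psi> i \<in> V" using F orthonormalD by (auto intro!: sum_mem)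
  have uv: "(\<lambda>x. u x - ?v x) \<in> V" by (rule diff_mem[OF u v(1)])
  have vu: "ip ?v u = (\<Sum>i\<in>F. c i * ip u (\<psi> i))"
    using ip_sum[OF F(1) v(2) u] ip_sym[OF u v(2)] by (simp cong: sum.cong)
  have "ip (\<lambda>x. u x - ?v x) (\<lambda>x. u x - ?v x) = ip u (\<lambda>x. u x - ?v x) - ip ?v (\<lambda>x. u x - ?v x)"
    by (rule ip_diff[OF u v(1) uv])
  also have "\<dots> = ip u u - 2 * ip ?v u + ip ?v ?v"
    using ip_sym[OF u uv] ip_sym[OF v(1) uv] ip_diff[OF u v(1) u] ip_diff[OF u v(1) v(1)] ip_sym[OF u v(1)] by simp
  also have "\<dots> = ip u u - (\<Sum>i\<in>F. (ip u (\<psi> i))\<^sup>2) + (\<Sum>i\<in>F. (ip u (\<psi> i) - c i)\<^sup>2)"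
    unfolding vu ip_comb_self[OF F]
    by (simp add: power2_diff sum_subtractf sum.distrib sum_distrib_left mult_ac)
  finally show ?thesis .
qed

lemma bessel:
  assumes u: "u \<in> V" and F: "finite F" "F \<subseteq> I"
  shows "(\<Sum>i\<in>F. (ip u (\<psi> i))\<^sup>2) \<le> ip u u"
proof -
  have "0 \<le> ip (\<lambda>x. u x - (\<Sum>i\<in>F. ip u (\<psi> i) * \<psi> i x)) (\<lambda>x. u x - (\<Sum>i\<in>F. ip u (\<psi> i) * \<psi> i x))"
    using F orthonormalD by (intro ip_nonneg diff_mem u sum_mem) auto
  then show ?thesis using ip_remainder[OF u F, of "\<lambda>i. ip u (\<psi> i)"] by simp
qed

lemma bessel_summable:
  assumes u: "u \<in> V"
  shows "(\<lambda>i. (ip u (\<psi> i))\<^sup>2) summable_on I" "(\<Sum>\<^sub>\<infinity>i\<in>I. (ip u (\<psi> i))\<^sup>2) \<le> ip u u"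
proof -
  show s: "(\<lambda>i. (ip u (\<psi> i))\<^sup>2) summable_on I"
    by (rule nonneg_bdd_above_summable_on) (auto intro!: bdd_aboveI[of _ "ip u u"] bessel[OF u])
  show "(\<Sum>\<^sub>\<infinity>i\<in>I. (ip u (\<psi> i))\<^sup>2) \<le> ip u u"
    by (rule infsum_le_finite_sums[OF s bessel[OF u]])
qed

text \<open>Completeness yields some coefficients with a small remainder; by
  \<open>ip_remainder\<close> the Fourier coefficients over the same finite set do at least as
  well.\<close>

lemma complete_family_remainder:
  assumes cf: "complete_family I \<psi>" and u: "u \<in> V" and \<epsilon>: "0 < \<epsilon>"
  obtains F where "finite F" "F \<subseteq> I" "ip u u - (\<Sum>i\<in>F. (ip u (\<psi> i))\<^sup>2) < \<epsilon>"
proof -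
  obtain F c where F: "finite F" "F \<subseteq> I"
      "ip (\<lambda>x. u x - (\<Sum>i\<in>F. c i * \<psi> i x)) (\<lambda>x. u x - (\<Sum>i\<in>F. c i * \<psi> i x)) < \<epsilon>"
    using cf[unfolded complete_family_def, rule_format, OF u \<epsilon>] by blast
  have "0 \<le> (\<Sum>i\<in>F. (ip u (\<psi> i) - c i)\<^sup>2)" by (simp add: sum_nonneg)
  then have "ip u u - (\<Sum>i\<in>F. (ip u (\<psi> i))\<^sup>2) < \<epsilon>"
    using F(3) ip_remainder[OF u F(1,2), of c] by linarith
  then show ?thesis by (rule that[OF F(1,2)])
qed

lemma parseval:
  assumes "complete_family I \<psi>" and u: "u \<in> V"
  shows "(\<Sum>\<^sub>\<infinity>i\<in>I. (ip u (\<psi> i))\<^sup>2) = ip u u"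
proof (rule antisym[OF bessel_summable(2)[OF u]], rule field_le_epsilon)
  fix e :: real assume "0 < e"
  then obtain F where F: "finite F" "F \<subseteq> I" "ip u u - (\<Sum>i\<in>F. (ip u (\<psi> i))\<^sup>2) < e"
    using complete_family_remainder[OF assms] by metis
  have "(\<Sum>i\<in>F. (ip u (\<psi> i))\<^sup>2) \<le> (\<Sum>\<^sub>\<infinity>i\<in>I. (ip u (\<psi> i))\<^sup>2)"
    by (rule finite_sum_le_infsum[OF bessel_summable(1)[OF u] F(1,2)]) simp
  with F show "ip u u \<le> (\<Sum>\<^sub>\<infinity>i\<in>I. (ip u (\<psi> i))\<^sup>2) + e" by simp
qed

end

text \<open>The test vector is the minimizer of the \<open>K\<close>-functional of the second family, truncated to \<open>F\<close>.\<close>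

lemma k_functional_le:
  assumes \<psi>: "orthonormal I \<psi>" and \<phi>: "orthonormal J \<phi>"
    and C: "1 \<le> C"
    and key: "\<And>F E c. finite F \<Longrightarrow> F \<subseteq> J \<Longrightarrow> finite E \<Longrightarrow> E \<subseteq> I \<Longrightarrow>
        (\<Sum>i\<in>E. (\<mu> i * ip (\<lambda>x. \<Sum>j\<in>F. c j * \<phi> j x) (\<psi> i))\<^sup>2) \<le> C * (\<Sum>j\<in>F. (\<nu> j * c j)\<^sup>2)"
    and u: "u \<in> V" and F: "finite F" "F \<subseteq> J" and E: "finite E" "E \<subseteq> I"
  shows "(\<Sum>i\<in>E. heinz_kernel (t * \<mu> i) * (ip u (\<psi> i))\<^sup>2)
     \<le> C * (ip u u - (\<Sum>j\<in>F. (ip u (\<phi> j))\<^sup>2) + (\<Sum>j\<in>F. heinz_kernel (t * \<nu> j) * (ip u (\<phi> j))\<^sup>2))"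
proof -
  define n where "n j = (t * \<nu> j)\<^sup>2" for j
  have n: "0 \<le> n j" "0 < 1 + n j" for j by (simp_all add: n_def add_pos_nonneg)
  define y where "y j = ip u (\<phi> j)" for j
  \<comment> \<open>In each direction this minimizes (y - z)^2 + n z^2 over z.\<close>
  define c where "c j = y j / (1 + n j)" for j
  define v where "v = (\<lambda>x. \<Sum>j\<in>F. c j * \<phi> j x)"
  have V: "v \<in> V" "\<And>i. i \<in> E \<Longrightarrow> \<psi> i \<in> V"
    using F E orthonormalD[OF \<phi>] orthonormalD[OF \<psi>] unfolding v_def by (auto intro!: sum_mem)
  define w where "w = (\<lambda>x. u x - v x)"
  have w: "w \<in> V" unfolding w_def by (rule diff_mem[OF u V(1)])
  \<comment> \<open>On the side of the first family any splitting of the coefficient into a - z and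
    z bounds the kernel from above, so the coefficients of \<open>v\<close> may be used although
    they are not optimal there.\<close>
  have pw: "heinz_kernel s * a\<^sup>2 \<le> (a - z)\<^sup>2 + (s * z)\<^sup>2" for s a z :: real
  proof -
    have p: "0 < 1 + s\<^sup>2" by (simp add: add_pos_nonneg)
    have "0 \<le> (a - (1 + s\<^sup>2) * z)\<^sup>2" by simp
    also have "\<dots> = ((a - z)\<^sup>2 + (s * z)\<^sup>2) * (1 + s\<^sup>2) - s\<^sup>2 * a\<^sup>2" by (simp add: power2_eq_square algebra_simps)
    finally have "s\<^sup>2 * a\<^sup>2 / (1 + s\<^sup>2) \<le> (a - z)\<^sup>2 + (s * z)\<^sup>2" using p by (simp add: pos_divide_le_eq)
    then show ?thesis by (simp add: heinz_kernel_def)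
  qed
  have "(\<Sum>i\<in>E. heinz_kernel (t * \<mu> i) * (ip u (\<psi> i))\<^sup>2)
     \<le> (\<Sum>i\<in>E. (ip w (\<psi> i))\<^sup>2 + t\<^sup>2 * (\<mu> i * ip v (\<psi> i))\<^sup>2)"
  proof (rule sum_mono)
    fix i assume "i \<in> E"
    then have "ip w (\<psi> i) = ip u (\<psi> i) - ip v (\<psi> i)" unfolding w_def using V u by (intro ip_diff) auto
    then show "heinz_kernel (t * \<mu> i) * (ip u (\<psi> i))\<^sup>2 \<le> (ip w (\<psi> i))\<^sup>2 + t\<^sup>2 * (\<mu> i * ip v (\<psi> i))\<^sup>2"
      using pw[of "t * \<mu> i" "ip u (\<psi> i)" "ip v (\<psi> i)"] by (simp add: power_mult_distrib mult.assoc)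
  qed
  also have "\<dots> = (\<Sum>i\<in>E. (ip w (\<psi> i))\<^sup>2) + t\<^sup>2 * (\<Sum>i\<in>E. (\<mu> i * ip v (\<psi> i))\<^sup>2)"
    by (simp add: sum.distrib sum_distrib_left)
  also have "\<dots> \<le> ip w w + t\<^sup>2 * (C * (\<Sum>j\<in>F. (\<nu> j * c j)\<^sup>2))"
    unfolding v_def by (intro add_mono bessel[OF \<psi> w E] mult_left_mono key F E) simp
  \<comment> \<open>C \<ge> 1 lets the remainder term carry the same factor as the operator
    term.\<close>
  also have "\<dots> \<le> C * ip w w + t\<^sup>2 * (C * (\<Sum>j\<in>F. (\<nu> j * c j)\<^sup>2))"
    using mult_right_mono[OF C ip_nonneg[OF w]] by simp
  also have "\<dots> = C * (ip w w + (\<Sum>j\<in>F. n j * (c j)\<^sup>2))"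
    by (simp add: n_def power_mult_distrib sum_distrib_left algebra_simps)
  also have "ip w w = ip u u - (\<Sum>j\<in>F. (y j)\<^sup>2) + (\<Sum>j\<in>F. (y j - c j)\<^sup>2)"
    unfolding w_def v_def y_def by (rule ip_remainder[OF \<phi> u F])
  also have "C * (ip u u - (\<Sum>j\<in>F. (y j)\<^sup>2) + (\<Sum>j\<in>F. (y j - c j)\<^sup>2) + (\<Sum>j\<in>F. n j * (c j)\<^sup>2))
     = C * (ip u u - (\<Sum>j\<in>F. (y j)\<^sup>2) + (\<Sum>j\<in>F. (y j - c j)\<^sup>2 + n j * (c j)\<^sup>2))"
    by (simp add: sum.distrib)
  \<comment> \<open>On the side of the second family \<open>c\<close> is the minimizer, so the
    kernel is attained exactly.\<close>
  also have "(\<Sum>j\<in>F. (y j - c j)\<^sup>2 + n j * (c j)\<^sup>2) = (\<Sum>j\<in>F. heinz_kernel (t * \<nu> j) * (y j)\<^sup>2)"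
  proof (rule sum.cong)
    fix j
    have y: "y j = (1 + n j) * c j" using n(2)[of j] by (simp add: c_def)
    have "(y j - c j)\<^sup>2 + n j * (c j)\<^sup>2 = n j * (1 + n j) * (c j)\<^sup>2"
      unfolding y by (simp add: power2_eq_square algebra_simps)
    also have "\<dots> = n j / (1 + n j) * (y j)\<^sup>2"
      unfolding y using n(2)[of j] by (simp add: power2_eq_square)
    finally show "(y j - c j)\<^sup>2 + n j * (c j)\<^sup>2 = heinz_kernel (t * \<nu> j) * (y j)\<^sup>2"
      by (simp add: heinz_kernel_def n_def)
  qed simp
  finally show ?thesis unfolding y_def .
qed

text \<open>The hypothesis \<open>key\<close> is the case \<alpha> = 2, tested on finite
  combinations. It compares the K-functionals for every t, and integrating over t against the weight
  t^(- \<alpha> - 1) gives the powers between 0 and 2.\<close>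

theorem heinz_inequality:
  assumes \<psi>: "orthonormal I \<psi>" and \<phi>: "orthonormal J \<phi>" "complete_family J \<phi>"
    and pos: "\<And>i. i \<in> I \<Longrightarrow> 0 < \<mu> i" "\<And>j. j \<in> J \<Longrightarrow> 0 < \<nu> j"
    and C: "1 \<le> C"
    and key: "\<And>F E c. finite F \<Longrightarrow> F \<subseteq> J \<Longrightarrow> finite E \<Longrightarrow> E \<subseteq> I \<Longrightarrow>
        (\<Sum>i\<in>E. (\<mu> i * ip (\<lambda>x. \<Sum>j\<in>F. c j * \<phi> j x) (\<psi> i))\<^sup>2) \<le> C * (\<Sum>j\<in>F. (\<nu> j * c j)\<^sup>2)"
    and u: "u \<in> V" and \<alpha>: "0 \<le> \<alpha>" "\<alpha> \<le> 2"
    and sum: "(\<lambda>j. \<nu> j powr \<alpha> * (ip u (\<phi> j))\<^sup>2) summable_on J"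
  shows "(\<lambda>i. \<mu> i powr \<alpha> * (ip u (\<psi> i))\<^sup>2) summable_on I"
    and "(\<Sum>\<^sub>\<infinity>i\<in>I. \<mu> i powr \<alpha> * (ip u (\<psi> i))\<^sup>2) \<le> C * (\<Sum>\<^sub>\<infinity>j\<in>J. \<nu> j powr \<alpha> * (ip u (\<phi> j))\<^sup>2)"
proof -
  let ?S = "\<Sum>\<^sub>\<infinity>j\<in>J. \<nu> j powr \<alpha> * (ip u (\<phi> j))\<^sup>2"
  note sy = bessel_summable(1)[OF \<phi>(1) u]
  have K: "(\<Sum>i\<in>E. heinz_kernel (t * \<mu> i) * (ip u (\<psi> i))\<^sup>2)
      \<le> C * (\<Sum>\<^sub>\<infinity>j\<in>J. heinz_kernel (t * \<nu> j) * (ip u (\<phi> j))\<^sup>2)" if E: "finite E" "E \<subseteq> I" for E t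
  proof (rule field_le_epsilon)
    fix e :: real assume e: "0 < e"
    \<comment> \<open>\<open>k_functional_le\<close> multiplies the defect of the truncation by C,
      hence the tolerance e / C.\<close>
    obtain F where F: "finite F" "F \<subseteq> J" "ip u u - (\<Sum>j\<in>F. (ip u (\<phi> j))\<^sup>2) < e / C"
      using complete_family_remainder[OF \<phi> u, of "e / C"] e C by auto
    have s: "(\<lambda>j. heinz_kernel (t * \<nu> j) * (ip u (\<phi> j))\<^sup>2) summable_on J"
      by (rule summable_on_comparison_test[OF sy]) (auto simp: heinz_kernel_bounds mult_left_le_one_le)
    have "(\<Sum>j\<in>F. heinz_kernel (t * \<nu> j) * (ip u (\<phi> j))\<^sup>2) \<le> (\<Sum>\<^sub>\<infinity>j\<in>J. heinz_kernel (t * \<nu> j) * (ip u (\<phi> j))\<^sup>2)"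
      by (rule finite_sum_le_infsum[OF s F(1,2)]) (simp add: heinz_kernel_bounds)
    then have "C * (ip u u - (\<Sum>j\<in>F. (ip u (\<phi> j))\<^sup>2) + (\<Sum>j\<in>F. heinz_kernel (t * \<nu> j) * (ip u (\<phi> j))\<^sup>2))
      \<le> C * (e / C + (\<Sum>\<^sub>\<infinity>j\<in>J. heinz_kernel (t * \<nu> j) * (ip u (\<phi> j))\<^sup>2))"
      using F(3) C by (intro mult_left_mono add_mono) auto
    also have "\<dots> = C * (\<Sum>\<^sub>\<infinity>j\<in>J. heinz_kernel (t * \<nu> j) * (ip u (\<phi> j))\<^sup>2) + e"
      using C by (simp add: algebra_simps)
    finally show "(\<Sum>i\<in>E. heinz_kernel (t * \<mu> i) * (ip u (\<psi> i))\<^sup>2)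
      \<le> C * (\<Sum>\<^sub>\<infinity>j\<in>J. heinz_kernel (t * \<nu> j) * (ip u (\<phi> j))\<^sup>2) + e"
      using k_functional_le[OF \<psi> \<phi>(1) C key u F(1,2) E, of t] by simp
  qed
  have main: "(\<Sum>i\<in>E. \<mu> i powr \<alpha> * (ip u (\<psi> i))\<^sup>2) \<le> C * ?S" if E: "finite E" "E \<subseteq> I" for E
  proof -
    \<comment> \<open>The weight integral is finite only for 0 < \<alpha> < 2. At \<alpha> = 0,
      Bessel for the first family meets Parseval for the second.\<close>
    consider "\<alpha> = 0" | "\<alpha> = 2" | "0 < \<alpha>" "\<alpha> < 2" using \<alpha> by linarith
    then show ?thesis
    proof cases
      case 1
      have "(\<Sum>i\<in>E. \<mu> i powr \<alpha> * (ip u (\<psi> i))\<^sup>2) = (\<Sum>i\<in>E. (ip u (\<psi> i))\<^sup>2)"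
        using pos E 1 by (intro sum.cong) (auto simp: subset_iff less_imp_neq[symmetric])
      also have "\<dots> \<le> ip u u" by (rule bessel[OF \<psi> u E])
      also have "\<dots> \<le> C * ip u u" using mult_right_mono[OF C ip_nonneg[OF u]] by simp
      also have "ip u u = (\<Sum>\<^sub>\<infinity>j\<in>J. (ip u (\<phi> j))\<^sup>2)" by (rule parseval[OF \<phi> u, symmetric])
      also have "\<dots> = ?S"
        using pos 1 by (intro infsum_cong) (auto simp: less_imp_neq[symmetric])
      finally show ?thesis .
    next
      case 2
      \<comment> \<open>After division by t^2 the kernel at t \<mu> tends to \<mu>^2 as t tends to
        0, while on the other side it never exceeds \<nu>^2. The end point \<alpha> = 2 is this
        limit.\<close>
      have le: "(\<Sum>i\<in>E. (\<mu> i)\<^sup>2 / (1 + (t * \<mu> i)\<^sup>2) * (ip u (\<psi> i))\<^sup>2) \<le> C * ?S" if t: "0 < t" for t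
      proof -
        have s: "(\<lambda>j. heinz_kernel (t * \<nu> j) * (ip u (\<phi> j))\<^sup>2) summable_on J"
          by (rule summable_on_comparison_test[OF sy]) (auto simp: heinz_kernel_bounds mult_left_le_one_le)
        have "(\<Sum>\<^sub>\<infinity>j\<in>J. heinz_kernel (t * \<nu> j) * (ip u (\<phi> j))\<^sup>2) \<le> (\<Sum>\<^sub>\<infinity>j\<in>J. t\<^sup>2 * (\<nu> j powr \<alpha> * (ip u (\<phi> j))\<^sup>2))"
        proof (rule infsum_mono[OF s summable_on_cmult_right[OF sum]])
          fix j assume "j \<in> J"
          then have "t\<^sup>2 * \<nu> j powr \<alpha> = (t * \<nu> j)\<^sup>2" using pos(2)[of j] 2 by (simp add: power_mult_distrib)
          then have eq: "t\<^sup>2 * (\<nu> j powr \<alpha> * (ip u (\<phi> j))\<^sup>2) = (t * \<nu> j)\<^sup>2 * (ip u (\<phi> j))\<^sup>2"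
            by (metis mult.assoc)
          show "heinz_kernel (t * \<nu> j) * (ip u (\<phi> j))\<^sup>2 \<le> t\<^sup>2 * (\<nu> j powr \<alpha> * (ip u (\<phi> j))\<^sup>2)"
            unfolding eq by (rule mult_right_mono[OF heinz_kernel_bounds(3)]) simp
        qed
        also have "\<dots> = t\<^sup>2 * ?S" by (rule infsum_cmult_right')
        finally have "C * (\<Sum>\<^sub>\<infinity>j\<in>J. heinz_kernel (t * \<nu> j) * (ip u (\<phi> j))\<^sup>2) \<le> C * (t\<^sup>2 * ?S)"
          using C by (intro mult_left_mono) auto
        then have "(\<Sum>i\<in>E. heinz_kernel (t * \<mu> i) * (ip u (\<psi> i))\<^sup>2) \<le> t\<^sup>2 * (C * ?S)"
          using K[OF E, of t] by (simp add: mult_ac)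
        moreover have "(\<Sum>i\<in>E. heinz_kernel (t * \<mu> i) * (ip u (\<psi> i))\<^sup>2) = t\<^sup>2 * (\<Sum>i\<in>E. (\<mu> i)\<^sup>2 / (1 + (t * \<mu> i)\<^sup>2) * (ip u (\<psi> i))\<^sup>2)"
          by (simp add: heinz_kernel_def power_mult_distrib sum_distrib_left mult_ac)
        ultimately show ?thesis using t by simp
      qed
      have "((\<lambda>t. \<Sum>i\<in>E. (\<mu> i)\<^sup>2 / (1 + (t * \<mu> i)\<^sup>2) * (ip u (\<psi> i))\<^sup>2)
          \<longlongrightarrow> (\<Sum>i\<in>E. (\<mu> i)\<^sup>2 / (1 + (0 * \<mu> i)\<^sup>2) * (ip u (\<psi> i))\<^sup>2)) (at_right 0)"
        by (intro tendsto_intros) auto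
      moreover have "\<forall>\<^sub>F t in at_right 0. (\<Sum>i\<in>E. (\<mu> i)\<^sup>2 / (1 + (t * \<mu> i)\<^sup>2) * (ip u (\<psi> i))\<^sup>2) \<le> C * ?S"
        using eventually_at_right_less[of 0] by eventually_elim (rule le)
      ultimately have "(\<Sum>i\<in>E. (\<mu> i)\<^sup>2 / (1 + (0 * \<mu> i)\<^sup>2) * (ip u (\<psi> i))\<^sup>2) \<le> C * ?S"
        by (rule tendsto_upperbound) simp
      moreover have "(\<Sum>i\<in>E. (\<mu> i)\<^sup>2 / (1 + (0 * \<mu> i)\<^sup>2) * (ip u (\<psi> i))\<^sup>2) = (\<Sum>i\<in>E. \<mu> i powr \<alpha> * (ip u (\<psi> i))\<^sup>2)"
      proof (rule sum.cong)
        fix i assume "i \<in> E"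
        then have "0 < \<mu> i" using pos E by blast
        then show "(\<mu> i)\<^sup>2 / (1 + (0 * \<mu> i)\<^sup>2) * (ip u (\<psi> i))\<^sup>2 = \<mu> i powr \<alpha> * (ip u (\<psi> i))\<^sup>2"
          by (simp add: 2)
      qed simp
      ultimately show ?thesis by simp
    next
      case 3
      show ?thesis
      proof (rule heinz_integrate[OF 3 E(1), where J = J and \<nu> = \<nu>])
        show "0 < \<mu> i" if "i \<in> E" for i using pos E that by blast
      qed (use C in \<open>simp_all add: pos sy K[OF E] sum\<close>)
    qed
  qed
  show s: "(\<lambda>i. \<mu> i powr \<alpha> * (ip u (\<psi> i))\<^sup>2) summable_on I"
    by (rule nonneg_bdd_above_summable_on) (auto intro!: bdd_aboveI[of _ "C * ?S"] main)
  show "(\<Sum>\<^sub>\<infinity>i\<in>I. \<mu> i powr \<alpha> * (ip u (\<psi> i))\<^sup>2) \<le> C * ?S"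
    by (rule infsum_le_finite_sums[OF s main])
qed

end

section \<open>Regularity on one edge\<close>

lemma continuous_AE_zero:
  fixes f :: "real \<Rightarrow> real"
  assumes l: "0 < l" and f: "continuous_on {0..l} f" and AE: "AE t in lebesgue_on {0..l}. f t = 0"
    and t: "t \<in> {0..l}"
  shows "f t = 0"
proof -
  have af: "(\<lambda>t. \<bar>f t\<bar>) absolutely_integrable_on {0..l}"
    by (intro absolutely_integrable_continuous_real continuous_intros f)
  have "integral {0..l} (\<lambda>t. \<bar>f t\<bar>) = (LINT t|lebesgue_on {0..l}. \<bar>f t\<bar>)"
    by (rule lebesgue_on_integral[OF af, symmetric])
  also have "\<dots> = (LINT t|lebesgue_on {0..l}. 0)"
    using AE af by (intro integral_cong_AE) (auto simp: integrable_lebesgue_on_iff[symmetric])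
  finally have "((\<lambda>t. \<bar>f t\<bar>) has_integral 0) (cbox 0 l)"
    using af by (simp add: has_integral_integral absolutely_integrable_on_def)
  then have "\<bar>f t\<bar> = 0"
    by (rule has_integral_0_cbox_imp_0[rotated 2]) (use l t f in \<open>auto intro!: continuous_intros\<close>)
  then show ?thesis by simp
qed

lemma continuous_AE_ge:
  fixes f :: "real \<Rightarrow> real"
  assumes l: "0 < l" and f: "continuous_on {0..l} f" and AE: "AE t in lebesgue_on {0..l}. c \<le> f t"
    and t: "t \<in> {0..l}"
  shows "c \<le> f t"
proof -
  have "min (f t - c) 0 = 0"
    by (rule continuous_AE_zero[OF l _ _ t]) (use f AE in \<open>auto intro!: continuous_intros\<close>)
  then show ?thesis by simp
qed

lemma AE_lebesgue_on_subset:
  assumes "AE t in lebesgue_on {0..l}. P (t::real)" "s \<le> l"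
  shows "AE t in lebesgue_on {0..s}. P t"
  using assms by (auto simp: AE_restrict_space_iff elim!: eventually_mono)

lemma primitive_cong_AE:
  fixes f g :: "real \<Rightarrow> real"
  assumes f: "f absolutely_integrable_on {0..l}" and g: "g absolutely_integrable_on {0..l}"
    and AE: "AE t in lebesgue_on {0..l}. f t = g t" and s: "s \<in> {0..l}"
  shows "integral {0..s} f = integral {0..s} g"
proof -
  have fg: "f absolutely_integrable_on {0..s}" "g absolutely_integrable_on {0..s}"
    using s by (auto intro: abs_integrable_sub[OF f] abs_integrable_sub[OF g])
  have "(LINT t|lebesgue_on {0..s}. f t) = (LINT t|lebesgue_on {0..s}. g t)"
    using fg s by (intro integral_cong_AE AE_lebesgue_on_subset[OF AE])
      (auto simp: integrable_lebesgue_on_iff[symmetric])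
  then show ?thesis using fg by (simp add: lebesgue_on_integral)
qed

text \<open>The flux a * du agrees almost everywhere with a continuous primitive of
  \<open>g\<close>. Dividing by the positive continuous \<open>a\<close> gives a continuous version
  of \<open>du\<close>, so \<open>U\<close> is continuously differentiable up to both ends, where
  the vertex conditions need one-sided derivatives.\<close>

lemma edge_regularity:
  fixes U a du g :: "real \<Rightarrow> real"
  assumes l: "0 < l" and U: "continuous_on {0..l} U" and a: "continuous_on {0..l} a"
    and pos: "\<And>t. t \<in> {0..l} \<Longrightarrow> 0 < a t"
    and du: "has_weak_deriv l U du" and g: "has_weak_deriv l (\<lambda>t. a t * du t) g"
  obtains u1 where "\<And>t. t \<in> {0..l} \<Longrightarrow> (U has_real_derivative u1 t) (at t within {0..l})"
    "continuous_on {0..l} u1"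
    "\<And>t. t \<in> {0..l} \<Longrightarrow> a t * u1 t = a 0 * u1 0 + integral {0..t} g"
proof -
  have gi: "g absolutely_integrable_on {0..l}" and dui: "du absolutely_integrable_on {0..l}"
    using g du by (simp_all add: has_weak_deriv_def integrable_lebesgue_on_iff)
  obtain k where k: "AE t in lebesgue_on {0..l}. a t * du t = k + integral {0..t} g"
    using weak_deriv_imp_primitive[OF l g] by blast
  obtain k' where k': "AE t in lebesgue_on {0..l}. U t = k' + integral {0..t} du"
    using weak_deriv_imp_primitive[OF l du] by blast
  \<comment> \<open>The continuous version of \<open>du\<close>, read off from the flux. Only the
    flux, not \<open>u1\<close> itself, is known to be a primitive.\<close>
  define u1 where "u1 t = (k + integral {0..t} g) / a t" for t
  have Q: "continuous_on {0..l} (\<lambda>t. k + integral {0..t} g)"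
    by (rule primitive_continuous[OF gi, of _ k]) simp
  have u1: "continuous_on {0..l} u1"
    unfolding u1_def[abs_def] using pos by (intro continuous_intros Q a) force
  have "AE t in lebesgue_on {0..l}. t \<in> {0..l}"
    by (rule AE_I2) simp
  with k have "AE t in lebesgue_on {0..l}. du t = u1 t"
    by eventually_elim (metis less_irrefl nonzero_mult_div_cancel_left pos u1_def)
  then have P: "integral {0..s} du = integral {0..s} u1" if "s \<in> {0..l}" for s
    using that by (intro primitive_cong_AE[OF dui absolutely_integrable_continuous_real[OF u1]])
  have Pc: "continuous_on {0..l} (\<lambda>t. k' + integral {0..t} u1)"
    by (rule primitive_continuous[OF absolutely_integrable_continuous_real[OF u1], of _ k']) simp
  have Ueq: "U t = k' + integral {0..t} u1" if t: "t \<in> {0..l}" for t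
  proof -
    have "AE t in lebesgue_on {0..l}. U t - (k' + integral {0..t} u1) = 0"
      using k' \<open>AE t in lebesgue_on {0..l}. t \<in> {0..l}\<close> by eventually_elim (simp add: P)
    then have "U t - (k' + integral {0..t} u1) = 0"
      using t by (intro continuous_AE_zero[OF l, of "\<lambda>t. U t - (k' + integral {0..t} u1)"] continuous_on_diff U Pc)
    then show ?thesis by simp
  qed
  show ?thesis
  proof (rule that[of u1])
    fix t assume t: "t \<in> {0..l}"
    have "((\<lambda>s. k' + integral {0..s} u1) has_real_derivative 0 + u1 t) (at t within {0..l})"
      by (intro DERIV_add DERIV_const integral_has_real_derivative[OF u1 t])
    then show "(U has_real_derivative u1 t) (at t within {0..l})"
      using has_field_derivative_transform_within[of "\<lambda>s. k' + integral {0..s} u1" "u1 t" t "{0..l}" 1 U] t Ueq by simp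
    show "a t * u1 t = a 0 * u1 0 + integral {0..t} g"
      using pos[OF t] pos[of 0] l by (simp add: u1_def)
  qed (rule u1)
qed

section \<open>Square-integrable functions on an edge\<close>

lemma L2_on_mult_integrable:
  assumes "L2_on l f" "L2_on l g"
  shows "integrable (lebesgue_on {0..l}) (\<lambda>t. f t * g t)"
proof (rule Bochner_Integration.integrable_bound)
  show "integrable (lebesgue_on {0..l}) (\<lambda>t. (f t)\<^sup>2 + (g t)\<^sup>2)"
    using assms by (auto simp: L2_on_def)
  show "(\<lambda>t. f t * g t) \<in> borel_measurable (lebesgue_on {0..l})"
    using assms by (auto simp: L2_on_def)
  have "\<bar>x * y\<bar> \<le> x\<^sup>2 + y\<^sup>2" for x y :: real
  proof -
    have "2 * \<bar>x * y\<bar> \<le> x\<^sup>2 + y\<^sup>2"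
      using sum_squares_bound[of "\<bar>x\<bar>" "\<bar>y\<bar>"] by (simp add: abs_mult)
    then show ?thesis using abs_ge_zero[of "x * y"] by linarith
  qed
  then show "AE t in lebesgue_on {0..l}. norm (f t * g t) \<le> norm ((f t)\<^sup>2 + (g t)\<^sup>2)"
    by simp
qed

lemma L2_on_add: "L2_on l f \<Longrightarrow> L2_on l g \<Longrightarrow> L2_on l (\<lambda>t. f t + g t)"
  using L2_on_mult_integrable[of l f g] by (auto simp: L2_on_def power2_sum mult.assoc)

lemma L2_on_cmult: "L2_on l f \<Longrightarrow> L2_on l (\<lambda>t. c * f t)"
  by (auto simp: L2_on_def power_mult_distrib)

lemma L2_on_continuous:
  assumes "continuous_on {0..l} f" shows "L2_on l f"
proof -
  have "(\<lambda>t. (f t)\<^sup>2) absolutely_integrable_on {0..l}"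
    by (intro absolutely_integrable_continuous_real continuous_intros assms)
  then show ?thesis
    using assms by (auto simp: L2_on_def integrable_lebesgue_on_iff intro: continuous_imp_measurable_on_sets_lebesgue)
qed

text \<open>Young's inequality in place of Cauchy-Schwarz: sums of squares add up over the edges
  without square roots, and the free weight \<open>d\<close> is fixed only when a term is to be
  absorbed.\<close>

lemma integral_young:
  fixes f w z :: "'a \<Rightarrow> real"
  assumes "integrable M f" "integrable M (\<lambda>t. (w t)\<^sup>2)" "integrable M (\<lambda>t. (z t)\<^sup>2)"
    and le: "AE t in M. \<bar>f t\<bar> \<le> K * \<bar>w t * z t\<bar>" and K: "0 \<le> K" and d: "0 < d"
  shows "\<bar>LINT t|M. f t\<bar> \<le> K * (d * (LINT t|M. (w t)\<^sup>2) + (LINT t|M. (z t)\<^sup>2) / d)"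
proof -
  have "\<bar>LINT t|M. f t\<bar> \<le> (LINT t|M. \<bar>f t\<bar>)"
    by (rule integral_abs_bound)
  also have "\<dots> \<le> (LINT t|M. K * (d * (w t)\<^sup>2 + (z t)\<^sup>2 / d))"
  proof (rule integral_mono_AE)
    have "\<bar>x * y\<bar> \<le> d * x\<^sup>2 + y\<^sup>2 / d" for x y :: real
    proof -
      have "0 \<le> (d * \<bar>x\<bar> - \<bar>y\<bar>)\<^sup>2" by simp
      then have "2 * d * \<bar>x * y\<bar> \<le> d\<^sup>2 * x\<^sup>2 + y\<^sup>2"
        by (simp add: power2_diff power_mult_distrib abs_mult mult_ac)
      moreover have "0 \<le> d * \<bar>x * y\<bar>" using d by simp
      ultimately have "d * \<bar>x * y\<bar> \<le> d\<^sup>2 * x\<^sup>2 + y\<^sup>2" by linarith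
      then show ?thesis using d by (simp add: field_simps power2_eq_square)
    qed
    then have "K * \<bar>w t * z t\<bar> \<le> K * (d * (w t)\<^sup>2 + (z t)\<^sup>2 / d)" for t
      using K by (intro mult_left_mono) auto
    then show "AE t in M. \<bar>f t\<bar> \<le> K * (d * (w t)\<^sup>2 + (z t)\<^sup>2 / d)"
      using le by (auto elim!: eventually_mono intro: order_trans)
  qed (use assms in auto)
  also have "\<dots> = K * (d * (LINT t|M. (w t)\<^sup>2) + (LINT t|M. (z t)\<^sup>2) / d)"
    using assms by simp
  finally show ?thesis .
qed

section \<open>Solutions on the graph\<close>

context compact_metric_graph
begin

definition lipschitz_coeff :: "('v, 'e) mg_fun \<Rightarrow> real \<Rightarrow> real \<Rightarrow> real \<Rightarrow> bool" where
  "lipschitz_coeff a c C L \<longleftrightarrow> 0 < c \<and> 0 \<le> L \<and>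
     (\<forall>e\<in>arcs G. \<forall>s\<in>{0..len e}. c \<le> on_edge G len e a s \<and> on_edge G len e a s \<le> C \<and>
       (\<forall>t\<in>{0..len e}. \<bar>on_edge G len e a s - on_edge G len e a t\<bar> \<le> L * \<bar>s - t\<bar>))"

definition bounded_coeff :: "('v, 'e) mg_fun \<Rightarrow> real \<Rightarrow> real \<Rightarrow> bool" where
  "bounded_coeff \<kappa> c C \<longleftrightarrow> 0 < c \<and> (\<forall>e\<in>arcs G.
     on_edge G len e \<kappa> \<in> borel_measurable (lebesgue_on {0..len e}) \<and>
     (AE t in lebesgue_on {0..len e}. c \<le> on_edge G len e \<kappa> t \<and> on_edge G len e \<kappa> t \<le> C))"

definition start :: "'e \<times> bool \<Rightarrow> 'v" where
  "start = (\<lambda>(e, d). if d then tail G e else head G e)"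

text \<open>The derivative at the starting vertex, directed into the edge; reversing the orientation
  changes the sign. A loop enters with both of its orientations.\<close>

definition outward :: "('e \<Rightarrow> real \<Rightarrow> real) \<Rightarrow> 'e \<times> bool \<Rightarrow> real" where
  "outward u1 = (\<lambda>(e, d). if d then u1 e 0 else - u1 e (len e))"

text \<open>A pointwise form of the operator equation: \<open>u1\<close> is the edgewise derivative of \<open>u\<close>, and
  \<open>a * u1\<close> is a primitive of \<open>g\<close>.\<close>

definition edgewise_C1 :: "('v, 'e) mg_fun \<Rightarrow> ('e \<Rightarrow> real \<Rightarrow> real) \<Rightarrow> bool" where
  "edgewise_C1 u u1 \<longleftrightarrow> (\<forall>e\<in>arcs G. continuous_on {0..len e} (u1 e) \<and>
     (\<forall>t\<in>{0..len e}. (on_edge G len e u has_real_derivative u1 e t) (at t within {0..len e})))"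

text \<open>Every clause is linear in \<open>u\<close>, \<open>f\<close>, \<open>u1\<close> and
  \<open>g\<close> jointly, so the notion passes from eigenfunctions to their finite
  combinations.\<close>

definition strong_solution ::
    "'v set \<Rightarrow> 'v set \<Rightarrow> ('v, 'e) mg_fun \<Rightarrow> ('v, 'e) mg_fun \<Rightarrow> ('v, 'e) mg_fun \<Rightarrow> ('v, 'e) mg_fun \<Rightarrow>
      ('e \<Rightarrow> real \<Rightarrow> real) \<Rightarrow> ('e \<Rightarrow> real \<Rightarrow> real) \<Rightarrow> bool" where
  "strong_solution VK VD a \<kappa> u f u1 g \<longleftrightarrow>
     f \<in> L2_graph G len \<and> edgewise_C1 u u1 \<and>
     (\<forall>e\<in>arcs G. g e absolutely_integrable_on {0..len e} \<and>
        (\<forall>t\<in>{0..len e}. on_edge G len e a t * u1 e t = on_edge G len e a 0 * u1 e 0 + integral {0..t} (g e)) \<and>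
        (AE t in lebesgue_on {0..len e}.
           on_edge G len e f t = (on_edge G len e \<kappa> t)\<^sup>2 * on_edge G len e u t - g e t)) \<and>
     (\<forall>v\<in>VK. (\<Sum>x | x \<in> arcs G \<times> UNIV \<and> start x = v. outward u1 x) = 0) \<and>
     (\<forall>v\<in>VD. u (Vertex v) = 0)"

lemma on_edge_0: "on_edge G len e u 0 = u (Vertex (tail G e))"
  by (simp add: on_edge_def edge_pt_def)

lemma on_edge_len: "e \<in> arcs G \<Longrightarrow> on_edge G len e u (len e) = u (Vertex (head G e))"
  using len_pos[of e] by (simp add: on_edge_def edge_pt_def)

lemma nat_param_0: "e \<in> arcs G \<Longrightarrow> nat_param G len e d 0 = Vertex (start (e, d))"
  using len_pos[of e] by (simp add: nat_param_def edge_pt_def start_def)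

lemma edgewise_C1_continuous:
  "edgewise_C1 u u1 \<Longrightarrow> e \<in> arcs G \<Longrightarrow> continuous_on {0..len e} (on_edge G len e u)"
  unfolding edgewise_C1_def by (meson DERIV_continuous_on)

lemma edgewise_C1_L2:
  assumes "edgewise_C1 u u1" "e \<in> arcs G"
  shows "L2_on (len e) (on_edge G len e u)" "L2_on (len e) (u1 e)"
  using L2_on_continuous edgewise_C1_continuous[OF assms] assms by (auto simp: edgewise_C1_def)

lemma lipschitz_coeff_continuous:
  assumes "lipschitz_coeff a c C L" "e \<in> arcs G"
  shows "continuous_on {0..len e} (on_edge G len e a)"
proof -
  have "L-lipschitz_on {0..len e} (on_edge G len e a)"
    using assms by (auto simp: lipschitz_on_def lipschitz_coeff_def dist_real_def)
  then show ?thesis by (rule lipschitz_on_continuous_on)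
qed

section \<open>From the operator equation to pointwise solutions\<close>

lemma outward_vector_derivative:
  assumes "edgewise_C1 u u1" and e: "e \<in> arcs G"
  shows "vector_derivative (u \<circ> nat_param G len e d) (at 0 within {0..len e}) = outward u1 (e, d)"
proof -
  have l: "0 < len e" by (rule len_pos[OF e])
  have D: "(on_edge G len e u has_real_derivative u1 e t) (at t within {0..len e})" if "t \<in> {0..len e}" for t
    using assms that by (simp add: edgewise_C1_def)
  have "((u \<circ> nat_param G len e d) has_real_derivative outward u1 (e, d)) (at 0 within {0..len e})"
  proof (cases d)
    case True
    then have "u \<circ> nat_param G len e d = on_edge G len e u"
      by (auto simp: nat_param_def on_edge_def)
    then show ?thesis using D[of 0] l True by (simp add: outward_def)
  next
    case False
    then have eq: "u \<circ> nat_param G len e d = on_edge G len e u \<circ> (\<lambda>t. len e - t)"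
      by (auto simp: nat_param_def on_edge_def)
    have "(\<lambda>t. len e - t) ` {0..len e} = {0..len e}"
      by (auto simp: image_iff intro!: bexI[of _ "len e - _"])
    then have "(on_edge G len e u has_real_derivative u1 e (len e)) (at (len e - 0) within (\<lambda>t. len e - t) ` {0..len e})"
      using D[of "len e"] l by simp
    moreover have "((\<lambda>t. len e - t) has_real_derivative - 1) (at 0 within {0..len e})"
      by (auto intro!: derivative_eq_intros)
    ultimately have "((on_edge G len e u \<circ> (\<lambda>t. len e - t)) has_real_derivative u1 e (len e) * - 1) (at 0 within {0..len e})"
      by (rule DERIV_image_chain)
    then show ?thesis using False unfolding eq by (simp add: outward_def)
  qed
  then have "((u \<circ> nat_param G len e d) has_vector_derivative outward u1 (e, d)) (at 0 within {0..len e})"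
    by (simp add: has_real_derivative_iff_has_vector_derivative)
  then show ?thesis
    using l by (intro vector_derivative_within_closed_interval) auto
qed

lemma elliptic_op_strong_solution:
  assumes a: "lipschitz_coeff a c C L" and op: "elliptic_op G len VK VD a \<kappa> u f"
  obtains u1 g where "strong_solution VK VD a \<kappa> u f u1 g"
proof -
  \<comment> \<open>Bundling the edgewise conditions into one predicate lets a single choice over
    the edges produce \<open>u1\<close> and \<open>g\<close>.\<close>
  define Q where "Q e u1 g \<longleftrightarrow> (\<forall>t\<in>{0..len e}. (on_edge G len e u has_real_derivative u1 t) (at t within {0..len e})) \<and>
    continuous_on {0..len e} u1 \<and> g absolutely_integrable_on {0..len e} \<and>
    (\<forall>t\<in>{0..len e}. on_edge G len e a t * u1 t = on_edge G len e a 0 * u1 0 + integral {0..t} g) \<and>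
    (AE t in lebesgue_on {0..len e}. on_edge G len e f t = (on_edge G len e \<kappa> t)\<^sup>2 * on_edge G len e u t - g t)" for e u1 g
  have "\<exists>u1 g. Q e u1 g"
    if e: "e \<in> arcs G" for e
  proof -
    obtain du g where dg: "has_weak_deriv (len e) (on_edge G len e u) du"
        "has_weak_deriv (len e) (\<lambda>t. on_edge G len e a t * du t) g"
        "AE t in lebesgue_on {0..len e}. on_edge G len e f t = (on_edge G len e \<kappa> t)\<^sup>2 * on_edge G len e u t - g t"
      using op e by (auto simp: elliptic_op_def)
    have U: "continuous_on {0..len e} (on_edge G len e u)"
      using op e by (auto simp: elliptic_op_def op_domain_def H2_graph_def mg_continuous_def)
    have pos: "0 < on_edge G len e a t" if "t \<in> {0..len e}" for t
      using a e that by (force simp: lipschitz_coeff_def)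
    obtain u1 where "\<And>t. t \<in> {0..len e} \<Longrightarrow> (on_edge G len e u has_real_derivative u1 t) (at t within {0..len e})"
        "continuous_on {0..len e} u1"
        "\<And>t. t \<in> {0..len e} \<Longrightarrow> on_edge G len e a t * u1 t = on_edge G len e a 0 * u1 0 + integral {0..t} g"
      using edge_regularity[OF len_pos[OF e] U lipschitz_coeff_continuous[OF a e] pos dg(1,2)] by blast
    moreover have "g absolutely_integrable_on {0..len e}"
      using dg(2) by (simp add: has_weak_deriv_def integrable_lebesgue_on_iff)
    ultimately show ?thesis using dg(3) unfolding Q_def by blast
  qed
  then obtain u1 g where u1g: "\<And>e. e \<in> arcs G \<Longrightarrow> Q e (u1 e) (g e)"
    by metis
  then have C1: "edgewise_C1 u u1" by (simp add: edgewise_C1_def Q_def)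
  have K: "(\<Sum>x | x \<in> arcs G \<times> UNIV \<and> start x = v. outward u1 x) = 0" if v: "v \<in> VK" for v
  proof -
    have "(\<Sum>(e, d) \<in> {(e, d). e \<in> arcs G \<and> nat_param G len e d 0 = Vertex v}.
        vector_derivative (u \<circ> nat_param G len e d) (at 0 within {0..len e})) = 0"
      using op v by (auto simp: elliptic_op_def op_domain_def kirchhoff_def)
    moreover have "{(e, d). e \<in> arcs G \<and> nat_param G len e d 0 = Vertex v} = {x. x \<in> arcs G \<times> UNIV \<and> start x = v}"
      by (auto simp: nat_param_0)
    moreover have "(\<Sum>(e, d) \<in> {x. x \<in> arcs G \<times> UNIV \<and> start x = v}.
        vector_derivative (u \<circ> nat_param G len e d) (at 0 within {0..len e})) = (\<Sum>x | x \<in> arcs G \<times> UNIV \<and> start x = v. outward u1 x)"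
      by (intro sum.cong) (auto simp: outward_vector_derivative[OF C1])
    ultimately show ?thesis by simp
  qed
  have "strong_solution VK VD a \<kappa> u f u1 g"
    unfolding strong_solution_def
  proof (intro conjI ballI C1 K)
    show "f \<in> L2_graph G len" using op by (simp add: elliptic_op_def)
    show "u (Vertex v) = 0" if "v \<in> VD" for v
      using op that by (simp add: elliptic_op_def op_domain_def dirichlet_def)
  qed (use u1g[unfolded Q_def] in blast)+
  then show ?thesis by (rule that)
qed

text \<open>Grouped by vertex, the end-point terms have the common factor \<open>a\<close> times
  \<open>w\<close>, since both are single-valued there. What remains is the Kirchhoff sum of
  \<open>u1\<close>, and on \<open>VD\<close> the factor \<open>w\<close> vanishes. The coefficient
  is arbitrary: it may belong to a different operator than \<open>u1\<close>.\<close>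

lemma sum_outward_zero:
  assumes VKD: "VK \<union> VD = verts G"
    and K: "\<And>v. v \<in> VK \<Longrightarrow> (\<Sum>x | x \<in> arcs G \<times> UNIV \<and> start x = v. outward u1 x) = 0"
    and D: "\<And>v. v \<in> VD \<Longrightarrow> w (Vertex v) = 0"
  shows "(\<Sum>e\<in>arcs G. on_edge G len e a (len e) * u1 e (len e) * on_edge G len e w (len e)
      - on_edge G len e a 0 * u1 e 0 * on_edge G len e w 0) = 0"
proof -
  define b where "b v = a (Vertex v) * w (Vertex v)" for v
  have fin: "finite (arcs G \<times> (UNIV :: bool set))" by simp
  have "(\<Sum>x\<in>arcs G \<times> UNIV. b (start x) * outward u1 x) = 0"
  proof -
    have "start ` (arcs G \<times> UNIV) \<subseteq> verts G" by (auto simp: start_def)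
    then have "(\<Sum>x\<in>arcs G \<times> UNIV. b (start x) * outward u1 x)
       = (\<Sum>v\<in>verts G. \<Sum>x | x \<in> arcs G \<times> UNIV \<and> start x = v. b (start x) * outward u1 x)"
      by (intro sum.group[symmetric] fin) simp
    also have "\<dots> = (\<Sum>v\<in>verts G. b v * (\<Sum>x | x \<in> arcs G \<times> UNIV \<and> start x = v. outward u1 x))"
      by (auto simp: sum_distrib_left intro!: sum.cong)
    also have "\<dots> = 0"
      using VKD K D by (intro sum.neutral) (auto simp: b_def)
    finally show ?thesis .
  qed
  moreover have "(\<Sum>x\<in>arcs G \<times> UNIV. b (start x) * outward u1 x)
      = (\<Sum>e\<in>arcs G. b (tail G e) * u1 e 0 - b (head G e) * u1 e (len e))"
  proof -
    have "(\<Sum>x\<in>arcs G \<times> UNIV. H x) = (\<Sum>e\<in>arcs G. \<Sum>d\<in>UNIV. H (e, d))" for H :: "'e \<times> bool \<Rightarrow> real"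
      by (simp add: sum.cartesian_product)
    then show ?thesis by (simp add: UNIV_bool start_def outward_def)
  qed
  ultimately have "(\<Sum>e\<in>arcs G. b (tail G e) * u1 e 0 - b (head G e) * u1 e (len e)) = 0" by simp
  moreover have "(\<Sum>e\<in>arcs G. on_edge G len e a (len e) * u1 e (len e) * on_edge G len e w (len e)
      - on_edge G len e a 0 * u1 e 0 * on_edge G len e w 0) = - (\<Sum>e\<in>arcs G. b (tail G e) * u1 e 0 - b (head G e) * u1 e (len e))"
    by (simp add: sum_negf[symmetric] on_edge_0 on_edge_len b_def algebra_simps)
  ultimately show ?thesis by simp
qed

lemma L2_graphD: "u \<in> L2_graph G len \<Longrightarrow> e \<in> arcs G \<Longrightarrow> L2_on (len e) (on_edge G len e u)"
  by (simp add: L2_graph_def)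

text \<open>Elements are functions rather than classes, so a function that is not identically zero
  may have norm zero; this is why the abstract inner product is only semidefinite.\<close>

lemma semi_inner_space_L2: "semi_inner_space (L2_graph G len) (L2_inner G len)"
proof
  note I = L2_on_mult_integrable[OF L2_graphD L2_graphD]
  show "(\<lambda>x. 0) \<in> L2_graph G len"
    using L2_on_continuous[of "len _" "\<lambda>_. 0"] by (simp add: L2_graph_def on_edge_def[abs_def])
  show "(\<lambda>x. u x + v x) \<in> L2_graph G len" if "u \<in> L2_graph G len" "v \<in> L2_graph G len" for u v
    using that by (auto simp: L2_graph_def on_edge_def[abs_def] intro!: L2_on_add)
  show "(\<lambda>x. c * u x) \<in> L2_graph G len" if "u \<in> L2_graph G len" for u c
    using that by (auto simp: L2_graph_def on_edge_def[abs_def] intro!: L2_on_cmult)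
  show "L2_inner G len u v = L2_inner G len v u" for u v
    by (simp add: L2_inner_def mult.commute)
  show "L2_inner G len (\<lambda>x. u x + v x) w = L2_inner G len u w + L2_inner G len v w"
    if "u \<in> L2_graph G len" "v \<in> L2_graph G len" "w \<in> L2_graph G len" for u v w
  proof -
    have "on_edge G len e (\<lambda>x. u x + v x) t * on_edge G len e w t
      = on_edge G len e u t * on_edge G len e w t + on_edge G len e v t * on_edge G len e w t" for e t
      by (simp add: on_edge_def algebra_simps)
    then show ?thesis
      using I[OF that(1) _ that(3)] I[OF that(2) _ that(3)] by (simp add: L2_inner_def sum.distrib)
  qed
  show "L2_inner G len (\<lambda>x. c * u x) w = c * L2_inner G len u w" for c u w
  proof -
    have "on_edge G len e (\<lambda>x. c * u x) = (\<lambda>t. c * on_edge G len e u t)" for e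
      by (simp add: on_edge_def fun_eq_iff)
    then show ?thesis by (simp add: L2_inner_def sum_distrib_left mult.assoc)
  qed
  show "0 \<le> L2_inner G len u u" for u
    unfolding L2_inner_def by (intro sum_nonneg Bochner_Integration.integral_nonneg) simp
qed

lemma L2_inner_self: "L2_inner G len u u = (\<Sum>e\<in>arcs G. LINT t|lebesgue_on {0..len e}. (on_edge G len e u t)\<^sup>2)"
  by (simp add: L2_inner_def power2_eq_square)

lemma on_edge_sum: "on_edge G len e (\<lambda>x. \<Sum>i\<in>F. c i * \<psi> i x) = (\<lambda>t. \<Sum>i\<in>F. c i * on_edge G len e (\<psi> i) t)"
  by (simp add: on_edge_def fun_eq_iff)

lemma strong_solution_sum:
  assumes F: "finite F" and s: "\<And>i. i \<in> F \<Longrightarrow> strong_solution VK VD a \<kappa> (u i) (f i) (u1 i) (g i)"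
  shows "strong_solution VK VD a \<kappa> (\<lambda>x. \<Sum>i\<in>F. c i * u i x) (\<lambda>x. \<Sum>i\<in>F. c i * f i x)
    (\<lambda>e t. \<Sum>i\<in>F. c i * u1 i e t) (\<lambda>e t. \<Sum>i\<in>F. c i * g i e t)"
  unfolding strong_solution_def
proof (intro conjI ballI)
  interpret semi_inner_space "L2_graph G len" "L2_inner G len" by (rule semi_inner_space_L2)
  show "(\<lambda>x. \<Sum>i\<in>F. c i * f i x) \<in> L2_graph G len"
    using s by (intro sum_mem F) (simp add: strong_solution_def)
  show "edgewise_C1 (\<lambda>x. \<Sum>i\<in>F. c i * u i x) (\<lambda>e t. \<Sum>i\<in>F. c i * u1 i e t)"
    unfolding edgewise_C1_def on_edge_sum using s
    by (intro conjI ballI DERIV_sum DERIV_cmult continuous_intros) (auto simp: strong_solution_def edgewise_C1_def)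
next
  fix e assume e: "e \<in> arcs G"
  have gi: "g i e absolutely_integrable_on {0..len e}" if "i \<in> F" for i
    using s[OF that] e by (simp add: strong_solution_def)
  show "(\<lambda>t. \<Sum>i\<in>F. c i * g i e t) absolutely_integrable_on {0..len e}"
    using gi by (intro absolutely_integrable_sum[OF F] set_integrable_mult_right) auto
  fix t assume t: "t \<in> {0..len e}"
  have gt: "g i e integrable_on {0..t}" if "i \<in> F" for i
    using abs_integrable_sub[OF gi[OF that], of 0 t] t by (auto simp: absolutely_integrable_on_def)
  have "integral {0..t} (\<lambda>t. \<Sum>i\<in>F. c i * g i e t) = (\<Sum>i\<in>F. c i * integral {0..t} (g i e))"
    using gt by (subst integral_sum[OF F]) (auto intro!: integrable_on_mult_right)
  moreover have "on_edge G len e a t * (c i * u1 i e t) = on_edge G len e a 0 * (c i * u1 i e 0) + c i * integral {0..t} (g i e)"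
    if "i \<in> F" for i
  proof -
    have "on_edge G len e a t * u1 i e t = on_edge G len e a 0 * u1 i e 0 + integral {0..t} (g i e)"
      using s[OF that] e t unfolding strong_solution_def by blast
    then show ?thesis by (metis distrib_left mult.left_commute)
  qed
  then have "(\<Sum>i\<in>F. on_edge G len e a t * (c i * u1 i e t))
     = (\<Sum>i\<in>F. on_edge G len e a 0 * (c i * u1 i e 0) + c i * integral {0..t} (g i e))"
    by (intro sum.cong) auto
  ultimately show "on_edge G len e a t * (\<Sum>i\<in>F. c i * u1 i e t)
     = on_edge G len e a 0 * (\<Sum>i\<in>F. c i * u1 i e 0) + integral {0..t} (\<lambda>t. \<Sum>i\<in>F. c i * g i e t)"
    by (simp add: sum_distrib_left sum.distrib)
next
  fix e assume e: "e \<in> arcs G"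
  have "AE t in lebesgue_on {0..len e}. \<forall>i\<in>F. on_edge G len e (f i) t = (on_edge G len e \<kappa> t)\<^sup>2 * on_edge G len e (u i) t - g i e t"
    using s e by (intro AE_finite_allI[OF F]) (simp add: strong_solution_def)
  then show "AE t in lebesgue_on {0..len e}. on_edge G len e (\<lambda>x. \<Sum>i\<in>F. c i * f i x) t =
      (on_edge G len e \<kappa> t)\<^sup>2 * on_edge G len e (\<lambda>x. \<Sum>i\<in>F. c i * u i x) t - (\<Sum>i\<in>F. c i * g i e t)"
  proof eventually_elim
    case (elim t)
    have "(\<Sum>i\<in>F. c i * on_edge G len e (f i) t)
       = (\<Sum>i\<in>F. (on_edge G len e \<kappa> t)\<^sup>2 * (c i * on_edge G len e (u i) t) - c i * g i e t)"
      using elim by (intro sum.cong) (auto simp: right_diff_distrib mult.left_commute)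
    then show ?case by (simp add: on_edge_sum sum_subtractf sum_distrib_left)
  qed
next
  fix v assume v: "v \<in> VK"
  have "outward (\<lambda>e t. \<Sum>i\<in>F. c i * u1 i e t) x = (\<Sum>i\<in>F. c i * outward (u1 i) x)" for x
    by (cases x) (auto simp: outward_def sum_negf[symmetric])
  then have "(\<Sum>x | x \<in> arcs G \<times> UNIV \<and> start x = v. outward (\<lambda>e t. \<Sum>i\<in>F. c i * u1 i e t) x)
     = (\<Sum>i\<in>F. c i * (\<Sum>x | x \<in> arcs G \<times> UNIV \<and> start x = v. outward (u1 i) x))"
    by (simp add: sum_distrib_left) (rule sum.swap)
  also have "\<dots> = 0"
    using s v by (intro sum.neutral) (auto simp: strong_solution_def)
  finally show "(\<Sum>x | x \<in> arcs G \<times> UNIV \<and> start x = v. outward (\<lambda>e t. \<Sum>i\<in>F. c i * u1 i e t) x) = 0" .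
next
  fix v assume "v \<in> VD"
  then show "(\<Sum>i\<in>F. c i * u i (Vertex v)) = 0"
    using s by (intro sum.neutral) (auto simp: strong_solution_def)
qed

section \<open>The quadratic form and energy bounds\<close>

lemma bounded_coeff_mult_integrable:
  assumes "bounded_coeff \<kappa> c C" "e \<in> arcs G" and h: "integrable (lebesgue_on {0..len e}) h"
  shows "integrable (lebesgue_on {0..len e}) (\<lambda>t. (on_edge G len e \<kappa> t)\<^sup>2 * h t)"
proof (rule Bochner_Integration.integrable_bound)
  show "integrable (lebesgue_on {0..len e}) (\<lambda>t. C\<^sup>2 * h t)" using h by simp
  show "(\<lambda>t. (on_edge G len e \<kappa> t)\<^sup>2 * h t) \<in> borel_measurable (lebesgue_on {0..len e})"
    using assms by (auto simp: bounded_coeff_def)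
  have "AE t in lebesgue_on {0..len e}. c \<le> on_edge G len e \<kappa> t \<and> on_edge G len e \<kappa> t \<le> C"
    using assms by (simp add: bounded_coeff_def)
  then show "AE t in lebesgue_on {0..len e}. norm ((on_edge G len e \<kappa> t)\<^sup>2 * h t) \<le> norm (C\<^sup>2 * h t)"
  proof eventually_elim
    case (elim t)
    moreover have "0 < c" using assms by (simp add: bounded_coeff_def)
    ultimately have "(on_edge G len e \<kappa> t)\<^sup>2 \<le> C\<^sup>2" by (intro power_mono) auto
    then show ?case by (simp add: abs_mult mult_right_mono)
  qed
qed

text \<open>Integration by parts on every edge. The boundary terms cancel in the sum because
  \<open>w\<close> supplies the Kirchhoff condition and \<open>v\<close> the Dirichlet condition, so
  \<open>v\<close> need not solve any equation.\<close>

lemma form_identity: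
  assumes V: "VK \<union> VD = verts G"
    and a: "lipschitz_coeff a c C L" and \<kappa>: "bounded_coeff \<kappa> c' C'"
    and w: "strong_solution VK VD a \<kappa> w f w1 g"
    and v: "edgewise_C1 v v1" "\<And>x. x \<in> VD \<Longrightarrow> v (Vertex x) = 0"
  shows "L2_inner G len f v = (\<Sum>e\<in>arcs G.
     (LINT t|lebesgue_on {0..len e}. (on_edge G len e \<kappa> t)\<^sup>2 * (on_edge G len e w t * on_edge G len e v t)) +
     (LINT t|lebesgue_on {0..len e}. on_edge G len e a t * w1 e t * v1 e t))"
proof -
  have W: "edgewise_C1 w w1" using w by (simp add: strong_solution_def)
  have edge: "(LINT t|lebesgue_on {0..len e}. on_edge G len e f t * on_edge G len e v t) =
     (LINT t|lebesgue_on {0..len e}. (on_edge G len e \<kappa> t)\<^sup>2 * (on_edge G len e w t * on_edge G len e v t)) +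
     (LINT t|lebesgue_on {0..len e}. on_edge G len e a t * w1 e t * v1 e t)
     - (on_edge G len e a (len e) * w1 e (len e) * on_edge G len e v (len e) - on_edge G len e a 0 * w1 e 0 * on_edge G len e v 0)"
    if e: "e \<in> arcs G" for e
  proof -
    let ?M = "lebesgue_on {0..len e}" and ?o = "on_edge G len e"
    have g: "g e absolutely_integrable_on {0..len e}"
      and P: "\<And>t. t \<in> {0..len e} \<Longrightarrow> ?o a t * w1 e t = ?o a 0 * w1 e 0 + integral {0..t} (g e)"
      and AE: "AE t in ?M. ?o f t = (?o \<kappa> t)\<^sup>2 * ?o w t - g e t" and f: "f \<in> L2_graph G len"
      using w e unfolding strong_solution_def by blast+
    have D: "\<And>t. t \<in> {0..len e} \<Longrightarrow> (?o v has_real_derivative v1 e t) (at t within {0..len e})"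
      and v1: "continuous_on {0..len e} (v1 e)"
      using v(1) e unfolding edgewise_C1_def by blast+
    have w1: "continuous_on {0..len e} (w1 e)" using W e by (simp add: edgewise_C1_def)
    have gv: "(\<lambda>t. g e t * ?o v t) absolutely_integrable_on {0..len e}"
      by (rule abs_integrable_mult_continuous[OF g edgewise_C1_continuous[OF v(1) e]])
    have aw: "(\<lambda>t. ?o a t * w1 e t * v1 e t) absolutely_integrable_on {0..len e}"
      by (intro absolutely_integrable_continuous_real continuous_intros lipschitz_coeff_continuous[OF a e] w1 v1)
    have parts: "integral {0..len e} (\<lambda>t. g e t * ?o v t) + integral {0..len e} (\<lambda>t. ?o a t * w1 e t * v1 e t)
       = ?o a (len e) * w1 e (len e) * ?o v (len e) - ?o a 0 * w1 e 0 * ?o v 0"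
      by (rule by_parts_primitive[OF less_imp_le[OF len_pos[OF e]] g P D v1])
    have wv: "integrable ?M (\<lambda>t. ?o w t * ?o v t)"
      by (intro L2_on_mult_integrable edgewise_C1_L2[OF W e] edgewise_C1_L2[OF v(1) e])
    note kwv = bounded_coeff_mult_integrable[OF \<kappa> e wv]
    have gv': "integrable ?M (\<lambda>t. g e t * ?o v t)" using gv by (simp add: integrable_lebesgue_on_iff)
    \<comment> \<open>The equation is known only almost everywhere, which suffices under the
      integral.\<close>
    have "(LINT t|?M. ?o f t * ?o v t) = (LINT t|?M. (?o \<kappa> t)\<^sup>2 * (?o w t * ?o v t) - g e t * ?o v t)"
    proof (rule integral_cong_AE)
      show "(\<lambda>t. ?o f t * ?o v t) \<in> borel_measurable ?M"
        using L2_on_mult_integrable[OF L2_graphD[OF f e] edgewise_C1_L2(1)[OF v(1) e]] by simp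
      show "AE t in ?M. ?o f t * ?o v t = (?o \<kappa> t)\<^sup>2 * (?o w t * ?o v t) - g e t * ?o v t"
        using AE by eventually_elim (simp add: left_diff_distrib mult.assoc)
    qed (use kwv gv' in auto)
    also have "\<dots> = (LINT t|?M. (?o \<kappa> t)\<^sup>2 * (?o w t * ?o v t)) - (LINT t|?M. g e t * ?o v t)"
      using kwv gv' by simp
    finally show ?thesis
      using parts by (simp add: lebesgue_on_integral[OF gv] lebesgue_on_integral[OF aw])
  qed
  have "L2_inner G len f v = (\<Sum>e\<in>arcs G.
     (LINT t|lebesgue_on {0..len e}. (on_edge G len e \<kappa> t)\<^sup>2 * (on_edge G len e w t * on_edge G len e v t)) +
     (LINT t|lebesgue_on {0..len e}. on_edge G len e a t * w1 e t * v1 e t))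
    - (\<Sum>e\<in>arcs G. on_edge G len e a (len e) * w1 e (len e) * on_edge G len e v (len e) - on_edge G len e a 0 * w1 e 0 * on_edge G len e v 0)"
    by (simp add: L2_inner_def edge sum_subtractf[symmetric])
  also have "(\<Sum>e\<in>arcs G. on_edge G len e a (len e) * w1 e (len e) * on_edge G len e v (len e) - on_edge G len e a 0 * w1 e 0 * on_edge G len e v 0) = 0"
    by (rule sum_outward_zero[OF V]) (use w v(2) in \<open>auto simp: strong_solution_def\<close>)
  finally show ?thesis by simp
qed

text \<open>Coercivity: a solution satisfies the Dirichlet condition itself and may be inserted as
  its own test function.\<close>

lemma form_lower_bound:
  assumes V: "VK \<union> VD = verts G"
    and b: "lipschitz_coeff b c C L" and \<kappa>: "bounded_coeff \<kappa> c' C'"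
    and v: "strong_solution VK VD b \<kappa> v f v1 g"
  shows "min c (c'\<^sup>2) * (\<Sum>e\<in>arcs G. (LINT t|lebesgue_on {0..len e}. (on_edge G len e v t)\<^sup>2)
      + (LINT t|lebesgue_on {0..len e}. (v1 e t)\<^sup>2)) \<le> L2_inner G len f v"
proof -
  define m where "m = min c (c'\<^sup>2)"
  have m: "m \<le> c" "m \<le> c'\<^sup>2" by (auto simp: m_def)
  have c': "0 < c'" using \<kappa> by (simp add: bounded_coeff_def)
  have C1: "edgewise_C1 v v1" using v by (simp add: strong_solution_def)
  have "m * (LINT t|lebesgue_on {0..len e}. (on_edge G len e v t)\<^sup>2) + m * (LINT t|lebesgue_on {0..len e}. (v1 e t)\<^sup>2)
    \<le> (LINT t|lebesgue_on {0..len e}. (on_edge G len e \<kappa> t)\<^sup>2 * (on_edge G len e v t * on_edge G len e v t)) +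
     (LINT t|lebesgue_on {0..len e}. on_edge G len e b t * v1 e t * v1 e t)"
    if e: "e \<in> arcs G" for e
  proof -
    let ?M = "lebesgue_on {0..len e}" and ?o = "on_edge G len e"
    note L2 = edgewise_C1_L2[OF C1 e]
    have v1: "continuous_on {0..len e} (v1 e)" using C1 e by (simp add: edgewise_C1_def)
    have "m * (LINT t|?M. (?o v t)\<^sup>2) = (LINT t|?M. m * (?o v t)\<^sup>2)" by simp
    also have "\<dots> \<le> (LINT t|?M. (?o \<kappa> t)\<^sup>2 * (?o v t * ?o v t))"
    proof (rule integral_mono_AE)
      show "integrable ?M (\<lambda>t. m * (?o v t)\<^sup>2)" using L2(1) by (simp add: L2_on_def)
      show "integrable ?M (\<lambda>t. (?o \<kappa> t)\<^sup>2 * (?o v t * ?o v t))"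
        by (intro bounded_coeff_mult_integrable[OF \<kappa> e] L2_on_mult_integrable L2)
      have "AE t in ?M. c' \<le> ?o \<kappa> t \<and> ?o \<kappa> t \<le> C'" using \<kappa> e by (simp add: bounded_coeff_def)
      then show "AE t in ?M. m * (?o v t)\<^sup>2 \<le> (?o \<kappa> t)\<^sup>2 * (?o v t * ?o v t)"
      proof eventually_elim
        case (elim t)
        then have "c'\<^sup>2 \<le> (?o \<kappa> t)\<^sup>2" using c' by (intro power_mono) auto
        then have "m \<le> (?o \<kappa> t)\<^sup>2" using m by linarith
        then show ?case by (simp add: power2_eq_square[of "?o v t"] mult_right_mono)
      qed
    qed
    moreover have "m * (LINT t|?M. (v1 e t)\<^sup>2) = (LINT t|?M. m * (v1 e t)\<^sup>2)" by simp
    moreover have "\<dots> \<le> (LINT t|?M. ?o b t * v1 e t * v1 e t)"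
    proof (rule Bochner_Integration.integral_mono)
      show "integrable ?M (\<lambda>t. m * (v1 e t)\<^sup>2)" using L2(2) by (simp add: L2_on_def)
      show "integrable ?M (\<lambda>t. ?o b t * v1 e t * v1 e t)"
        unfolding integrable_lebesgue_on_iff
        by (intro absolutely_integrable_continuous_real continuous_intros lipschitz_coeff_continuous[OF b e] v1)
      fix t assume "t \<in> space ?M"
      then have "c \<le> ?o b t" using b e by (simp add: lipschitz_coeff_def)
      then have "m \<le> ?o b t" using m by linarith
      then show "m * (v1 e t)\<^sup>2 \<le> ?o b t * v1 e t * v1 e t"
        by (simp add: power2_eq_square mult.assoc mult_right_mono)
    qed
    ultimately show ?thesis by linarith
  qed
  then have "(\<Sum>e\<in>arcs G. m * (LINT t|lebesgue_on {0..len e}. (on_edge G len e v t)\<^sup>2) + m * (LINT t|lebesgue_on {0..len e}. (v1 e t)\<^sup>2))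
    \<le> L2_inner G len f v"
    by (subst form_identity[OF V b \<kappa> v C1]) (use v in \<open>auto simp: strong_solution_def intro!: sum_mono\<close>)
  then show ?thesis by (simp add: m_def sum_distrib_left distrib_left)
qed

text \<open>Coercivity gives a lower bound for the pairing of \<open>f\<close> with
  \<open>v\<close>; Young's inequality bounds the same pairing from above, and the part with
  \<open>v\<close> is absorbed.\<close>

lemma energy_estimate:
  assumes V: "VK \<union> VD = verts G"
    and b: "lipschitz_coeff b c C L" and \<kappa>: "bounded_coeff \<kappa> c' C'"
    and v: "strong_solution VK VD b \<kappa> v f v1 g"
  shows "(\<Sum>e\<in>arcs G. (LINT t|lebesgue_on {0..len e}. (on_edge G len e v t)\<^sup>2)
      + (LINT t|lebesgue_on {0..len e}. (v1 e t)\<^sup>2)) \<le> 4 / (min c (c'\<^sup>2))\<^sup>2 * L2_inner G len f f"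
proof -
  define m where "m = min c (c'\<^sup>2)"
  have m: "0 < m" using b \<kappa> by (simp add: m_def lipschitz_coeff_def bounded_coeff_def)
  let ?N = "\<Sum>e\<in>arcs G. (LINT t|lebesgue_on {0..len e}. (on_edge G len e v t)\<^sup>2)"
  let ?N1 = "\<Sum>e\<in>arcs G. (LINT t|lebesgue_on {0..len e}. (v1 e t)\<^sup>2)"
  have C1: "edgewise_C1 v v1" and f: "f \<in> L2_graph G len" using v by (simp_all add: strong_solution_def)
  have "m * (?N + ?N1) \<le> L2_inner G len f v"
    using form_lower_bound[OF V b \<kappa> v] by (simp add: m_def sum.distrib)
  \<comment> \<open>With the weight m / 2 half of the coercive term survives the absorption; this is
    the origin of the factor 4.\<close>
  also have "\<dots> \<le> (\<Sum>e\<in>arcs G. 1 * ((m / 2) * (LINT t|lebesgue_on {0..len e}. (on_edge G len e v t)\<^sup>2)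
       + (LINT t|lebesgue_on {0..len e}. (on_edge G len e f t)\<^sup>2) / (m / 2)))"
    unfolding L2_inner_def
  proof (rule sum_mono)
    fix e assume e: "e \<in> arcs G"
    note L2 = edgewise_C1_L2(1)[OF C1 e] L2_graphD[OF f e]
    have "\<bar>LINT t|lebesgue_on {0..len e}. on_edge G len e f t * on_edge G len e v t\<bar>
      \<le> 1 * ((m / 2) * (LINT t|lebesgue_on {0..len e}. (on_edge G len e v t)\<^sup>2)
       + (LINT t|lebesgue_on {0..len e}. (on_edge G len e f t)\<^sup>2) / (m / 2))"
      by (rule integral_young) (use L2 m in \<open>auto intro!: L2_on_mult_integrable simp: L2_on_def mult.commute\<close>)
    then show "(LINT t|lebesgue_on {0..len e}. on_edge G len e f t * on_edge G len e v t)
      \<le> 1 * ((m / 2) * (LINT t|lebesgue_on {0..len e}. (on_edge G len e v t)\<^sup>2)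
       + (LINT t|lebesgue_on {0..len e}. (on_edge G len e f t)\<^sup>2) / (m / 2))" by linarith
  qed
  also have "\<dots> = m / 2 * ?N + L2_inner G len f f / (m / 2)"
    by (simp add: sum.distrib sum_distrib_left sum_distrib_right sum_divide_distrib L2_inner_self)
  finally have "m * (?N + ?N1) \<le> m / 2 * ?N + 2 * L2_inner G len f f / m" by simp
  moreover have "0 \<le> m * ?N1" using m by (intro mult_nonneg_nonneg sum_nonneg) auto
  ultimately have "m * (?N + ?N1) \<le> 4 * L2_inner G len f f / m"
    by (simp add: distrib_left)
  then have "?N + ?N1 \<le> 4 * L2_inner G len f f / m / m"
    using m by (simp add: pos_le_divide_eq mult.commute)
  then show ?thesis by (simp add: m_def sum.distrib power2_eq_square)
qed

text \<open>With q = b v1 and r = a / b the integrand is q r w1, and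
  \<open>by_parts_lipschitz\<close> takes the derivative off \<open>w\<close>. Three terms remain
  and give the three summands of the constant: \<sigma>^2 v r w, f r w, and the Lipschitz error for
  r. The boundary term is kept, since it cancels only in the sum over the edges.\<close>

lemma form_edge_estimate:
  assumes a: "lipschitz_coeff a ca Ca La" and b: "lipschitz_coeff b cb Cb Lb"
    and \<sigma>: "bounded_coeff \<sigma> cl Cl"
    and w: "edgewise_C1 w w1" and v: "strong_solution VK VD b \<sigma> v f v1 g"
    and e: "e \<in> arcs G" and d: "0 < d"
  defines "R \<equiv> Ca / cb"
  shows "\<bar>(LINT t|lebesgue_on {0..len e}. on_edge G len e a t * v1 e t * w1 e t)
      - (on_edge G len e a (len e) * v1 e (len e) * on_edge G len e w (len e) - on_edge G len e a 0 * v1 e 0 * on_edge G len e w 0)\<bar>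
    \<le> (Cl\<^sup>2 * R + R + (La * Cb + Ca * Lb) / cb\<^sup>2 * Cb) * (d * (LINT t|lebesgue_on {0..len e}. (on_edge G len e w t)\<^sup>2)
       + ((LINT t|lebesgue_on {0..len e}. (on_edge G len e v t)\<^sup>2) + (LINT t|lebesgue_on {0..len e}. (v1 e t)\<^sup>2)
       + (LINT t|lebesgue_on {0..len e}. (on_edge G len e f t)\<^sup>2)) / d)"
proof -
  let ?M = "lebesgue_on {0..len e}" and ?o = "on_edge G len e"
  define r where "r t = ?o a t / ?o b t" for t
  define q where "q t = ?o b t * v1 e t" for t
  define Lr where "Lr = (La * Cb + Ca * Lb) / cb\<^sup>2"
  have l: "0 < len e" by (rule len_pos[OF e])
  have av: "\<And>t. t \<in> {0..len e} \<Longrightarrow> ca \<le> ?o a t \<and> ?o a t \<le> Ca" and ca: "0 < ca" "0 \<le> La"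
    using a e by (auto simp: lipschitz_coeff_def)
  have bv: "\<And>t. t \<in> {0..len e} \<Longrightarrow> cb \<le> ?o b t \<and> ?o b t \<le> Cb" and cb: "0 < cb" "0 \<le> Lb"
    using b e by (auto simp: lipschitz_coeff_def)
  have Ca: "0 < Ca" and Cb: "0 < Cb" using av[of 0] bv[of 0] l ca cb by auto
  have R: "0 \<le> R" using Ca cb by (simp add: R_def)
  have Lr: "0 \<le> Lr" using Ca Cb ca cb by (simp add: Lr_def)
  have Cl: "0 \<le> Cl\<^sup>2" by simp
  have r: "\<bar>r s - r t\<bar> \<le> Lr * \<bar>s - t\<bar>" if "s \<in> {0..len e}" "t \<in> {0..len e}" for s t
  proof -
    have lip: "\<bar>?o a s - ?o a t\<bar> \<le> La * \<bar>s - t\<bar>" "\<bar>?o b s - ?o b t\<bar> \<le> Lb * \<bar>s - t\<bar>"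
      using a b e that by (simp_all add: lipschitz_coeff_def)
    have "\<bar>?o b s\<bar> \<le> Cb" "\<bar>?o a s\<bar> \<le> Ca"
      using av[OF that(1)] bv[OF that(1)] ca cb by linarith+
    then show ?thesis
      unfolding r_def Lr_def using bv[OF that(1)] bv[OF that(2)] lip
      by (intro quotient_lipschitz[OF cb(1)]) auto
  qed
  have rb: "\<bar>r t\<bar> \<le> R" if "t \<in> {0..len e}" for t
    using av[OF that] bv[OF that] ca cb by (auto simp: r_def R_def intro!: frac_le)
  have "Lr-lipschitz_on {0..len e} r" using r Lr by (auto simp: lipschitz_on_def dist_real_def)
  then have cr: "continuous_on {0..len e} r" by (rule lipschitz_on_continuous_on)
  have V1: "edgewise_C1 v v1" and f: "f \<in> L2_graph G len" using v by (simp_all add: strong_solution_def)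
  have g: "g e absolutely_integrable_on {0..len e}"
    and P: "\<And>t. t \<in> {0..len e} \<Longrightarrow> q t = ?o b 0 * v1 e 0 + integral {0..t} (g e)"
    and AE: "AE t in ?M. ?o f t = (?o \<sigma> t)\<^sup>2 * ?o v t - g e t"
    using v e unfolding strong_solution_def q_def by blast+
  have D: "\<And>t. t \<in> {0..len e} \<Longrightarrow> (?o w has_real_derivative w1 e t) (at t within {0..len e})"
    and w1: "continuous_on {0..len e} (w1 e)" and v1: "continuous_on {0..len e} (v1 e)"
    using w V1 e unfolding edgewise_C1_def by blast+
  have cw: "continuous_on {0..len e} (?o w)" by (rule edgewise_C1_continuous[OF w e])
  have cv: "continuous_on {0..len e} (?o v)" by (rule edgewise_C1_continuous[OF V1 e])
  have cb': "continuous_on {0..len e} (?o b)" by (rule lipschitz_coeff_continuous[OF b e])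
  have ca': "continuous_on {0..len e} (?o a)" by (rule lipschitz_coeff_continuous[OF a e])
  have cq: "continuous_on {0..len e} q" unfolding q_def[abs_def] by (intro continuous_intros cb' v1)
  note L2v = edgewise_C1_L2[OF V1 e] and L2w = edgewise_C1_L2(1)[OF w e] and L2f = L2_graphD[OF f e]
  define W where "W = (LINT t|?M. (?o w t)\<^sup>2)"
  define N where "N = (LINT t|?M. (?o v t)\<^sup>2)"
  define N1 where "N1 = (LINT t|?M. (v1 e t)\<^sup>2)"
  define Nf where "Nf = (LINT t|?M. (?o f t)\<^sup>2)"
  have qr: "q t * r t = ?o a t * v1 e t" if "t \<in> {0..len e}" for t
    using bv[OF that] cb by (simp add: q_def r_def)
  have I1: "(LINT t|?M. ?o a t * v1 e t * w1 e t) = integral {0..len e} (\<lambda>t. q t * r t * w1 e t)"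
  proof -
    have "(LINT t|?M. ?o a t * v1 e t * w1 e t) = integral {0..len e} (\<lambda>t. ?o a t * v1 e t * w1 e t)"
      by (intro lebesgue_on_integral absolutely_integrable_continuous_real continuous_intros ca' v1 w1)
    also have "\<dots> = integral {0..len e} (\<lambda>t. q t * r t * w1 e t)"
      by (rule integral_cong) (simp add: qr)
    finally show ?thesis .
  qed
  have B: "\<bar>integral {0..len e} (\<lambda>t. q t * r t * w1 e t) + integral {0..len e} (\<lambda>t. g e t * r t * ?o w t)
      - (q (len e) * r (len e) * ?o w (len e) - q 0 * r 0 * ?o w 0)\<bar> \<le> Lr * integral {0..len e} (\<lambda>t. \<bar>q t * ?o w t\<bar>)"
    by (rule by_parts_lipschitz[OF less_imp_le[OF l] g P D w1 r Lr])
  have T2: "Lr * integral {0..len e} (\<lambda>t. \<bar>q t * ?o w t\<bar>) \<le> Lr * Cb * (d * W + N1 / d)"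
  proof -
    have "(\<lambda>t. \<bar>q t * ?o w t\<bar>) absolutely_integrable_on {0..len e}"
      by (intro absolutely_integrable_continuous_real continuous_intros cq cw)
    then have i: "integrable ?M (\<lambda>t. \<bar>q t * ?o w t\<bar>)"
        and eq: "integral {0..len e} (\<lambda>t. \<bar>q t * ?o w t\<bar>) = (LINT t|?M. \<bar>q t * ?o w t\<bar>)"
      by (simp_all add: integrable_lebesgue_on_iff lebesgue_on_integral)
    have "\<bar>LINT t|?M. \<bar>q t * ?o w t\<bar>\<bar> \<le> Cb * (d * W + N1 / d)"
      unfolding W_def N1_def
    proof (rule integral_young[OF i])
      show "AE t in ?M. \<bar>\<bar>q t * ?o w t\<bar>\<bar> \<le> Cb * \<bar>?o w t * v1 e t\<bar>"
      proof (rule AE_I2)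
        fix t assume "t \<in> space ?M"
        then have "\<bar>?o b t\<bar> \<le> Cb" using bv[of t] cb by auto
        then have "\<bar>?o b t\<bar> * \<bar>?o w t * v1 e t\<bar> \<le> Cb * \<bar>?o w t * v1 e t\<bar>" by (rule mult_right_mono) simp
        then show "\<bar>\<bar>q t * ?o w t\<bar>\<bar> \<le> Cb * \<bar>?o w t * v1 e t\<bar>" by (simp add: q_def abs_mult mult_ac)
      qed
    qed (use L2v L2w Cb d in \<open>auto simp: L2_on_def\<close>)
    then show ?thesis unfolding eq using Lr by (simp add: mult.assoc mult_left_mono)
  qed
  have rvw: "integrable ?M (\<lambda>t. ?o v t * r t * ?o w t)"
    unfolding integrable_lebesgue_on_iff
    by (intro absolutely_integrable_continuous_real continuous_intros cv cr cw)
  note lrvw = bounded_coeff_mult_integrable[OF \<sigma> e rvw]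
  have rw: "L2_on (len e) (\<lambda>t. r t * ?o w t)"
    by (intro L2_on_continuous continuous_intros cr cw)
  have frw: "integrable ?M (\<lambda>t. ?o f t * r t * ?o w t)"
    using L2_on_mult_integrable[OF L2f rw] by (simp add: mult.assoc)
  have grw: "(\<lambda>t. g e t * r t * ?o w t) absolutely_integrable_on {0..len e}"
    by (intro abs_integrable_mult_continuous g cr cw)
  \<comment> \<open>\<open>g\<close> by itself is only integrable. The equation expresses it through
    \<open>v\<close> and \<open>f\<close>, which are square-integrable.\<close>
  have G: "integral {0..len e} (\<lambda>t. g e t * r t * ?o w t)
     = (LINT t|?M. (?o \<sigma> t)\<^sup>2 * (?o v t * r t * ?o w t)) - (LINT t|?M. ?o f t * r t * ?o w t)"
  proof -
    have "integral {0..len e} (\<lambda>t. g e t * r t * ?o w t) = (LINT t|?M. g e t * r t * ?o w t)"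
      by (rule lebesgue_on_integral[OF grw, symmetric])
    also have "\<dots> = (LINT t|?M. (?o \<sigma> t)\<^sup>2 * (?o v t * r t * ?o w t) - ?o f t * r t * ?o w t)"
    proof (rule integral_cong_AE)
      show "AE t in ?M. g e t * r t * ?o w t = (?o \<sigma> t)\<^sup>2 * (?o v t * r t * ?o w t) - ?o f t * r t * ?o w t"
        using AE by eventually_elim (simp add: left_diff_distrib mult.assoc)
    qed (use grw lrvw frw in \<open>auto simp: integrable_lebesgue_on_iff[symmetric]\<close>)
    also have "\<dots> = (LINT t|?M. (?o \<sigma> t)\<^sup>2 * (?o v t * r t * ?o w t)) - (LINT t|?M. ?o f t * r t * ?o w t)"
      using lrvw frw by simp
    finally show ?thesis .
  qed
  have AEM: "AE t in ?M. t \<in> {0..len e}" by (rule AE_I2) simp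
  have T3: "\<bar>LINT t|?M. (?o \<sigma> t)\<^sup>2 * (?o v t * r t * ?o w t)\<bar> \<le> Cl\<^sup>2 * R * (d * W + N / d)"
    unfolding W_def N_def
  proof (rule integral_young[OF lrvw])
    have "AE t in ?M. cl \<le> ?o \<sigma> t \<and> ?o \<sigma> t \<le> Cl" using \<sigma> e by (simp add: bounded_coeff_def)
    with AEM show "AE t in ?M. \<bar>(?o \<sigma> t)\<^sup>2 * (?o v t * r t * ?o w t)\<bar> \<le> Cl\<^sup>2 * R * \<bar>?o w t * ?o v t\<bar>"
    proof eventually_elim
      case (elim t)
      moreover have "0 < cl" using \<sigma> by (simp add: bounded_coeff_def)
      ultimately have "(?o \<sigma> t)\<^sup>2 \<le> Cl\<^sup>2" by (intro power_mono) auto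
      then have "(?o \<sigma> t)\<^sup>2 * \<bar>r t\<bar> \<le> Cl\<^sup>2 * R" using rb[OF elim(1)] by (intro mult_mono) auto
      then have "((?o \<sigma> t)\<^sup>2 * \<bar>r t\<bar>) * \<bar>?o w t * ?o v t\<bar> \<le> (Cl\<^sup>2 * R) * \<bar>?o w t * ?o v t\<bar>" by (rule mult_right_mono) simp
      then show ?case by (simp add: abs_mult mult_ac)
    qed
  qed (use L2v L2w R d in \<open>auto simp: L2_on_def\<close>)
  have T4: "\<bar>LINT t|?M. ?o f t * r t * ?o w t\<bar> \<le> R * (d * W + Nf / d)"
    unfolding W_def Nf_def
  proof (rule integral_young[OF frw])
    from AEM show "AE t in ?M. \<bar>?o f t * r t * ?o w t\<bar> \<le> R * \<bar>?o w t * ?o f t\<bar>"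
    proof eventually_elim
      case (elim t)
      have "\<bar>r t\<bar> * \<bar>?o w t * ?o f t\<bar> \<le> R * \<bar>?o w t * ?o f t\<bar>" by (rule mult_right_mono[OF rb[OF elim]]) simp
      then show ?case by (simp add: abs_mult mult_ac)
    qed
  qed (use L2f L2w R d in \<open>auto simp: L2_on_def\<close>)
  have nn: "0 \<le> W" "0 \<le> N" "0 \<le> N1" "0 \<le> Nf"
    by (simp_all add: W_def N_def N1_def Nf_def)
  define Z where "Z = d * W + (N + N1 + Nf) / d"
  have Z: "d * W + N / d \<le> Z" "d * W + N1 / d \<le> Z" "d * W + Nf / d \<le> Z"
    using nn d by (simp_all add: Z_def divide_right_mono)
  have S3: "Cl\<^sup>2 * R * (d * W + N / d) \<le> Cl\<^sup>2 * R * Z" using R by (intro mult_left_mono Z) simp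
  have S4: "R * (d * W + Nf / d) \<le> R * Z" using R by (intro mult_left_mono Z)
  have S2: "Lr * Cb * (d * W + N1 / d) \<le> Lr * Cb * Z" using Lr Cb by (intro mult_left_mono Z) simp
  have "\<bar>(LINT t|?M. ?o a t * v1 e t * w1 e t) - (q (len e) * r (len e) * ?o w (len e) - q 0 * r 0 * ?o w 0)\<bar>
     \<le> Cl\<^sup>2 * R * Z + R * Z + Lr * Cb * Z"
    using B G T2 T3 T4 S2 S3 S4 unfolding I1 by linarith
  \<comment> \<open>At the ends the product is again the flux with coefficient \<open>a\<close>, the
    form required by \<open>sum_outward_zero\<close>.\<close>
  also have "q (len e) * r (len e) = ?o a (len e) * v1 e (len e)" using l by (simp add: qr)
  also have "q 0 * r 0 = ?o a 0 * v1 e 0" using l by (simp add: qr)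
  finally show ?thesis
    by (simp add: Z_def W_def N_def N1_def Nf_def Lr_def distrib_right)
qed

text \<open>\<open>K\<close> depends on neither the solutions nor \<open>d\<close>, so optimizing
  over \<open>d\<close> would give a bound by the product of the norms of \<open>w\<close> and
  \<open>fv\<close>. The derivative of \<open>w\<close> has disappeared, and that of
  \<open>v\<close> is controlled by \<open>energy_estimate\<close>.\<close>

lemma key_estimate:
  assumes V: "VK \<union> VD = verts G"
    and a: "lipschitz_coeff a ca Ca La" and \<kappa>: "bounded_coeff \<kappa> ck Ck"
    and b: "lipschitz_coeff b cb Cb Lb" and \<sigma>: "bounded_coeff \<sigma> cl Cl"
  shows "\<exists>K>0. \<forall>w fw w1 gw v fv v1 gv d. strong_solution VK VD a \<kappa> w fw w1 gw \<longrightarrow>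
     strong_solution VK VD b \<sigma> v fv v1 gv \<longrightarrow> 0 < d \<longrightarrow>
     \<bar>L2_inner G len fw v\<bar> \<le> K * (d * L2_inner G len w w + L2_inner G len fv fv / d)"
proof -
  define K0 where "K0 = Cl\<^sup>2 * (Ca / cb) + Ca / cb + (La * Cb + Ca * Lb) / cb\<^sup>2 * Cb"
  define K1 where "K1 = 4 / (min cb (cl\<^sup>2))\<^sup>2"
  \<comment> \<open>The sign of \<open>K0\<close> is not determined when there are no edges, where
    the coefficient bounds are vacuous; the absolute value makes \<open>S\<close> nonnegative in
    every case.\<close>
  define S where "S = Ck\<^sup>2 + \<bar>K0\<bar>"
  define K where "K = S * (1 + K1) + 1"
  have K1: "0 \<le> K1" and S: "0 \<le> S" by (simp_all add: K1_def S_def)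
  have K: "0 < K" using K1 S by (simp add: K_def add_nonneg_pos)
  have "\<bar>L2_inner G len fw v\<bar> \<le> K * (d * L2_inner G len w w + L2_inner G len fv fv / d)"
    if w: "strong_solution VK VD a \<kappa> w fw w1 gw" and v: "strong_solution VK VD b \<sigma> v fv v1 gv" and d: "0 < d"
    for w fw w1 gw v fv v1 gv d
  proof -
    define I where "I e h = (LINT t|lebesgue_on {0..len e}. h t)" for e and h :: "real \<Rightarrow> real"
    define W where "W e = I e (\<lambda>t. (on_edge G len e w t)\<^sup>2)" for e
    define N where "N e = I e (\<lambda>t. (on_edge G len e v t)\<^sup>2)" for e
    define N1 where "N1 e = I e (\<lambda>t. (v1 e t)\<^sup>2)" for e
    define Nf where "Nf e = I e (\<lambda>t. (on_edge G len e fv t)\<^sup>2)" for e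
    define A where "A e = I e (\<lambda>t. (on_edge G len e \<kappa> t)\<^sup>2 * (on_edge G len e w t * on_edge G len e v t))" for e
    define Bd where "Bd e = on_edge G len e a (len e) * v1 e (len e) * on_edge G len e w (len e) - on_edge G len e a 0 * v1 e 0 * on_edge G len e w 0" for e
    define T where "T e = I e (\<lambda>t. on_edge G len e a t * v1 e t * w1 e t)" for e
    define Z where "Z e = d * W e + (N e + N1 e + Nf e) / d" for e
    have w': "edgewise_C1 w w1" "\<And>x. x \<in> VD \<Longrightarrow> w (Vertex x) = 0"
      and v': "edgewise_C1 v v1" "\<And>x. x \<in> VD \<Longrightarrow> v (Vertex x) = 0" "fv \<in> L2_graph G len"
      using w v by (auto simp: strong_solution_def)
    have nn: "0 \<le> W e" "0 \<le> N e" "0 \<le> N1 e" "0 \<le> Nf e" for e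
      by (simp_all add: W_def N_def N1_def Nf_def I_def)
    have Z: "0 \<le> Z e" "d * W e + N e / d \<le> Z e" for e
      using nn[of e] d by (simp_all add: Z_def divide_right_mono)
    \<comment> \<open>In contrast to \<open>form_identity\<close>, here \<open>v\<close> supplies
      the Kirchhoff condition and \<open>w\<close> the Dirichlet condition.\<close>
    have "(\<Sum>e\<in>arcs G. Bd e) = 0"
      unfolding Bd_def by (rule sum_outward_zero[OF V]) (use v w'(2) in \<open>auto simp: strong_solution_def\<close>)
    moreover have "L2_inner G len fw v = (\<Sum>e\<in>arcs G. A e + T e)"
      by (subst form_identity[OF V a \<kappa> w v'(1,2)]) (simp_all add: A_def T_def I_def mult_ac)
    ultimately have "L2_inner G len fw v = (\<Sum>e\<in>arcs G. A e + (T e - Bd e))"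
      by (simp add: sum.distrib sum_subtractf)
    also have "\<bar>\<dots>\<bar> \<le> (\<Sum>e\<in>arcs G. \<bar>A e + (T e - Bd e)\<bar>)" by (rule sum_abs)
    also have "\<dots> \<le> (\<Sum>e\<in>arcs G. S * Z e)"
    proof (rule sum_mono)
      fix e assume e: "e \<in> arcs G"
      have "\<bar>T e - Bd e\<bar> \<le> K0 * Z e"
        using form_edge_estimate[OF a b \<sigma> w'(1) v e d]
        by (simp add: T_def Bd_def K0_def Z_def W_def N_def N1_def Nf_def I_def)
      also have "\<dots> \<le> \<bar>K0\<bar> * Z e" using Z by (intro mult_right_mono) auto
      finally have 1: "\<bar>T e - Bd e\<bar> \<le> \<bar>K0\<bar> * Z e" .
      have wv: "integrable (lebesgue_on {0..len e}) (\<lambda>t. on_edge G len e w t * on_edge G len e v t)"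
        by (intro L2_on_mult_integrable edgewise_C1_L2(1)[OF w'(1) e] edgewise_C1_L2(1)[OF v'(1) e])
      have "\<bar>A e\<bar> \<le> Ck\<^sup>2 * (d * W e + N e / d)"
        unfolding A_def I_def W_def N_def
      proof (rule integral_young[OF bounded_coeff_mult_integrable[OF \<kappa> e wv]])
        have "AE t in lebesgue_on {0..len e}. ck \<le> on_edge G len e \<kappa> t \<and> on_edge G len e \<kappa> t \<le> Ck"
          using \<kappa> e by (simp add: bounded_coeff_def)
        then show "AE t in lebesgue_on {0..len e}. \<bar>(on_edge G len e \<kappa> t)\<^sup>2 * (on_edge G len e w t * on_edge G len e v t)\<bar>
           \<le> Ck\<^sup>2 * \<bar>on_edge G len e w t * on_edge G len e v t\<bar>"
        proof eventually_elim
          case (elim t)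
          moreover have "0 < ck" using \<kappa> by (simp add: bounded_coeff_def)
          ultimately have "(on_edge G len e \<kappa> t)\<^sup>2 \<le> Ck\<^sup>2" by (intro power_mono) auto
          then show ?case by (simp add: abs_mult mult_right_mono)
        qed
      qed (use edgewise_C1_L2(1)[OF w'(1) e] edgewise_C1_L2(1)[OF v'(1) e] d in \<open>auto simp: L2_on_def\<close>)
      also have "\<dots> \<le> Ck\<^sup>2 * Z e" using Z by (intro mult_left_mono) auto
      finally have "\<bar>A e\<bar> \<le> Ck\<^sup>2 * Z e" .
      with 1 show "\<bar>A e + (T e - Bd e)\<bar> \<le> S * Z e" by (simp add: S_def distrib_right)
    qed
    also have "\<dots> = S * (d * (\<Sum>e\<in>arcs G. W e) + ((\<Sum>e\<in>arcs G. N e + N1 e) + (\<Sum>e\<in>arcs G. Nf e)) / d)"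
      by (simp add: Z_def sum.distrib sum_distrib_left[symmetric] sum_divide_distrib[symmetric])
    also have "\<dots> = S * (d * L2_inner G len w w + ((\<Sum>e\<in>arcs G. N e + N1 e) + L2_inner G len fv fv) / d)"
      by (simp add: L2_inner_self W_def Nf_def I_def)
    also have "\<dots> \<le> S * (d * L2_inner G len w w + (K1 * L2_inner G len fv fv + L2_inner G len fv fv) / d)"
      using energy_estimate[OF V b \<sigma> v] S d
      by (intro mult_left_mono add_left_mono divide_right_mono add_right_mono) (auto simp: N_def N1_def I_def K1_def)
    also have "\<dots> \<le> K * (d * L2_inner G len w w + L2_inner G len fv fv / d)"
    proof -
      define X where "X = d * L2_inner G len w w"
      define Y where "Y = L2_inner G len fv fv / d"
      have "0 \<le> L2_inner G len u u" for u by (simp add: L2_inner_self sum_nonneg)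
      then have XY: "0 \<le> X" "0 \<le> Y" using d by (simp_all add: X_def Y_def)
      have "S * (X + (K1 * Y + Y)) \<le> S * ((1 + K1) * X + (1 + K1) * Y)"
        using XY K1 S by (intro mult_left_mono) (auto simp: distrib_right)
      also have "\<dots> \<le> K * (X + Y)" using XY by (simp add: K_def algebra_simps)
      finally show ?thesis by (simp add: X_def Y_def add_divide_distrib)
    qed
    finally show ?thesis .
  qed
  with K show ?thesis by blast
qed

section \<open>From the hypotheses on the coefficients to pointwise bounds\<close>

lemma edge_pt_mem:
  assumes "e \<in> arcs G" "t \<in> {0..len e}"
  shows "edge_pt G len e t \<in> mg_points G len"
  using assms by (auto simp: edge_pt_def mg_points_def)

lemma mg_path_nonneg: "mg_path G len p q r \<Longrightarrow> 0 \<le> r"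
  by (induction rule: mg_path.induct) auto

text \<open>A single segment is one admissible path. Another route may be shorter, so only an
  inequality holds, in the direction that carries a Lipschitz bound from the graph to the
  edges.\<close>

lemma geodesic_dist_edge:
  assumes "e \<in> arcs G" "s \<in> {0..len e}" "t \<in> {0..len e}"
  shows "0 \<le> geodesic_dist G len (edge_pt G len e s) (edge_pt G len e t)"
    "geodesic_dist G len (edge_pt G len e s) (edge_pt G len e t) \<le> \<bar>s - t\<bar>"
proof -
  let ?R = "{r. mg_path G len (edge_pt G len e s) (edge_pt G len e t) r}"
  have "mg_path G len (edge_pt G len e s) (edge_pt G len e t) (0 + \<bar>t - s\<bar>)"
    by (intro mg_path.step mg_path.refl edge_pt_mem assms)
  then have mem: "\<bar>s - t\<bar> \<in> ?R" by (simp add: abs_minus_commute)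
  have lb: "r \<in> ?R \<Longrightarrow> 0 \<le> r" for r using mg_path_nonneg by blast
  show "0 \<le> geodesic_dist G len (edge_pt G len e s) (edge_pt G len e t)"
    unfolding geodesic_dist_def by (rule cInf_greatest) (use mem lb in auto)
  show "geodesic_dist G len (edge_pt G len e s) (edge_pt G len e t) \<le> \<bar>s - t\<bar>"
    unfolding geodesic_dist_def by (rule cInf_lower[OF mem bdd_belowI[of _ 0]]) (rule lb)
qed

lemma mg_lipschitz_on_edges:
  assumes "mg_lipschitz G len f"
  obtains L where "0 \<le> L" "\<And>e s t. e \<in> arcs G \<Longrightarrow> s \<in> {0..len e} \<Longrightarrow> t \<in> {0..len e} \<Longrightarrow>
    \<bar>on_edge G len e f s - on_edge G len e f t\<bar> \<le> L * \<bar>s - t\<bar>"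
proof -
  obtain L where L: "\<And>p q. p \<in> mg_points G len \<Longrightarrow> q \<in> mg_points G len \<Longrightarrow> \<bar>f p - f q\<bar> \<le> L * geodesic_dist G len p q"
    using assms unfolding mg_lipschitz_def by blast
  have "\<bar>on_edge G len e f s - on_edge G len e f t\<bar> \<le> \<bar>L\<bar> * \<bar>s - t\<bar>"
    if e: "e \<in> arcs G" "s \<in> {0..len e}" "t \<in> {0..len e}" for e s t
  proof -
    let ?d = "geodesic_dist G len (edge_pt G len e s) (edge_pt G len e t)"
    have "\<bar>on_edge G len e f s - on_edge G len e f t\<bar> \<le> L * ?d"
      unfolding on_edge_def using e by (intro L edge_pt_mem)
    \<comment> \<open>The constant in \<open>mg_lipschitz\<close> may be negative, hence the
      absolute value.\<close>
    also have "\<dots> \<le> \<bar>L\<bar> * ?d" using geodesic_dist_edge[OF e] by (intro mult_right_mono) auto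
    also have "\<dots> \<le> \<bar>L\<bar> * \<bar>s - t\<bar>" using geodesic_dist_edge[OF e] by (intro mult_left_mono) auto
    finally show ?thesis .
  qed
  then show ?thesis using that[of "\<bar>L\<bar>"] by simp
qed

text \<open>Continuity turns the essential bounds into bounds at every point, including the ends of
  the edges, where \<open>a\<close> is evaluated in the boundary terms.\<close>

lemma lipschitz_coeffI:
  assumes "a \<in> Linf_graph G len" "ess_inf_pos G len a" "mg_lipschitz G len a"
  obtains c C L where "lipschitz_coeff a c C L"
proof -
  obtain L where L: "0 \<le> L" "\<And>e s t. e \<in> arcs G \<Longrightarrow> s \<in> {0..len e} \<Longrightarrow> t \<in> {0..len e} \<Longrightarrow>
      \<bar>on_edge G len e a s - on_edge G len e a t\<bar> \<le> L * \<bar>s - t\<bar>"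
    using mg_lipschitz_on_edges[OF assms(3)] by blast
  obtain C where C: "\<And>e. e \<in> arcs G \<Longrightarrow> AE t in lebesgue_on {0..len e}. \<bar>on_edge G len e a t\<bar> \<le> C"
    using assms(1) by (auto simp: Linf_graph_def)
  obtain c where c: "0 < c" "\<And>e. e \<in> arcs G \<Longrightarrow> AE t in lebesgue_on {0..len e}. c \<le> on_edge G len e a t"
    using assms(2) by (auto simp: ess_inf_pos_def)
  have cont: "continuous_on {0..len e} (on_edge G len e a)" if "e \<in> arcs G" for e
  proof -
    have "L-lipschitz_on {0..len e} (on_edge G len e a)"
      using L that by (auto simp: lipschitz_on_def dist_real_def)
    then show ?thesis by (rule lipschitz_on_continuous_on)
  qed
  have lo: "c \<le> on_edge G len e a t" if "e \<in> arcs G" "t \<in> {0..len e}" for e t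
    by (rule continuous_AE_ge[OF len_pos cont c(2) that(2)]) (use that in auto)
  have hi: "on_edge G len e a t \<le> C" if e: "e \<in> arcs G" and t: "t \<in> {0..len e}" for e t
  proof -
    have "AE t in lebesgue_on {0..len e}. - C \<le> - on_edge G len e a t"
      using C[OF e] by eventually_elim simp
    then have "- C \<le> - on_edge G len e a t"
      using cont[OF e] by (intro continuous_AE_ge[OF len_pos[OF e] _ _ t] continuous_intros)
    then show ?thesis by simp
  qed
  have "lipschitz_coeff a c C L"
    unfolding lipschitz_coeff_def using c(1) L lo hi by blast
  then show ?thesis by (rule that)
qed

lemma bounded_coeffI:
  assumes "\<kappa> \<in> Linf_graph G len" "ess_inf_pos G len \<kappa>"
  obtains c C where "bounded_coeff \<kappa> c C"
proof -
  obtain C where C: "\<And>e. e \<in> arcs G \<Longrightarrow> on_edge G len e \<kappa> \<in> borel_measurable (lebesgue_on {0..len e}) \<and>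
      (AE t in lebesgue_on {0..len e}. \<bar>on_edge G len e \<kappa> t\<bar> \<le> C)"
    using assms(1) by (auto simp: Linf_graph_def)
  obtain c where c: "0 < c" "\<And>e. e \<in> arcs G \<Longrightarrow> AE t in lebesgue_on {0..len e}. c \<le> on_edge G len e \<kappa> t"
    using assms(2) by (auto simp: ess_inf_pos_def)
  have "AE t in lebesgue_on {0..len e}. c \<le> on_edge G len e \<kappa> t \<and> on_edge G len e \<kappa> t \<le> C"
    if "e \<in> arcs G" for e
    using c(2)[OF that] conjunct2[OF C[OF that]] by eventually_elim auto
  then have "bounded_coeff \<kappa> c C"
    using c(1) C by (simp add: bounded_coeff_def)
  then show ?thesis by (rule that)
qed

section \<open>Eigenbases and the comparison of the fractional norms\<close>

lemma coeff_one:
  "lipschitz_coeff (\<lambda>_. 1) 1 1 0" "bounded_coeff (\<lambda>_. 1) 1 1"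
  by (simp_all add: lipschitz_coeff_def bounded_coeff_def on_edge_def[abs_def])

lemma one_minus_laplacian_elliptic:
  "one_minus_laplacian G len VK VD u f \<Longrightarrow> elliptic_op G len VK VD (\<lambda>_. 1) (\<lambda>_. 1) u f"
  by (auto simp: one_minus_laplacian_def elliptic_op_def on_edge_def[abs_def])

lemma eigenbasis_family:
  assumes eb: "orthonormal_eigenbasis G len (elliptic_op G len VK VD a \<kappa>) I \<psi> \<mu>"
  shows "semi_inner_space.orthonormal (L2_graph G len) (L2_inner G len) I \<psi>"
    "semi_inner_space.complete_family (L2_graph G len) (L2_inner G len) I \<psi>"
proof -
  interpret semi_inner_space "L2_graph G len" "L2_inner G len" by (rule semi_inner_space_L2)
  have "\<psi> i \<in> L2_graph G len" if "i \<in> I" for i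
  proof -
    have "\<psi> i \<in> H2_graph G len"
      using eb that by (simp add: orthonormal_eigenbasis_def elliptic_op_def op_domain_def)
    then show ?thesis by (auto simp: H2_graph_def H2_on_def L2_graph_def)
  qed
  then show "orthonormal I \<psi>"
    using eb by (simp add: orthonormal_def orthonormal_eigenbasis_def)
  show "complete_family I \<psi>"
    unfolding complete_family_def
  proof (intro ballI allI impI)
    fix u and \<epsilon> :: real assume u: "u \<in> L2_graph G len" and e: "0 < \<epsilon>"
    have "0 < sqrt \<epsilon>" using e by simp
    then obtain F c where F: "finite F" "F \<subseteq> I" "L2_norm G len (\<lambda>x. u x - (\<Sum>i\<in>F. c i * \<psi> i x)) < sqrt \<epsilon>"
      using eb[unfolded orthonormal_eigenbasis_def, THEN conjunct2, THEN conjunct2, rule_format, OF u] by blast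
    then show "\<exists>F c. finite F \<and> F \<subseteq> I \<and>
        L2_inner G len (\<lambda>x. u x - (\<Sum>i\<in>F. c i * \<psi> i x)) (\<lambda>x. u x - (\<Sum>i\<in>F. c i * \<psi> i x)) < \<epsilon>"
      unfolding L2_norm_def real_sqrt_less_iff by blast
  qed
qed

lemma eigenbasis_strong_solution:
  assumes a: "lipschitz_coeff a c C L"
    and eb: "orthonormal_eigenbasis G len (elliptic_op G len VK VD a \<kappa>) I \<psi> \<mu>"
  obtains u1 g where "\<And>i. i \<in> I \<Longrightarrow> strong_solution VK VD a \<kappa> (\<psi> i) (\<lambda>x. \<mu> i * \<psi> i x) (u1 i) (g i)"
proof -
  have "\<exists>u1 g. strong_solution VK VD a \<kappa> (\<psi> i) (\<lambda>x. \<mu> i * \<psi> i x) u1 g" if "i \<in> I" for i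
  proof -
    have "elliptic_op G len VK VD a \<kappa> (\<psi> i) (\<lambda>x. \<mu> i * \<psi> i x)"
      using eb that by (simp add: orthonormal_eigenbasis_def)
    from elliptic_op_strong_solution[OF a this] show ?thesis by blast
  qed
  then obtain u1 g where "\<And>i. i \<in> I \<Longrightarrow> strong_solution VK VD a \<kappa> (\<psi> i) (\<lambda>x. \<mu> i * \<psi> i x) (u1 i) (g i)"
    by metis
  then show ?thesis by (rule that)
qed

text \<open>Coercivity at a normalized eigenfunction bounds the eigenvalue from below by a positive
  constant. Positivity makes the powers \<mu>^\<alpha> behave as real powers.\<close>

lemma eigenvalue_pos:
  assumes V: "VK \<union> VD = verts G" and a: "lipschitz_coeff a c C L" and \<kappa>: "bounded_coeff \<kappa> c' C'"
    and eb: "orthonormal_eigenbasis G len (elliptic_op G len VK VD a \<kappa>) I \<psi> \<mu>" and i: "i \<in> I"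
  shows "0 < \<mu> i"
proof -
  interpret semi_inner_space "L2_graph G len" "L2_inner G len" by (rule semi_inner_space_L2)
  note on = orthonormalD[OF eigenbasis_family(1)[OF eb] i]
  obtain u1 g where s: "strong_solution VK VD a \<kappa> (\<psi> i) (\<lambda>x. \<mu> i * \<psi> i x) (u1 i) (g i)"
    using eigenbasis_strong_solution[OF a eb] i by metis
  define m where "m = min c (c'\<^sup>2)"
  have m: "0 < m" using a \<kappa> by (simp add: m_def lipschitz_coeff_def bounded_coeff_def)
  have "m * L2_inner G len (\<psi> i) (\<psi> i) \<le> m * (\<Sum>e\<in>arcs G. (LINT t|lebesgue_on {0..len e}. (on_edge G len e (\<psi> i) t)\<^sup>2)
      + (LINT t|lebesgue_on {0..len e}. (u1 i e t)\<^sup>2))"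
    unfolding L2_inner_self using m by (intro mult_left_mono sum_mono) auto
  also have "\<dots> \<le> L2_inner G len (\<lambda>x. \<mu> i * \<psi> i x) (\<psi> i)"
    unfolding m_def by (rule form_lower_bound[OF V a \<kappa> s])
  also have "\<dots> = \<mu> i" using on i by (simp add: ip_scale)
  finally show ?thesis using m on(2)[OF i] by simp
qed

text \<open>One-sided, for two arbitrary pairs of coefficients: exchanging the pairs gives the
  opposite inequality. \<open>key_estimate\<close> supplies the case \<alpha> = 2 in the form that
  \<open>heinz_inequality\<close> expects.\<close>

lemma frac_norm_le:
  assumes V: "VK \<union> VD = verts G"
    and a: "lipschitz_coeff a ca Ca La" and \<kappa>: "bounded_coeff \<kappa> ck Ck"
    and b: "lipschitz_coeff b cb Cb Lb" and \<sigma>: "bounded_coeff \<sigma> cl Cl"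
    and eba: "orthonormal_eigenbasis G len (elliptic_op G len VK VD a \<kappa>) I \<psi> \<mu>"
    and ebb: "orthonormal_eigenbasis G len (elliptic_op G len VK VD b \<sigma>) J \<phi> \<nu>"
    and \<alpha>: "0 \<le> \<alpha>" "\<alpha> \<le> 2"
  shows "\<exists>C>0. \<forall>u\<in>frac_domain G len J \<phi> \<nu> \<alpha>. u \<in> frac_domain G len I \<psi> \<mu> \<alpha> \<and>
     frac_norm G len I \<psi> \<mu> \<alpha> u \<le> C * frac_norm G len J \<phi> \<nu> \<alpha> u"
proof -
  interpret semi_inner_space "L2_graph G len" "L2_inner G len" by (rule semi_inner_space_L2)
  note \<psi> = eigenbasis_family(1)[OF eba] and \<phi> = eigenbasis_family[OF ebb]
  obtain K where K: "0 < K" and est: "\<And>w fw w1 gw v fv v1 gv d. strong_solution VK VD a \<kappa> w fw w1 gw \<Longrightarrow>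
     strong_solution VK VD b \<sigma> v fv v1 gv \<Longrightarrow> 0 < d \<Longrightarrow>
     \<bar>L2_inner G len fw v\<bar> \<le> K * (d * L2_inner G len w w + L2_inner G len fv fv / d)"
    using key_estimate[OF V a \<kappa> b \<sigma>] by blast
  obtain p1 gp where p: "\<And>i. i \<in> I \<Longrightarrow> strong_solution VK VD a \<kappa> (\<psi> i) (\<lambda>x. \<mu> i * \<psi> i x) (p1 i) (gp i)"
    using eigenbasis_strong_solution[OF a eba] by blast
  obtain q1 gq where q: "\<And>j. j \<in> J \<Longrightarrow> strong_solution VK VD b \<sigma> (\<phi> j) (\<lambda>x. \<nu> j * \<phi> j x) (q1 j) (gq j)"
    using eigenbasis_strong_solution[OF b ebb] by blast
  \<comment> \<open>4 * K^2 comes from the absorption below; the maximum with 1 meets the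
    requirement of \<open>heinz_inequality\<close>.\<close>
  define C where "C = max 1 (4 * K\<^sup>2)"
  have key: "(\<Sum>i\<in>E. (\<mu> i * L2_inner G len (\<lambda>x. \<Sum>j\<in>F. c j * \<phi> j x) (\<psi> i))\<^sup>2) \<le> C * (\<Sum>j\<in>F. (\<nu> j * c j)\<^sup>2)"
    if F: "finite F" "F \<subseteq> J" and E: "finite E" "E \<subseteq> I" for F E c
  proof -
    let ?v = "\<lambda>x. \<Sum>j\<in>F. c j * \<phi> j x"
    have mem: "?v \<in> L2_graph G len" "\<And>i. i \<in> E \<Longrightarrow> \<psi> i \<in> L2_graph G len"
      using F E orthonormalD[OF \<psi>] orthonormalD[OF \<phi>(1)] by (auto intro!: sum_mem)
    \<comment> \<open>Formally the coefficients of A v in the basis \<open>\<psi>\<close>. With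
      these as coefficients of \<open>?w\<close>, the pairing of A w with v equals the squared norm
      of w, so the bilinear bound controls \<open>S\<close> in terms of itself.\<close>
    define d where "d i = \<mu> i * L2_inner G len ?v (\<psi> i)" for i
    define S where "S = (\<Sum>i\<in>E. (d i)\<^sup>2)"
    define T where "T = (\<Sum>j\<in>F. (\<nu> j * c j)\<^sup>2)"
    let ?w = "\<lambda>x. \<Sum>i\<in>E. d i * \<psi> i x"
    have fv: "(\<lambda>x. \<Sum>j\<in>F. c j * (\<nu> j * \<phi> j x)) = (\<lambda>x. \<Sum>j\<in>F. (\<nu> j * c j) * \<phi> j x)"
      by (simp add: mult_ac)
    have fw: "(\<lambda>x. \<Sum>i\<in>E. d i * (\<mu> i * \<psi> i x)) = (\<lambda>x. \<Sum>i\<in>E. (d i * \<mu> i) * \<psi> i x)"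
      by (simp add: mult_ac)
    have "strong_solution VK VD a \<kappa> ?w (\<lambda>x. \<Sum>i\<in>E. d i * (\<mu> i * \<psi> i x)) (\<lambda>e t. \<Sum>i\<in>E. d i * p1 i e t) (\<lambda>e t. \<Sum>i\<in>E. d i * gp i e t)"
      by (rule strong_solution_sum[OF E(1) p]) (use E in auto)
    moreover have "strong_solution VK VD b \<sigma> ?v (\<lambda>x. \<Sum>j\<in>F. c j * (\<nu> j * \<phi> j x)) (\<lambda>e t. \<Sum>j\<in>F. c j * q1 j e t) (\<lambda>e t. \<Sum>j\<in>F. c j * gq j e t)"
      by (rule strong_solution_sum[OF F(1) q]) (use F in auto)
    \<comment> \<open>With this weight the bound reads S \<le> S / 2 + 2 K^2 T, and half of
      \<open>S\<close> can be absorbed.\<close>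
    moreover have "0 < 1 / (2 * K)" using K by simp
    ultimately have "\<bar>L2_inner G len (\<lambda>x. \<Sum>i\<in>E. (d i * \<mu> i) * \<psi> i x) ?v\<bar>
      \<le> K * (1 / (2 * K) * L2_inner G len ?w ?w + L2_inner G len (\<lambda>x. \<Sum>j\<in>F. (\<nu> j * c j) * \<phi> j x) (\<lambda>x. \<Sum>j\<in>F. (\<nu> j * c j) * \<phi> j x) / (1 / (2 * K)))"
      unfolding fv[symmetric] fw[symmetric] by (rule est)
    moreover have "L2_inner G len (\<lambda>x. \<Sum>i\<in>E. (d i * \<mu> i) * \<psi> i x) ?v = S"
    proof -
      have "L2_inner G len (\<lambda>x. \<Sum>i\<in>E. (d i * \<mu> i) * \<psi> i x) ?v = (\<Sum>i\<in>E. (d i * \<mu> i) * L2_inner G len (\<psi> i) ?v)"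
        by (rule ip_sum[OF E(1) mem(2,1)])
      also have "\<dots> = S"
        unfolding S_def
      proof (rule sum.cong)
        fix i assume "i \<in> E"
        then have "L2_inner G len (\<psi> i) ?v = L2_inner G len ?v (\<psi> i)" by (intro ip_sym mem)
        then show "(d i * \<mu> i) * L2_inner G len (\<psi> i) ?v = (d i)\<^sup>2" by (simp add: d_def power2_eq_square)
      qed simp
      finally show ?thesis .
    qed
    ultimately have "\<bar>S\<bar> \<le> K * (1 / (2 * K) * S + T / (1 / (2 * K)))"
      by (simp only: ip_comb_self[OF \<psi> E] ip_comb_self[OF \<phi>(1) F] S_def T_def)
    then have "S \<le> K * (1 / (2 * K) * S + T / (1 / (2 * K)))" by linarith
    also have "\<dots> = S / 2 + 2 * K\<^sup>2 * T" using K by (simp add: field_simps power2_eq_square)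
    finally have "S \<le> 4 * K\<^sup>2 * T" by linarith
    also have "\<dots> \<le> C * T" unfolding C_def T_def by (intro mult_right_mono sum_nonneg) auto
    finally show ?thesis unfolding S_def T_def d_def .
  qed
  have C: "1 \<le> C" by (simp add: C_def)
  have "u \<in> frac_domain G len I \<psi> \<mu> \<alpha> \<and> frac_norm G len I \<psi> \<mu> \<alpha> u \<le> sqrt C * frac_norm G len J \<phi> \<nu> \<alpha> u"
    if u: "u \<in> frac_domain G len J \<phi> \<nu> \<alpha>" for u
  proof -
    have u': "u \<in> L2_graph G len" "(\<lambda>j. \<nu> j powr \<alpha> * (L2_inner G len u (\<phi> j))\<^sup>2) summable_on J"
      using u by (simp_all add: frac_domain_def)
    note H = heinz_inequality[OF \<psi> \<phi> eigenvalue_pos[OF V a \<kappa> eba] eigenvalue_pos[OF V b \<sigma> ebb] C key u'(1) \<alpha> u'(2)]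
    show ?thesis
      using H(1) u'(1) real_sqrt_le_mono[OF H(2)]
      by (simp add: frac_domain_def frac_norm_def real_sqrt_mult)
  qed
  moreover have "0 < sqrt C" using C by simp
  ultimately show ?thesis by blast
qed

end

theorem theorem13:
  fixes G :: "('v, 'e) pre_digraph" and len :: "'e \<Rightarrow> real"
    and VK VD :: "'v set"
    and a \<kappa> :: "('v, 'e) mg_fun"
    and I J :: "nat set" and \<psi> \<phi> :: "nat \<Rightarrow> ('v, 'e) mg_fun" and \<mu> \<nu> :: "nat \<Rightarrow> real"
    and \<alpha> :: real
  assumes graph: "compact_metric_graph G len"
    and partition: "VK \<union> VD = verts G" "VK \<inter> VD = {}"
    and a: "a \<in> Linf_graph G len" "ess_inf_pos G len a" "mg_lipschitz G len a"
    and \<kappa>: "\<kappa> \<in> Linf_graph G len" "ess_inf_pos G len \<kappa>"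
    and eigenbasis_elliptic:
      "orthonormal_eigenbasis G len (elliptic_op G len VK VD a \<kappa>) I \<psi> \<mu>"
    and eigenbasis_laplace:
      "orthonormal_eigenbasis G len (one_minus_laplacian G len VK VD) J \<phi> \<nu>"
    and \<alpha>: "0 \<le> \<alpha>" "\<alpha> \<le> 2"
  shows "equal_with_equivalent_norms
           (frac_domain G len I \<psi> \<mu> \<alpha>) (frac_norm G len I \<psi> \<mu> \<alpha>)
           (frac_domain G len J \<phi> \<nu> \<alpha>) (frac_norm G len J \<phi> \<nu> \<alpha>)"
proof -
  interpret compact_metric_graph G len by (rule graph)
  obtain ca Ca La where A: "lipschitz_coeff a ca Ca La" using lipschitz_coeffI[OF a] by blast
  obtain ck Ck where K: "bounded_coeff \<kappa> ck Ck" using bounded_coeffI[OF \<kappa>] by blast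
  have L: "orthonormal_eigenbasis G len (elliptic_op G len VK VD (\<lambda>_. 1) (\<lambda>_. 1)) J \<phi> \<nu>"
    using eigenbasis_laplace one_minus_laplacian_elliptic unfolding orthonormal_eigenbasis_def by blast
  obtain C where C: "0 < C" "\<And>u. u \<in> frac_domain G len J \<phi> \<nu> \<alpha> \<Longrightarrow> u \<in> frac_domain G len I \<psi> \<mu> \<alpha> \<and>
     frac_norm G len I \<psi> \<mu> \<alpha> u \<le> C * frac_norm G len J \<phi> \<nu> \<alpha> u"
    using frac_norm_le[OF partition(1) A K coeff_one eigenbasis_elliptic L \<alpha>] by blast
  obtain D where D: "0 < D" "\<And>u. u \<in> frac_domain G len I \<psi> \<mu> \<alpha> \<Longrightarrow> u \<in> frac_domain G len J \<phi> \<nu> \<alpha> \<and>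
     frac_norm G len J \<phi> \<nu> \<alpha> u \<le> D * frac_norm G len I \<psi> \<mu> \<alpha> u"
    using frac_norm_le[OF partition(1) coeff_one A K L eigenbasis_elliptic \<alpha>] by blast
  have eq: "frac_domain G len I \<psi> \<mu> \<alpha> = frac_domain G len J \<phi> \<nu> \<alpha>" using C D by blast
  \<comment> \<open>The lower constant is the reciprocal of the constant of the reverse
    inequality.\<close>
  have "1 / D * frac_norm G len J \<phi> \<nu> \<alpha> u \<le> frac_norm G len I \<psi> \<mu> \<alpha> u \<and>
      frac_norm G len I \<psi> \<mu> \<alpha> u \<le> C * frac_norm G len J \<phi> \<nu> \<alpha> u"
    if "u \<in> frac_domain G len I \<psi> \<mu> \<alpha>" for u
    using C(2)[of u] D(2)[OF that] D(1) by (simp add: pos_divide_le_eq mult.commute)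
  moreover have "0 < 1 / D" using D(1) by simp
  ultimately show ?thesis
    unfolding equal_with_equivalent_norms_def using eq C(1) by blast
qed

end
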